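(* (1) $\mathrm E^{\#\mathrm P}$ does not have #P-measure 0. (2) $\mathrm E^{\mathrm{SpanP}}$ does not have SpanP-measure 0. (3) $\mathrm E^{\#\mathrm P}=\mathrm E^{\mathrm{GapP}}$ does not have GapP-measure 0.
   Context: $\mathrm E^{\mathcal F}$ denotes the class of languages decidable in time $2^{O(n)}$ with oracle access to a function in $\mathcal F$. Languages are identified with their characteristic sequences in Cantor space $\mathbf C=\{0,1\}^\infty$ via the standard enumeration $s_0=\lambda,s_1=0,s_2=1,s_3=00,\dots$; $S\upharpoonright n$ is the length-$n$ prefix. A martingale is $d:\{0,1\}^*\to[0,\infty)$ with $d(w)=\frac{d(w0)+d(w1)}{2}$; it succeeds on $S$ if $\limsup_n d(S\upharpoonright n)=\infty$. #P functions count accepting paths of a polynomial-time nondeterministic Turing machine; SpanP functions count the distinct strings output by a polynomial-time nondeterministic machine that on each path outputs a string or nothing; GapP functions are accepting minus rejecting path counts of a polynomial-time nondeterministic machine. For $\Delta\in\{\#\mathrm P,\mathrm{SpanP},\mathrm{GapP}\}$, a $\Delta$-martingale is a martingale $d$ for which there are $f\in\Delta$ and a polynomial-time computable $g$ with power-of-2 values such that $|d(w)-f(w,r)/g(w,r)|\le2^{-r}$ for all $w$ and $r\in\mathbb N$ ($r$ in unary). A class $X$ has $\Delta$-measure 0 if some $\Delta$-martingale succeeds on every element of $X$. *)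

theory Defs
  imports
    "HOL-Library.Extended_Real"
    "HOL-Library.Liminf_Limsup"
    "HOL-Computational_Algebra.Polynomial"
begin

section \<open>Multi-tape Turing machines\<close>

text \<open>
  Tapes are two-way infinite. States are natural numbers and work symbols are taken from a
  countable supply; a machine is given by a finite set of transitions, so only finitely
  many states and symbols ever matter. A computation halts exactly when no transition
  applies.
\<close>

datatype sym = Blank | Bit bool | Minus | Work nat

datatype move = MLeft | MStay | MRight

fun offset :: "move \<Rightarrow> int" where
  "offset MLeft = -1"
| "offset MStay = 0"
| "offset MRight = 1"

text \<open>Old state, symbols read, new state, symbols written and head moves (one entry per tape).\<close>

type_synonym trans = "nat \<times> sym list \<times> nat \<times> (sym \<times> move) list"

record tm =
  tape_count :: nat
  start :: nat
  accept :: nat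
  delta :: "trans set"

record otm = tm +
  query :: nat
  answer :: nat

record config =
  state :: nat
  tape :: "nat \<Rightarrow> int \<Rightarrow> sym"
  pos :: "nat \<Rightarrow> int"

text \<open>
  Tape 0 is the input tape. For ordinary machines tape 1 is the output tape; for oracle
  machines tape 1 is the query tape and tape 2 the answer tape.
\<close>

definition wf_tm :: "'a tm_scheme \<Rightarrow> bool" where
  "wf_tm M \<longleftrightarrow> 2 \<le> tape_count M \<and> finite (delta M) \<and>
     (\<forall>(q, rs, q', as) \<in> delta M. length rs = tape_count M \<and> length as = tape_count M)"

definition wf_otm :: "otm \<Rightarrow> bool" where
  "wf_otm M \<longleftrightarrow> wf_tm M \<and> 3 \<le> tape_count M"

definition deterministic :: "'a tm_scheme \<Rightarrow> bool" where
  "deterministic M \<longleftrightarrow>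
     (\<forall>q rs q1 as1 q2 as2. (q, rs, q1, as1) \<in> delta M \<and> (q, rs, q2, as2) \<in> delta M
        \<longrightarrow> q1 = q2 \<and> as1 = as2)"

definition write_tape :: "sym list \<Rightarrow> int \<Rightarrow> sym" where
  "write_tape ss i = (if 0 \<le> i \<and> nat i < length ss then ss ! nat i else Blank)"

text \<open>The bit string starting in cell 0 and ending before the first cell that holds no bit.\<close>

definition read_tape :: "(int \<Rightarrow> sym) \<Rightarrow> bool list" where
  "read_tape t =
     map (\<lambda>i. t (int i) = Bit True) [0..<(LEAST n. t (int n) \<notin> range Bit)]"

definition init_config :: "'a tm_scheme \<Rightarrow> bool list \<Rightarrow> config" where
  "init_config M x =
     \<lparr>state = start M,
      tape = (\<lambda>k. write_tape (if k = 0 then map Bit x else [])),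
      pos = (\<lambda>k. 0)\<rparr>"

definition scanned :: "nat \<Rightarrow> config \<Rightarrow> sym list" where
  "scanned n c = map (\<lambda>k. tape c k (pos c k)) [0..<n]"

definition perform :: "nat \<Rightarrow> (sym \<times> move) list \<Rightarrow> config \<Rightarrow> config" where
  "perform q as c =
     \<lparr>state = q,
      tape = (\<lambda>k. if k < length as then (tape c k)(pos c k := fst (as ! k)) else tape c k),
      pos = (\<lambda>k. if k < length as then pos c k + offset (snd (as ! k)) else pos c k)\<rparr>"

definition tm_step :: "'a tm_scheme \<Rightarrow> config \<Rightarrow> config \<Rightarrow> bool" where
  "tm_step M c c' \<longleftrightarrow>
     (\<exists>q as. (state c, scanned (tape_count M) c, q, as) \<in> delta M \<and> c' = perform q as c)"

text \<open>Numbers are written in binary, least significant bit first, without superfluous zeros.\<close>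

fun nat_bits :: "nat \<Rightarrow> bool list" where
  "nat_bits n = (if n = 0 then [] else odd n # nat_bits (n div 2))"

declare nat_bits.simps [simp del]

definition int_syms :: "int \<Rightarrow> sym list" where
  "int_syms z = (if z < 0 then [Minus] else []) @ map Bit (nat_bits (nat \<bar>z\<bar>))"

text \<open>
  In the query state a single step replaces the content of the answer tape by the oracle's
  value on the query string, erases the query tape, returns the heads of these two tapes to
  cell 0 and enters the answer state.
\<close>

definition oracle_reply :: "(bool list \<Rightarrow> int) \<Rightarrow> otm \<Rightarrow> config \<Rightarrow> config" where
  "oracle_reply f M c =
     \<lparr>state = answer M,
      tape = (tape c)(1 := write_tape [], 2 := write_tape (int_syms (f (read_tape (tape c 1))))),
      pos = (pos c)(1 := 0, 2 := 0)\<rparr>"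

definition otm_step :: "(bool list \<Rightarrow> int) \<Rightarrow> otm \<Rightarrow> config \<Rightarrow> config \<Rightarrow> bool" where
  "otm_step f M c c' \<longleftrightarrow>
     (if state c = query M then c' = oracle_reply f M c else tm_step M c c')"

text \<open>A computation is a list of configurations; it takes one step fewer than its length.\<close>

definition computation :: "(config \<Rightarrow> config \<Rightarrow> bool) \<Rightarrow> config \<Rightarrow> config list \<Rightarrow> bool" where
  "computation step c cs \<longleftrightarrow> cs \<noteq> [] \<and> hd cs = c \<and> successively step cs"

definition halting_computation :: "(config \<Rightarrow> config \<Rightarrow> bool) \<Rightarrow> config \<Rightarrow> config list \<Rightarrow> bool" where
  "halting_computation step c cs \<longleftrightarrow> computation step c cs \<and> (\<nexists>c'. step (last cs) c')"

text \<open>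
  Different transitions applicable to a configuration lead to different configurations, so
  counting computations as lists of configurations counts computation paths.
\<close>

lemma perform_inject:
  assumes "perform q as c = perform q' as' c" and "length as = length as'"
  shows "q = q' \<and> as = as'"
proof -
  have q: "q = q'"
    using assms(1) by (simp add: perform_def)
  have "as ! k = as' ! k" if k: "k < length as" for k
  proof -
    have "tape (perform q as c) k (pos c k) = tape (perform q' as' c) k (pos c k)"
      and "pos (perform q as c) k = pos (perform q' as' c) k"
      using assms(1) by simp_all
    then have "fst (as ! k) = fst (as' ! k)"
      and "offset (snd (as ! k)) = offset (snd (as' ! k))"
      using k assms(2) by (simp_all add: perform_def)
    then show ?thesis
      by (cases "snd (as ! k)"; cases "snd (as' ! k)") (auto simp: prod_eq_iff)
  qed
  then show ?thesis
    using q assms(2) by (simp add: list_eq_iff_nth_eq)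
qed

section \<open>Counting classes and exponential time with a function oracle\<close>

definition poly_time :: "tm \<Rightarrow> bool" where
  "poly_time M \<longleftrightarrow>
     (\<exists>p :: nat poly. \<forall>x cs. computation (tm_step M) (init_config M x) cs
        \<longrightarrow> length cs - 1 \<le> poly p (length x))"

definition accepting_paths :: "tm \<Rightarrow> bool list \<Rightarrow> config list set" where
  "accepting_paths M x =
     {cs. halting_computation (tm_step M) (init_config M x) cs \<and> state (last cs) = accept M}"

definition rejecting_paths :: "tm \<Rightarrow> bool list \<Rightarrow> config list set" where
  "rejecting_paths M x =
     {cs. halting_computation (tm_step M) (init_config M x) cs \<and> state (last cs) \<noteq> accept M}"

text \<open>
  All three counting classes are taken as sets of integer-valued functions.
  In SpanP, a path yields an output exactly if it is accepting.
\<close>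

definition sharpP :: "(bool list \<Rightarrow> int) set" where
  "sharpP = {f. \<exists>M. wf_tm M \<and> poly_time M \<and> (\<forall>x. f x = int (card (accepting_paths M x)))}"

definition spanP :: "(bool list \<Rightarrow> int) set" where
  "spanP = {f. \<exists>M. wf_tm M \<and> poly_time M \<and>
     (\<forall>x. f x = int (card ((\<lambda>cs. read_tape (tape (last cs) 1)) ` accepting_paths M x)))}"

definition gapP :: "(bool list \<Rightarrow> int) set" where
  "gapP = {f. \<exists>M. wf_tm M \<and> poly_time M \<and>
     (\<forall>x. f x = int (card (accepting_paths M x)) - int (card (rejecting_paths M x)))}"

definition poly_time_computable :: "(bool list \<Rightarrow> nat) \<Rightarrow> bool" where
  "poly_time_computable g \<longleftrightarrow>
     (\<exists>M :: tm. wf_tm M \<and> deterministic M \<and> poly_time M \<and>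
        (\<forall>x cs. halting_computation (tm_step M) (init_config M x) cs
           \<longrightarrow> read_tape (tape (last cs) 1) = nat_bits (g x)))"

definition E_oracle :: "(bool list \<Rightarrow> int) set \<Rightarrow> bool list set set" where
  "E_oracle F = {A. \<exists>f\<in>F. \<exists>M. wf_otm M \<and> deterministic M \<and>
     (\<exists>c. \<forall>x. \<exists>cs. halting_computation (otm_step f M) (init_config M x) cs \<and>
        length cs - 1 \<le> 2 ^ (c * length x + c) \<and>
        (state (last cs) = accept M \<longleftrightarrow> x \<in> A))}"

section \<open>Martingales and measure\<close>

text \<open>The standard enumeration \<open>\<lambda>, 0, 1, 00, 01, \<dots>\<close> of all binary strings.\<close>

fun std_string :: "nat \<Rightarrow> bool list" where
  "std_string n = (if n = 0 then [] else std_string ((n - 1) div 2) @ [even n])"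

declare std_string.simps [simp del]

lemma std_string_first:
  "map std_string [0..<7] =
     [[], [False], [True], [False, False], [False, True], [True, False], [True, True]]"
  by (simp add: upt_rec std_string.simps)

lemma bij_std_string: "bij std_string"
proof (rule bijI)
  have "m = n" if "std_string m = std_string n" for m n
    using that
  proof (induction m arbitrary: n rule: less_induct)
    case (less m)
    show ?case
    proof (cases "m = 0 \<or> n = 0")
      case True
      then show ?thesis
        using less.prems by (subst (asm) (1 2) std_string.simps) (auto split: if_splits)
    next
      case False
      then have "std_string ((m - 1) div 2) = std_string ((n - 1) div 2)" "even m = even n"
        using less.prems by (subst (asm) (1 2) std_string.simps; simp)+
      then have "(m - 1) div 2 = (n - 1) div 2" "even m = even n"
        using less.IH[of "(m - 1) div 2"] False by auto
      then show ?thesis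
        using False by presburger
    qed
  qed
  then show "inj std_string"
    by (rule injI)
  have "\<exists>n. std_string n = x" for x
  proof (induction x rule: rev_induct)
    case Nil
    show ?case by (rule exI[of _ 0]) (simp add: std_string.simps)
  next
    case (snoc b x)
    then obtain n where n: "std_string n = x" by blast
    show ?case
      using n by (intro exI[of _ "if b then 2 * n + 2 else 2 * n + 1"])
        (simp add: std_string.simps[of "2 * n + 2"] std_string.simps[of "2 * n + 1"]
          std_string.simps[of "Suc (2 * n)"] std_string.simps[of "Suc (Suc (2 * n))"])
  qed
  then show "surj std_string"
    by (metis surjI)
qed

definition char_seq :: "bool list set \<Rightarrow> nat \<Rightarrow> bool" where
  "char_seq A n \<longleftrightarrow> std_string n \<in> A"

definition prefix_of :: "(nat \<Rightarrow> bool) \<Rightarrow> nat \<Rightarrow> bool list" where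
  "prefix_of S n = map S [0..<n]"

definition martingale :: "(bool list \<Rightarrow> real) \<Rightarrow> bool" where
  "martingale d \<longleftrightarrow>
     (\<forall>w. 0 \<le> d w) \<and> (\<forall>w. d w = (d (w @ [False]) + d (w @ [True])) / 2)"

definition succeeds_on :: "(bool list \<Rightarrow> real) \<Rightarrow> (nat \<Rightarrow> bool) \<Rightarrow> bool" where
  "succeeds_on d S \<longleftrightarrow> limsup (\<lambda>n. ereal (d (prefix_of S n))) = \<infinity>"

text \<open>The argument pair \<open>(w, r)\<close>, with \<open>r\<close> in unary, is encoded as the string \<open>1\<^sup>r 0 w\<close>.\<close>

definition unary_pair :: "bool list \<Rightarrow> nat \<Rightarrow> bool list" where
  "unary_pair w r = replicate r True @ False # w"

lemma unary_pair_inject: "unary_pair w r = unary_pair w' r' \<longleftrightarrow> w = w' \<and> r = r'"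
proof
  assume eq: "unary_pair w r = unary_pair w' r'"
  have *: "takeWhile id (unary_pair v s) = replicate s True" for v s
    by (induction s) (simp_all add: unary_pair_def)
  have "r = r'"
    using arg_cong[OF eq, of "takeWhile id"] by (simp add: *)
  then show "w = w' \<and> r = r'"
    using eq by (simp add: unary_pair_def)
qed simp

definition class_martingale :: "(bool list \<Rightarrow> int) set \<Rightarrow> (bool list \<Rightarrow> real) \<Rightarrow> bool" where
  "class_martingale \<Delta> d \<longleftrightarrow> martingale d \<and>
     (\<exists>f\<in>\<Delta>. \<exists>g. poly_time_computable g \<and>
        (\<forall>w r. \<exists>k. g (unary_pair w r) = 2 ^ k) \<and>
        (\<forall>w r. \<bar>d w - real_of_int (f (unary_pair w r)) / real (g (unary_pair w r))\<bar>
           \<le> 1 / 2 ^ r))"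

definition measure_zero :: "(bool list \<Rightarrow> int) set \<Rightarrow> bool list set set \<Rightarrow> bool" where
  "measure_zero \<Delta> X \<longleftrightarrow>
     (\<exists>d. class_martingale \<Delta> d \<and> (\<forall>A\<in>X. succeeds_on d (char_seq A)))"

end

theory Submission
  imports Defs
begin

text \<open>
  Let \<open>d\<close> be a martingale approximated by \<open>f / g\<close> with \<open>g\<close> a power of 2, and let \<open>m \<ge> 1\<close> be
  so large that \<open>d \<lambda> \<le> 2\<^sup>m / 2\<close>. Along the characteristic sequence built greedily, append 0
  to \<open>w\<close>, \<open>|w| = n\<close>, iff \<open>f(w1, n+2) / g(w1, n+2) \<ge> 2\<^sup>m (1 - 2\<^sup>-\<^sup>(\<^sup>n\<^sup>+\<^sup>1\<^sup>))\<close>, and 1 otherwise; then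
  \<open>d(w) \<le> 2\<^sup>m (1 - 2\<^sup>-\<^sup>(\<^sup>n\<^sup>+\<^sup>1\<^sup>))\<close> persists, by the averaging property in the first case and directly in
  the second. Since \<open>g\<close> is a power of 2, the comparison only inspects the leading digits of \<open>f\<close>.
  The \<open>N\<close>-th bit needs \<open>N + 1\<close> queries to \<open>f\<close> of length linear in \<open>N < 2\<^sup>|\<^sup>x\<^sup>|\<^sup>+\<^sup>1\<close>, so the language is in
  \<open>E\<close> with oracle \<open>f\<close> itself; the class of \<open>f\<close> plays no role.

  For \<open>E\<close> with #P and GapP oracles: a #P function is a gap, as every rejecting path can be split
  into an accepting and a rejecting one. Conversely the #P function that counts the accepting paths
  on \<open>0x\<close> and the rejecting paths on \<open>1x\<close> determines the gap on \<open>x\<close> by a subtraction, whose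
  operands have length polynomial in \<open>|x|\<close>.

  Machines are obtained by compiling while-programs over finite automata with actions on tapes.
  Embedded machines run in lockstep with a tape that marks the initial position of their tape 1,
  and with a tape that counts steps; these make it possible to find the origin of tape 1 and to erase
  all tapes afterwards.
\<close>

section \<open>While-programs for oracle machines\<close>

text \<open>The threshold has n + 1 leading binary ones followed by zeros, so reaching it means
  showing n + 1 ones below the leading position, and the prefix \<open>w\<close>, of length n, is
  itself the ruler that counts them. Precision n + 2 is what the growth of the thresholds can pay
  for: consecutive ones differ by at least 2^-(n+2). Three features of the machine model shape the
  programs. Tapes are two-way infinite and have no end markers, while queries and outputs are read
  from cell 0; an embedded machine thus leaves its output at a place that no symbol identifies, and
  its other tapes dirty over an unknown range. An oracle machine has one query state and one answer
  state, so a program may contain \<open>Query\<close> only once, and repeated queries, in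
  particular the two #P queries that replace one GapP query, must come from loops. Finally,
  transition sets are finite, so compiled code is correct only on stores over a fixed finite
  alphabet. In the subtraction the sign is known only after the last borrow, so both differences are
  formed in one pass and the right one is selected afterwards.\<close>

type_synonym stape = "(int \<Rightarrow> sym) \<times> int"
type_synonym store = "nat \<Rightarrow> stape"
type_synonym acts = "(nat \<times> sym \<times> move) list"
type_synonym aut = "nat \<Rightarrow> (nat \<Rightarrow> sym) \<Rightarrow> nat option \<times> acts"

definition rd :: "stape \<Rightarrow> sym" where
  "rd T = fst T (snd T)"

definition wr :: "sym \<times> move \<Rightarrow> stape \<Rightarrow> stape" where
  "wr a T = ((fst T)(snd T := fst a), snd T + offset (snd a))"

definition app :: "acts \<Rightarrow> store \<Rightarrow> store" where
  "app al st = (\<lambda>j. case map_of al j of None \<Rightarrow> st j | Some a \<Rightarrow> wr a (st j))"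

text \<open>Tapes from \<open>k\<close> on read as \<open>Blank\<close>, so that a program sees
  exactly what a machine with \<open>k\<close> tapes scans.\<close>

definition scan :: "nat \<Rightarrow> store \<Rightarrow> nat \<Rightarrow> sym" where
  "scan k st = (\<lambda>j. if j < k then rd (st j) else Blank)"

lemma app_Nil [simp]: "app [] st = st"
  by (simp add: app_def)

lemma app_Cons [simp]: "app ((i, a) # al) st = (app al st)(i := wr a (st i))"
  by (auto simp: app_def)

lemma scan_less [simp]: "j < k \<Longrightarrow> scan k st j = rd (st j)"
  by (simp add: scan_def)

text \<open>The number in \<open>Aut\<close> is the number of states reserved in the compiled
  machine. Automata and tests are arbitrary functions here; finiteness is imposed by
  \<open>wf_prog\<close> over a finite alphabet.\<close>

datatype prog = Aut nat aut | Seq prog prog | While "(nat \<Rightarrow> sym) \<Rightarrow> bool" prog | Query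

inductive arun :: "nat \<Rightarrow> aut \<Rightarrow> nat \<Rightarrow> store \<Rightarrow> nat \<Rightarrow> store \<Rightarrow> bool" for k d where
  stop: "d q (scan k st) = (None, al) \<Longrightarrow> arun k d q st 1 (app al st)"
| go: "d q (scan k st) = (Some q', al) \<Longrightarrow> arun k d q' (app al st) t st' \<Longrightarrow> arun k d q st (Suc t) st'"

inductive exec :: "nat \<Rightarrow> (bool list \<Rightarrow> int) \<Rightarrow> prog \<Rightarrow> store \<Rightarrow> nat \<Rightarrow> store \<Rightarrow> bool" for k f where
  Aut: "arun k d 0 st t st' \<Longrightarrow> exec k f (Aut n d) st t st'"
| Seq: "exec k f p st t st1 \<Longrightarrow> exec k f q st1 t' st2 \<Longrightarrow> exec k f (Seq p q) st (t + t') st2"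
| While_False: "\<not> c (scan k st) \<Longrightarrow> exec k f (While c p) st 1 st"
| While_True: "c (scan k st) \<Longrightarrow> exec k f p st t st1 \<Longrightarrow> exec k f (While c p) st1 t' st2
     \<Longrightarrow> exec k f (While c p) st (Suc (t + t')) st2"
| Query: "exec k f Query st 1
     (st(1 := (write_tape [], 0), 2 := (write_tape (int_syms (f (read_tape (fst (st 1))))), 0)))"

fun plen :: "prog \<Rightarrow> nat" where
  "plen (Aut n d) = n"
| "plen (Seq p q) = plen p + plen q"
| "plen (While c p) = Suc (plen p)"
| "plen Query = 1"

fun queries :: "prog \<Rightarrow> nat" where
  "queries (Aut n d) = 0"
| "queries (Seq p q) = queries p + queries q"
| "queries (While c p) = queries p"
| "queries Query = 1"

definition env :: "nat \<Rightarrow> sym list \<Rightarrow> nat \<Rightarrow> sym" where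
  "env k rs = (\<lambda>j. if j < k then rs ! j else Blank)"

definition mkact :: "nat \<Rightarrow> sym list \<Rightarrow> acts \<Rightarrow> (sym \<times> move) list" where
  "mkact k rs al = map (\<lambda>j. case map_of al j of None \<Rightarrow> (rs ! j, MStay) | Some a \<Rightarrow> a) [0..<k]"

definition words :: "nat \<Rightarrow> sym set \<Rightarrow> sym list set" where
  "words k S = {rs. set rs \<subseteq> S \<and> length rs = k}"

text \<open>The code of a program occupies the states from \<open>s\<close> on and leaves to state \<open>e\<close>.\<close>

fun code :: "nat \<Rightarrow> sym set \<Rightarrow> prog \<Rightarrow> nat \<Rightarrow> nat \<Rightarrow> trans set" where
  "code k S (Aut n d) s e = (\<lambda>(q, rs). (s + q, rs,
       case fst (d q (env k rs)) of None \<Rightarrow> e | Some q' \<Rightarrow> s + q', mkact k rs (snd (d q (env k rs)))))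
     ` ({..<n} \<times> words k S)"
| "code k S (Seq p q) s e = code k S p s (s + plen p) \<union> code k S q (s + plen p) e"
| "code k S (While c p) s e =
     (\<lambda>rs. (s, rs, if c (env k rs) then Suc s else e, mkact k rs [])) ` words k S
     \<union> code k S p (Suc s) s"
| "code k S Query s e = {}"

fun wf_prog :: "nat \<Rightarrow> sym set \<Rightarrow> prog \<Rightarrow> bool" where
  "wf_prog k S (Aut n d) \<longleftrightarrow> 0 < n \<and> (\<forall>q s. q < n \<longrightarrow> (\<forall>j. s j \<in> S) \<longrightarrow>
      (\<forall>q'. fst (d q s) = Some q' \<longrightarrow> q' < n) \<and> (\<forall>(j, x, m) \<in> set (snd (d q s)). j < k \<and> x \<in> S))"
| "wf_prog k S (Seq p q) \<longleftrightarrow> wf_prog k S p \<and> wf_prog k S q"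
| "wf_prog k S (While c p) \<longleftrightarrow> wf_prog k S p"
| "wf_prog k S Query \<longleftrightarrow> True"

text \<open>Compatibility of a machine with query state \<open>Q\<close> and answer state
  \<open>A\<close> with the layout produced by \<open>code\<close>: the state allotted to
  \<open>Query\<close> must be \<open>Q\<close> with exit \<open>A\<close>, and no ordinary state
  may be \<open>Q\<close>, since \<open>otm_step\<close> ignores transitions there.\<close>

fun query_at :: "prog \<Rightarrow> nat \<Rightarrow> nat \<Rightarrow> nat \<Rightarrow> nat \<Rightarrow> bool" where
  "query_at (Aut n d) s e Q A \<longleftrightarrow> Q < s \<or> s + n \<le> Q"
| "query_at (Seq p q) s e Q A \<longleftrightarrow> query_at p s (s + plen p) Q A \<and> query_at q (s + plen p) e Q A"
| "query_at (While c p) s e Q A \<longleftrightarrow> s \<noteq> Q \<and> query_at p (Suc s) s Q A"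
| "query_at Query s e Q A \<longleftrightarrow> s = Q \<and> e = A"

lemma query_at_outside: "queries p = 0 \<Longrightarrow> Q < s \<or> s + plen p \<le> Q \<Longrightarrow> query_at p s e Q A"
  by (induction p arbitrary: s e) auto

text \<open>The place and the exit of the only \<open>Query\<close> dictate the two special states;
  with two occurrences their demands would clash.\<close>

lemma query_at_exists:
  assumes "queries p = 1"
  shows "\<exists>Q A. s \<le> Q \<and> Q < s + plen p \<and> query_at p s e Q A"
  using assms
proof (induction p arbitrary: s e)
  case (Seq p q)
  show ?case
  proof (cases "queries p = 1")
    case True
    then obtain Q A where "s \<le> Q" "Q < s + plen p" "query_at p s (s + plen p) Q A"
      using Seq.IH(1) by blast
    moreover have "query_at q (s + plen p) e Q A"
      using Seq.prems True calculation by (intro query_at_outside) auto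
    ultimately show ?thesis by (intro exI[of _ Q] exI[of _ A]) auto
  next
    case False
    then have "queries q = 1" "queries p = 0" using Seq.prems by auto
    then obtain Q A where "s + plen p \<le> Q" "Q < s + plen p + plen q" "query_at q (s + plen p) e Q A"
      using Seq.IH(2) by blast
    moreover have "query_at p s (s + plen p) Q A"
      using \<open>queries p = 0\<close> calculation by (intro query_at_outside) auto
    ultimately show ?thesis by (intro exI[of _ Q] exI[of _ A]) auto
  qed
next
  case (While c p)
  then obtain Q A where "Suc s \<le> Q" "Q < Suc s + plen p" "query_at p (Suc s) s Q A"
    by fastforce
  then show ?case by (intro exI[of _ Q] exI[of _ A]) auto
qed auto

lemma finite_words: "finite S \<Longrightarrow> finite (words k S)"
  unfolding words_def by (rule finite_lists_length_eq)

lemma finite_code: "finite S \<Longrightarrow> finite (code k S p s e)"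
  by (induction p arbitrary: s e) (auto intro!: finite_imageI finite_cartesian_product finite_words)

lemma length_mkact [simp]: "length (mkact k rs al) = k"
  by (simp add: mkact_def)

lemma code_range:
  "(q, rs, q', as) \<in> code k S p s e \<Longrightarrow> s \<le> q \<and> q < s + plen p \<and> length rs = k \<and> length as = k"
  by (induction p arbitrary: s e) (fastforce simp: words_def)+

lemma code_functional:
  "(q, rs, q1, as1) \<in> code k S p s e \<Longrightarrow> (q, rs, q2, as2) \<in> code k S p s e \<Longrightarrow> q1 = q2 \<and> as1 = as2"
proof (induction p arbitrary: s e)
  case (Seq p1 p2)
  then show ?case
    using code_range[of q rs q1 as1 k S p1] code_range[of q rs q2 as2 k S p1]
      code_range[of q rs q1 as1 k S p2] code_range[of q rs q2 as2 k S p2]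
    by (simp only: code.simps Un_iff) (meson linorder_not_less)
next
  case (While c p)
  then show ?case
    using code_range[of q rs q1 as1 k S p "Suc s" s] code_range[of q rs q2 as2 k S p "Suc s" s]
    by auto
qed auto

definition cfg :: "nat \<Rightarrow> store \<Rightarrow> config" where
  "cfg q st = \<lparr>state = q, tape = (\<lambda>j. fst (st j)), pos = (\<lambda>j. snd (st j))\<rparr>"

text \<open>Compiled code has transitions only for words over the finite set \<open>S\<close>; this
  invariant guarantees that one is always available.\<close>

definition over :: "sym set \<Rightarrow> store \<Rightarrow> bool" where
  "over S st \<longleftrightarrow> (\<forall>j i. fst (st j) i \<in> S)"

lemma state_cfg [simp]: "state (cfg q st) = q"
  by (simp add: cfg_def)

lemma scanned_cfg: "scanned k (cfg q st) = map (\<lambda>j. rd (st j)) [0..<k]"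
  by (simp add: scanned_def cfg_def rd_def)

lemma env_scanned: "env k (scanned k (cfg q st)) = scan k st"
  by (auto simp: env_def scan_def scanned_cfg)

lemma scanned_words: "over S st \<Longrightarrow> scanned k (cfg q st) \<in> words k S"
  by (auto simp: words_def scanned_cfg over_def rd_def)

lemma perform_mkact:
  assumes "\<forall>(j, x, m) \<in> set al. j < k"
  shows "perform q (mkact k (scanned k (cfg q0 st)) al) (cfg q0 st) = cfg q (app al st)"
proof -
  have none: "map_of al j = None" if "\<not> j < k" for j
    using assms that by (fastforce simp: map_of_eq_None_iff)
  show ?thesis
    by (auto simp: perform_def cfg_def fun_eq_iff app_def mkact_def scanned_def wr_def none rd_def
        split: option.splits)
qed

lemma over_app: "over S st \<Longrightarrow> \<forall>(j, x, m) \<in> set al. x \<in> S \<Longrightarrow> over S (app al st)"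
  by (auto simp: over_def app_def wr_def dest!: map_of_SomeD split: option.splits)

lemma over_scan: "over S st \<Longrightarrow> Blank \<in> S \<Longrightarrow> scan k st j \<in> S"
  by (auto simp: over_def scan_def rd_def)

lemma write_tape_over: "set xs \<subseteq> S \<Longrightarrow> Blank \<in> S \<Longrightarrow> write_tape xs i \<in> S"
  by (auto simp: write_tape_def)

text \<open>Contains whatever an input or an oracle reply can place on a tape, and the work symbols
  of all programs below, which serve as marks, flags and encoded pairs of digits.\<close>

definition basic :: "sym set" where
  "basic = {Blank, Minus, Bit False, Bit True, Work 0, Work 1, Work 2, Work 3}"

lemma int_syms_over: "basic \<subseteq> S \<Longrightarrow> set (int_syms z) \<subseteq> S"
proof -
  have "Bit b \<in> basic" "Minus \<in> basic" for b
    by (cases b; simp add: basic_def)+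
  then show "basic \<subseteq> S \<Longrightarrow> set (int_syms z) \<subseteq> S"
    by (auto simp: int_syms_def)
qed

lemma relpowp_Suc_0: "R ^^ Suc 0 = (R :: 'a \<Rightarrow> 'a \<Rightarrow> bool)"
  by (auto simp: fun_eq_iff)

lemma otm_step_code:
  assumes "state c \<noteq> query M" "(state c, scanned (tape_count M) c, q, as) \<in> delta M"
  shows "otm_step f M c (perform q as c)"
  using assms by (auto simp: otm_step_def tm_step_def)

lemma wf_prog_AutD:
  assumes "wf_prog k S (Aut n d)" "q < n" "\<And>j. s j \<in> S" "d q s = (nq, al)"
  shows "\<forall>(j, x, m) \<in> set al. j < k \<and> x \<in> S" "nq = Some q' \<Longrightarrow> q' < n"
proof -
  have "(\<forall>q'. fst (d q s) = Some q' \<longrightarrow> q' < n) \<and> (\<forall>(j, x, m) \<in> set (snd (d q s)). j < k \<and> x \<in> S)"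
    using assms(1,2,3) by (simp only: wf_prog.simps) blast
  then show "\<forall>(j, x, m) \<in> set al. j < k \<and> x \<in> S" "nq = Some q' \<Longrightarrow> q' < n"
    using assms(4) by simp_all
qed

lemma arun_otm:
  assumes "arun k d q st t st'" "q < n" "over S st" "basic \<subseteq> S" "wf_prog k S (Aut n d)"
    and M: "code k S (Aut n d) s e \<subseteq> delta M" "tape_count M = k" "query M < s \<or> s + n \<le> query M"
  shows "(otm_step f M ^^ t) (cfg (s + q) st) (cfg e st') \<and> over S st'"
  using assms(1,2,3)
proof (induction rule: arun.induct)
  case (stop q st al)
  have S: "scan k st j \<in> S" for j
    using stop.prems assms(4) by (intro over_scan) (auto simp: basic_def)
  then have al: "\<forall>(j, x, m) \<in> set al. j < k \<and> x \<in> S"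
    by (rule wf_prog_AutD(1)[OF assms(5) stop.prems(1) _ stop.hyps])
  let ?rs = "scanned k (cfg (s + q) st)"
  have "(s + q, ?rs, e, mkact k ?rs al) \<in> code k S (Aut n d) s e"
    using stop.hyps stop.prems(1)
    by (auto simp: image_iff env_scanned intro!: bexI[of _ "(q, ?rs)"] scanned_words[OF stop.prems(2)])
  then have "otm_step f M (cfg (s + q) st) (perform e (mkact k ?rs al) (cfg (s + q) st))"
    using M stop.prems(1) by (intro otm_step_code) auto
  then show ?case
    using al by (subst (asm) perform_mkact) (auto simp: relpowp_Suc_0 simp del: relpowp.simps intro!: over_app stop.prems)
next
  case (go q st q' al t st')
  have S: "scan k st j \<in> S" for j
    using go.prems assms(4) by (intro over_scan) (auto simp: basic_def)
  then have al: "\<forall>(j, x, m) \<in> set al. j < k \<and> x \<in> S" and q': "q' < n"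
    using wf_prog_AutD[OF assms(5) go.prems(1) S go.hyps(1)] by auto
  let ?rs = "scanned k (cfg (s + q) st)"
  have "(s + q, ?rs, s + q', mkact k ?rs al) \<in> code k S (Aut n d) s e"
    using go.hyps go.prems(1)
    by (auto simp: image_iff env_scanned intro!: bexI[of _ "(q, ?rs)"] scanned_words[OF go.prems(2)])
  then have "otm_step f M (cfg (s + q) st) (perform (s + q') (mkact k ?rs al) (cfg (s + q) st))"
    using M go.prems(1) by (intro otm_step_code) auto
  then have "otm_step f M (cfg (s + q) st) (cfg (s + q') (app al st))"
    using al by (subst (asm) perform_mkact) auto
  moreover have "over S (app al st)"
    using al by (intro over_app go.prems) auto
  ultimately show ?case
    using go.IH q' relpowp_Suc_I2 by fast
qed

text \<open>Correctness of the compiler. Each execution rule corresponds to a stretch of machine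
  steps of the same length; the body of a loop has the state of the loop test as its exit, which
  closes the cycle.\<close>

theorem exec_otm:
  assumes "exec k f p st t st'" "over S st" "basic \<subseteq> S" "wf_prog k S p"
    and "code k S p s e \<subseteq> delta M" "tape_count M = k" "query_at p s e (query M) (answer M)"
  shows "(otm_step f M ^^ t) (cfg s st) (cfg e st') \<and> over S st'"
  using assms
proof (induction arbitrary: s e rule: exec.induct)
  case (Aut d st t st' n)
  then show ?case
    using arun_otm[of k d 0 st t st' n S s e M f] by simp
next
  case (Seq p st t st1 q t' st2)
  have "(otm_step f M ^^ t) (cfg s st) (cfg (s + plen p) st1)" "over S st1"
    using Seq.IH(1)[of s "s + plen p"] Seq.prems by auto
  moreover from this have "(otm_step f M ^^ t') (cfg (s + plen p) st1) (cfg e st2)" "over S st2"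
    using Seq.IH(2)[of "s + plen p" e] Seq.prems by auto
  ultimately show ?case
    by (auto simp: relpowp_add)
next
  case (While_False c st p)
  let ?rs = "scanned k (cfg s st)"
  have "(s, ?rs, e, mkact k ?rs []) \<in> code k S (While c p) s e"
    using While_False.hyps scanned_words[OF While_False.prems(1)] by (auto simp: image_iff env_scanned)
  then have "otm_step f M (cfg s st) (perform e (mkact k ?rs []) (cfg s st))"
    using While_False.prems by (intro otm_step_code) auto
  then show ?case
    using While_False.prems by (subst (asm) perform_mkact) (auto simp: relpowp_Suc_0 simp del: relpowp.simps)
next
  case (While_True c st p t st1 t' st2)
  let ?rs = "scanned k (cfg s st)"
  have "(s, ?rs, Suc s, mkact k ?rs []) \<in> code k S (While c p) s e"
    using While_True.hyps scanned_words[OF While_True.prems(1)] by (auto simp: image_iff env_scanned)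
  then have "otm_step f M (cfg s st) (perform (Suc s) (mkact k ?rs []) (cfg s st))"
    using While_True.prems by (intro otm_step_code) auto
  then have 1: "otm_step f M (cfg s st) (cfg (Suc s) st)"
    by (subst (asm) perform_mkact) auto
  have 2: "(otm_step f M ^^ t) (cfg (Suc s) st) (cfg s st1)" "over S st1"
    using While_True.IH(1)[of "Suc s" s] While_True.prems by auto
  have 3: "(otm_step f M ^^ t') (cfg s st1) (cfg e st2)" "over S st2"
    using While_True.IH(2)[of s e] While_True.prems 2(2) by auto
  have "(otm_step f M ^^ (t + t')) (cfg (Suc s) st) (cfg e st2)"
    using 2 3 by (auto simp: relpowp_add)
  with 1 3(2) show ?case
    using relpowp_Suc_I2 by fast
next
  case (Query st)
  have "otm_step f M (cfg s st) (oracle_reply f M (cfg s st))"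
    using Query.prems by (auto simp: otm_step_def)
  moreover have "oracle_reply f M (cfg s st) = cfg e (st(1 := (write_tape [], 0),
      2 := (write_tape (int_syms (f (read_tape (fst (st 1))))), 0)))"
    using Query.prems by (auto simp: oracle_reply_def cfg_def fun_eq_iff)
  moreover have "Blank \<in> S" using Query.prems by (auto simp: basic_def)
  then have "over S (st(1 := (write_tape [], 0),
      2 := (write_tape (int_syms (f (read_tape (fst (st 1))))), 0)))"
    using Query.prems by (auto simp: over_def intro!: write_tape_over dest: subsetD[OF int_syms_over])
  ultimately show ?case
    by (simp add: relpowp_Suc_0 del: relpowp.simps fun_upd_apply)
qed

section \<open>From executions of programs to languages in E\<close>

lemma relpowp_computation:
  "(step ^^ t) c c' \<longleftrightarrow> (\<exists>cs. computation step c cs \<and> length cs = Suc t \<and> last cs = c')"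
proof (induction t arbitrary: c)
  case 0
  show ?case
    by (auto simp: computation_def length_Suc_conv intro!: exI[of _ "[c']"])
next
  case (Suc t)
  show ?case
  proof
    assume "(step ^^ Suc t) c c'"
    then obtain c1 where "step c c1" "(step ^^ t) c1 c'"
      by (meson relpowp_Suc_D2)
    then obtain cs where "computation step c1 cs" "length cs = Suc t" "last cs = c'"
      using Suc.IH by blast
    then show "\<exists>cs. computation step c cs \<and> length cs = Suc (Suc t) \<and> last cs = c'"
      using \<open>step c c1\<close> by (intro exI[of _ "c # cs"]) (auto simp: computation_def successively_Cons)
  next
    assume "\<exists>cs. computation step c cs \<and> length cs = Suc (Suc t) \<and> last cs = c'"
    then obtain c1 cs where "computation step c (c # c1 # cs)" "length (c1 # cs) = Suc t"
      "last (c1 # cs) = c'"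
      by (auto simp: computation_def length_Suc_conv)
    then have "step c c1" "computation step c1 (c1 # cs)" "length (c1 # cs) = Suc t" "last (c1 # cs) = c'"
      by (auto simp: computation_def)
    then show "(step ^^ Suc t) c c'"
      using Suc.IH relpowp_Suc_I2 by metis
  qed
qed

definition init_store :: "bool list \<Rightarrow> store" where
  "init_store x = (\<lambda>j. (write_tape (if j = 0 then map Bit x else []), 0))"

definition runs :: "nat \<Rightarrow> (bool list \<Rightarrow> int) \<Rightarrow> prog \<Rightarrow> store \<Rightarrow> nat \<Rightarrow> store \<Rightarrow> bool" where
  "runs k f p st n st' \<longleftrightarrow> (\<exists>t\<le>n. exec k f p st t st')"

theorem E_oracleI:
  assumes "f \<in> F" and k: "3 \<le> k" and S: "finite S" "basic \<subseteq> S" and p: "wf_prog k S p" "queries p = 1"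
    and run: "\<And>x. \<exists>st'. runs k f p (init_store x) (2 ^ (c * length x + c)) st' \<and> (acc (scan k st') \<longleftrightarrow> x \<in> A)"
  shows "A \<in> E_oracle F"
proof -
  define e where "e = plen p"
  obtain Q R where Q: "Q < e" "query_at p 0 e Q R"
    using query_at_exists[OF p(2), of 0 e] by (auto simp: e_def)
  \<comment> \<open>State \<open>e\<close> is the exit of the code and \<open>Suc e\<close> the
    accepting state. In \<open>e\<close> a transition exists exactly for the accepting readings, so
    a rejecting run halts in \<open>e\<close> itself.\<close>
  define M :: otm where "M = \<lparr>tape_count = k, start = 0, accept = Suc e,
    delta = code k S p 0 e \<union> (\<lambda>rs. (e, rs, Suc e, mkact k rs [])) ` {rs \<in> words k S. acc (env k rs)},
    query = Q, answer = R\<rparr>"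
  have "wf_otm M"
    using k S by (auto simp: wf_otm_def wf_tm_def M_def finite_code finite_words
        dest: code_range intro!: finite_imageI finite_subset[OF _ finite_words[of S k]])
      (auto simp: words_def)
  moreover have "deterministic M"
    unfolding deterministic_def
  proof (intro allI impI, elim conjE)
    fix q rs q1 as1 q2 as2
    assume "(q, rs, q1, as1) \<in> delta M" "(q, rs, q2, as2) \<in> delta M"
    moreover have "q \<noteq> e" if "(q, rs, q', as) \<in> code k S p 0 e" for q' as
      using code_range[OF that] by (simp add: e_def)
    ultimately show "q1 = q2 \<and> as1 = as2"
      using code_functional[of q rs q1 as1 k S p 0 e q2 as2] by (auto simp: M_def)
  qed
  moreover have "\<exists>cs. halting_computation (otm_step f M) (init_config M x) cs \<and>
        length cs - 1 \<le> 2 ^ (Suc c * length x + Suc c) \<and> (state (last cs) = accept M \<longleftrightarrow> x \<in> A)" for x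
  proof -
    obtain t st' where t: "t \<le> 2 ^ (c * length x + c)" "exec k f p (init_store x) t st'"
      and acc: "acc (scan k st') \<longleftrightarrow> x \<in> A"
      using run[of x] by (auto simp: runs_def)
    have init: "init_config M x = cfg 0 (init_store x)"
      by (auto simp: init_config_def cfg_def init_store_def M_def)
    have "Bit b \<in> S" for b
      using S(2) by (cases b) (auto simp: basic_def)
    then have "over S (init_store x)"
      using S(2) by (auto simp: over_def init_store_def basic_def intro!: write_tape_over)
    then have *: "(otm_step f M ^^ t) (cfg 0 (init_store x)) (cfg e st')" "over S st'"
      using exec_otm[OF t(2), of S 0 e M] S p Q by (auto simp: M_def)
    have "\<exists>t' c'. t' \<le> Suc t \<and> (otm_step f M ^^ t') (cfg 0 (init_store x)) c' \<and>
        (\<nexists>c''. otm_step f M c' c'') \<and> (state c' = Suc e \<longleftrightarrow> x \<in> A)"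
    proof (cases "x \<in> A")
      case True
      let ?rs = "scanned k (cfg e st')"
      have "(e, ?rs, Suc e, mkact k ?rs []) \<in> delta M"
        using True acc scanned_words[OF *(2)] by (auto simp: M_def env_scanned)
      then have "otm_step f M (cfg e st') (perform (Suc e) (mkact k ?rs []) (cfg e st'))"
        using Q by (intro otm_step_code) (auto simp: M_def)
      then have "otm_step f M (cfg e st') (cfg (Suc e) st')"
        by (subst (asm) perform_mkact) auto
      then have "(otm_step f M ^^ Suc t) (cfg 0 (init_store x)) (cfg (Suc e) st')"
        using *(1) by auto
      moreover have "\<not> otm_step f M (cfg (Suc e) st') c''" for c''
        using Q by (auto simp: otm_step_def tm_step_def M_def e_def dest!: code_range)
      ultimately show ?thesis
        using True by (intro exI[of _ "Suc t"] exI[of _ "cfg (Suc e) st'"]) auto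
    next
      case False
      have "\<not> otm_step f M (cfg e st') c''" for c''
        using Q acc False
        by (auto simp: otm_step_def tm_step_def M_def e_def env_scanned dest!: code_range)
      then show ?thesis
        using False *(1) by (intro exI[of _ t] exI[of _ "cfg e st'"]) auto
    qed
    then obtain t' c' where t': "t' \<le> Suc t" "(otm_step f M ^^ t') (cfg 0 (init_store x)) c'"
      "\<nexists>c''. otm_step f M c' c''" "state c' = Suc e \<longleftrightarrow> x \<in> A" by blast
    then obtain cs where cs: "computation (otm_step f M) (cfg 0 (init_store x)) cs" "length cs = Suc t'"
      "last cs = c'"
      using relpowp_computation by metis
    \<comment> \<open>The extra step at most doubles the bound, which passing from \<open>c\<close>
      to \<open>Suc c\<close> absorbs.\<close>
    have "Suc t \<le> 2 ^ (c * length x + c) + 2 ^ (c * length x + c)"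
      using t(1) one_le_power[of "2::nat" "c * length x + c"] by linarith
    also have "\<dots> = 2 ^ Suc (c * length x + c)" by simp
    also have "\<dots> \<le> 2 ^ (Suc c * length x + Suc c)" by (rule power_increasing) auto
    finally show ?thesis
      using cs t' unfolding init
      by (intro exI[of _ cs]) (auto simp: halting_computation_def M_def)
  qed
  ultimately show ?thesis
    using \<open>f \<in> F\<close> unfolding E_oracle_def by blast
qed

section \<open>Tapes as zippers and basic programs\<close>

lemma runs_Seq: "runs k f p st n st1 \<Longrightarrow> runs k f q st1 m st2 \<Longrightarrow> runs k f (Seq p q) st (n + m) st2"
  unfolding runs_def by (meson add_mono exec.Seq)

lemma runs_mono: "runs k f p st n st' \<Longrightarrow> n \<le> m \<Longrightarrow> runs k f p st m st'"
  unfolding runs_def by (meson order_trans)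

lemma runs_While_False: "\<not> c (scan k st) \<Longrightarrow> runs k f (While c p) st 1 st"
  unfolding runs_def by (meson exec.While_False order_refl)

lemma runs_While_True: "c (scan k st) \<Longrightarrow> runs k f p st n st1 \<Longrightarrow> runs k f (While c p) st1 m st2
   \<Longrightarrow> runs k f (While c p) st (Suc (n + m)) st2"
  unfolding runs_def by (meson Suc_le_mono add_mono exec.While_True)

lemma runs_Query: "runs k f Query st 1
  (st(1 := (write_tape [], 0), 2 := (write_tape (int_syms (f (read_tape (fst (st 1))))), 0)))"
  unfolding runs_def by (meson exec.Query order_refl)

lemma runs_Aut: "arun k d 0 st t st' \<Longrightarrow> t \<le> m \<Longrightarrow> runs k f (Aut n d) st m st'"
  unfolding runs_def by (meson exec.Aut)

definition Do :: "((nat \<Rightarrow> sym) \<Rightarrow> acts) \<Rightarrow> prog" where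
  "Do g = Aut 1 (\<lambda>_ s. (None, g s))"

definition Loop :: "((nat \<Rightarrow> sym) \<Rightarrow> bool) \<Rightarrow> ((nat \<Rightarrow> sym) \<Rightarrow> acts) \<Rightarrow> prog" where
  "Loop c g = Aut 1 (\<lambda>_ s. if c s then (Some 0, g s) else (None, []))"

lemma wf_prog_Do [simp]:
  "wf_prog k S (Do g) \<longleftrightarrow> (\<forall>s. (\<forall>j. s j \<in> S) \<longrightarrow> (\<forall>(j, x, m) \<in> set (g s). j < k \<and> x \<in> S))"
  by (simp add: Do_def)

lemma wf_prog_Loop [simp]:
  "wf_prog k S (Loop c g) \<longleftrightarrow>
     (\<forall>s. (\<forall>j. s j \<in> S) \<longrightarrow> c s \<longrightarrow> (\<forall>(j, x, m) \<in> set (g s). j < k \<and> x \<in> S))"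
  unfolding Loop_def by auto

lemma queries_Do_Loop [simp]: "queries (Do g) = 0" "queries (Loop c g) = 0"
  by (simp_all add: Do_def Loop_def)

lemma runs_eq: "runs k f p st n st' \<Longrightarrow> st' = st'' \<Longrightarrow> n \<le> m \<Longrightarrow> runs k f p st m st''"
  using runs_mono by blast

lemma runs_Do: "app (g (scan k st)) st = st' \<Longrightarrow> 0 < m \<Longrightarrow> runs k f (Do g) st m st'"
  unfolding Do_def using arun.stop[of "\<lambda>_ s. (None, g s)" 0 k st] by (auto intro: runs_Aut)

lemma runs_Loop_end: "\<not> c (scan k st) \<Longrightarrow> st = st' \<Longrightarrow> 0 < m \<Longrightarrow> runs k f (Loop c g) st m st'"
  unfolding Loop_def using arun.stop[of "\<lambda>_ s. if c s then (Some 0, g s) else (None, [])" 0 k st "[]"]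
  by (auto intro: runs_Aut)

lemma runs_Loop_step:
  assumes "c (scan k st)" "app (g (scan k st)) st = st1" "runs k f (Loop c g) st1 n st2"
    "st2 = st'" "Suc n \<le> m"
  shows "runs k f (Loop c g) st m st'"
proof -
  let ?d = "\<lambda>_ s. if c s then (Some (0::nat), g s) else (None, [])"
  obtain t where "t \<le> n" "exec k f (Loop c g) st1 t st2"
    using assms(3) by (auto simp: runs_def)
  then have "arun k ?d 0 st1 t st2"
    unfolding Loop_def by (auto elim: exec.cases)
  then have "arun k ?d 0 st (Suc t) st'"
    using assms(1,2,4) by (intro arun.go) auto
  then show ?thesis
    unfolding Loop_def using \<open>t \<le> n\<close> assms(5) by (intro runs_Aut[of _ _ _ "Suc t"]) auto
qed

text \<open>\<open>tz h l r\<close> is the tape with head at \<open>h\<close>, reading \<open>r\<close> from the head to the right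
  and \<open>l\<close> from the cell next to the head to the left.\<close>

definition nth_blank :: "sym list \<Rightarrow> nat \<Rightarrow> sym" where
  "nth_blank l n = (if n < length l then l ! n else Blank)"

definition tz :: "int \<Rightarrow> sym list \<Rightarrow> sym list \<Rightarrow> stape" where
  "tz h l r = (\<lambda>i. if h \<le> i then nth_blank r (nat (i - h)) else nth_blank l (nat (h - 1 - i)), h)"

fun hdb :: "sym list \<Rightarrow> sym" where
  "hdb [] = Blank"
| "hdb (x # l) = x"

lemma nth_blank_Cons: "nth_blank (x # l) n = (if n = 0 then x else nth_blank l (n - 1))"
  by (auto simp: nth_blank_def)

lemma nth_blank_tl: "nth_blank (tl l) n = nth_blank l (Suc n)"
  by (cases l) (auto simp: nth_blank_def)

lemma nth_blank_0: "nth_blank l 0 = hdb l"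
  by (cases l) (auto simp: nth_blank_def)

lemma rd_tz [simp]: "rd (tz h l r) = hdb r"
  by (simp add: rd_def tz_def nth_blank_0)

lemma wr_tz [simp]:
  "wr (y, MRight) (tz h l r) = tz (h + 1) (y # l) (tl r)"
  "wr (y, MLeft) (tz h l r) = tz (h - 1) (tl l) (hdb l # y # tl r)"
  "wr (y, MStay) (tz h l r) = tz h l (y # tl r)"
proof -
  have *: "Suc (nat (i - (h + 1))) = nat (i - h)" if "h + 1 \<le> i" for i
    using that by linarith
  show "wr (y, MRight) (tz h l r) = tz (h + 1) (y # l) (tl r)"
    by (auto simp: wr_def tz_def fun_eq_iff nth_blank_Cons nth_blank_tl *
        intro!: arg_cong[of _ _ "nth_blank _"])
  have *: "Suc (nat (h - 1 - 1 - i)) = nat (h - 1 - i)" if "i < h - 1" for i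
    using that by linarith
  show "wr (y, MLeft) (tz h l r) = tz (h - 1) (tl l) (hdb l # y # tl r)"
    using * by (auto simp: wr_def tz_def fun_eq_iff nth_blank_Cons nth_blank_tl nth_blank_0[symmetric]
        intro!: arg_cong[of _ _ "nth_blank _"])
  show "wr (y, MStay) (tz h l r) = tz h l (y # tl r)"
    by (auto simp: wr_def tz_def fun_eq_iff nth_blank_Cons nth_blank_tl
        intro!: arg_cong[of _ _ "nth_blank _"])
qed

lemma nth_blank_snoc: "nth_blank (l @ [Blank]) = nth_blank l"
  by (auto simp: nth_blank_def fun_eq_iff nth_append)

text \<open>Zippers describe a tape only up to blanks at the far ends; this rule and the next ones
  bring them to one form, so that stores can be compared by simplification.\<close>

lemma tz_snoc [simp]: "tz h l (r @ [Blank]) = tz h l r" "tz h (l @ [Blank]) r = tz h l r"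
  unfolding tz_def nth_blank_snoc by simp_all

lemma tz_drop_Blank [simp]: "tz h l [Blank] = tz h l []" "tz h [Blank] r = tz h [] r"
  "tz h l [x, Blank] = tz h l [x]"
  using tz_snoc[of h l "[]"] tz_snoc[of h "[]" r] tz_snoc(1)[of h l "[x]"] by simp_all

lemma tz_hdb_tl [simp]: "tz h l (a @ hdb r # tl r) = tz h l (a @ r)"
  by (cases r) (simp_all add: tz_snoc)

lemma tz_blank: "tz h [] [] = (\<lambda>_. Blank, h)"
  by (auto simp: tz_def nth_blank_def)

lemma tz_write: "(write_tape xs, 0) = tz 0 [] xs"
  by (auto simp: tz_def nth_blank_def write_tape_def fun_eq_iff)

lemma read_tape_eqI:
  assumes "\<And>i. i < length xs \<Longrightarrow> t (int i) = Bit (xs ! i)" "t (int (length xs)) \<notin> range Bit"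
  shows "read_tape t = xs"
proof -
  have "(LEAST n. t (int n) \<notin> range Bit) = length xs"
  proof (rule Least_equality)
    show "length xs \<le> y" if "t (int y) \<notin> range Bit" for y
      using that assms(1)[of y] by (cases "y < length xs") auto
  qed (fact assms(2))
  then have "read_tape t = map (\<lambda>i. t (int i) = Bit True) [0..<length xs]"
    unfolding read_tape_def by (rule arg_cong)
  also have "\<dots> = map (\<lambda>i. xs ! i) [0..<length xs]"
    by (intro map_cong refl) (simp add: assms(1))
  finally show ?thesis
    by (simp only: map_nth)
qed

text \<open>Covers a query tape as it is left after writing, with the head just behind the last
  bit.\<close>

lemma read_tape_tz:
  assumes "hdb r \<notin> range Bit"
  shows "read_tape (fst (tz (int (length xs)) (map Bit (rev xs)) r)) = xs"
proof (rule read_tape_eqI)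
  show "fst (tz (int (length xs)) (map Bit (rev xs)) r) (int i) = Bit (xs ! i)" if "i < length xs" for i
  proof -
    have "nat (int (length xs) - 1 - int i) = length xs - Suc i"
      using that by linarith
    then show ?thesis
      using that by (simp add: tz_def nth_blank_def rev_nth)
  qed
qed (use assms in \<open>auto simp: tz_def nth_blank_0\<close>)

abbreviation "scan_left j \<equiv> Loop (\<lambda>s. s j \<noteq> Blank) (\<lambda>s. [(j, s j, MLeft)])"

abbreviation "scan_right j \<equiv> Loop (\<lambda>s. s j \<noteq> Blank) (\<lambda>s. [(j, s j, MRight)])"

abbreviation "do_left j \<equiv> Do (\<lambda>s. [(j, Blank, MLeft)])"

abbreviation "do_right j \<equiv> Do (\<lambda>s. [(j, Blank, MRight)])"

text \<open>The start is what one \<open>MLeft\<close> makes of a zipper with left part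
  \<open>l\<close>. Writing it with \<open>tl l\<close> and \<open>hdb l\<close> gives the empty
  list the same form as the others, which suits the induction on \<open>l\<close>; the later
  leftward loops use the same device.\<close>

lemma runs_Loop_left:
  assumes "st j = tz (h - 1) (tl l) (hdb l # r)" "Blank \<notin> set l" "j < k"
  shows "runs k f (scan_left j) st (length l + 1)
    (st(j := tz (h - 1 - int (length l)) [] (Blank # rev l @ r)))"
  using assms
proof (induction l arbitrary: st h r)
  case Nil
  then show ?case by (intro runs_Loop_end) (auto simp: fun_eq_iff)
next
  case (Cons z l)
  show ?case
    by (rule runs_Loop_step[OF _ _ Cons.IH[of "st(j := tz (h - 1 - 1) (tl l) (hdb l # z # r))" "h - 1" "z # r"]])
      (use Cons.prems in \<open>auto simp: fun_eq_iff algebra_simps\<close>)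
qed

definition go_left :: "nat \<Rightarrow> prog" where
  "go_left j = Seq (Do (\<lambda>s. [(j, s j, MLeft)]))
     (Seq (scan_left j) (do_right j))"

lemma runs_go_left:
  assumes "st j = tz h l r" "Blank \<notin> set l" "j < k"
  shows "runs k f (go_left j) st (length l + 3) (st(j := tz (h - int (length l)) [] (rev l @ r)))"
proof -
  let ?st1 = "st(j := tz (h - 1) (tl l) (hdb l # hdb r # tl r))"
  let ?st2 = "st(j := tz (h - 1 - int (length l)) [] (Blank # rev l @ hdb r # tl r))"
  have "runs k f (Do (\<lambda>s. [(j, s j, MLeft)])) st 1 ?st1"
    using assms by (intro runs_Do) (auto simp: fun_eq_iff)
  moreover have "runs k f (scan_left j) ?st1 (length l + 1) ?st2"
    by (rule runs_eq[OF runs_Loop_left[of ?st1 j h l "hdb r # tl r" k f]]) (use assms in \<open>auto simp: fun_eq_iff\<close>)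
  moreover have "runs k f (do_right j) ?st2 1 (st(j := tz (h - int (length l)) [] (rev l @ r)))"
    using assms by (intro runs_Do) (auto simp: fun_eq_iff algebra_simps)
  ultimately show ?thesis
    unfolding go_left_def by (intro runs_mono[OF runs_Seq[OF _ runs_Seq]]) auto
qed

section \<open>Recovering the origin of a tape and erasing tapes with the help of a step
  counter\<close>

definition mark :: "int \<Rightarrow> int \<Rightarrow> sym" where
  "mark h = (\<lambda>i. if i = h then Work 0 else Blank)"

lemma wr_rd: "wr (rd T, m) T = (fst T, snd T + offset m)"
  by (simp add: wr_def rd_def)

lemma wr_pair: "wr (x, m) (t, p) = (t(p := x), p + offset m)"
  by (simp add: wr_def)

lemma rd_pair: "rd (t, p) = t p"
  by (simp add: rd_def)

abbreviation "retreat i j l \<equiv> Loop (\<lambda>s. s l \<noteq> Blank) (\<lambda>s. [(l, s l, MLeft), (i, s i, MLeft), (j, s j, MLeft)])"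

abbreviation "seek_mark j l \<equiv> Loop (\<lambda>s. s l \<noteq> Work 0) (\<lambda>s. [(j, s j, MRight), (l, s l, MRight)])"

text \<open>The mark may lie on either side of the head, so the direction of search is unknown.
  Stepping back as many cells as the counter has symbols brings the head onto the mark or to its
  left, and then a search to the right succeeds. The counter is restored in between.\<close>

definition home :: "nat \<Rightarrow> nat \<Rightarrow> nat \<Rightarrow> prog" where
  "home j ip ic = Seq (do_left ic)
     (Seq (retreat j ip ic)
     (Seq (do_right ic)
     (Seq (scan_right ic)
     (seek_mark j ip))))"

lemma runs_Loop_right:
  assumes "st j = tz h l r" "Blank \<notin> set r" "j < k"
  shows "runs k f (scan_right j) st (length r + 1)
    (st(j := tz (h + int (length r)) (rev r @ l) []))"
  using assms
proof (induction r arbitrary: st h l)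
  case Nil
  then show ?case by (intro runs_Loop_end) (auto simp: fun_eq_iff)
next
  case (Cons z r)
  show ?case
    by (rule runs_Loop_step[OF _ _ Cons.IH[of "st(j := tz (h + 1) (z # l) r)" "h + 1" "z # l"]])
      (use Cons.prems in \<open>auto simp: fun_eq_iff algebra_simps\<close>)
qed

lemma replicate_Suc_shift: "replicate n x @ x # r = x # replicate n x @ r"
  by (induction n) auto

lemma runs_home_left:
  assumes "st ic = tz (h - 1) (tl (replicate n (Work 0))) (hdb (replicate n (Work 0)) # r)"
    "distinct [j, ip, ic]" "j < k" "ip < k" "ic < k"
  shows "runs k f (retreat j ip ic)
    st (n + 1) (st(ic := tz (h - 1 - int n) [] (Blank # replicate n (Work 0) @ r),
      j := (fst (st j), snd (st j) - int n), ip := (fst (st ip), snd (st ip) - int n)))"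
  using assms(1)
proof (induction n arbitrary: st h r)
  case 0
  then show ?case using assms(2-) by (intro runs_Loop_end) (auto simp: fun_eq_iff rd_pair mark_def)
next
  case (Suc n)
  let ?w = "replicate n (Work 0)"
  let ?st1 = "st(ic := tz (h - 1 - 1) (tl ?w) (hdb ?w # Work 0 # r),
      j := (fst (st j), snd (st j) - 1), ip := (fst (st ip), snd (st ip) - 1))"
  show ?case
    by (rule runs_Loop_step[OF _ _ Suc.IH[of ?st1 "h - 1" "Work 0 # r"]])
      (use Suc.prems assms in \<open>auto simp: fun_eq_iff algebra_simps wr_rd replicate_Suc_shift\<close>)
qed

lemma runs_home_right:
  assumes "st j = (t, a - int m)" "st ip = (mark hp, hp - int m)" "j \<noteq> ip" "j < k" "ip < k"
  shows "runs k f (seek_mark j ip) st (m + 1)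
    (st(j := (t, a), ip := (mark hp, hp)))"
  using assms(1,2)
proof (induction m arbitrary: st)
  case 0
  then show ?case using assms(2-) by (intro runs_Loop_end) (auto simp: fun_eq_iff rd_pair mark_def)
next
  case (Suc m)
  let ?st1 = "st(j := (t, a - int m), ip := (mark hp, hp - int m))"
  show ?case
    by (rule runs_Loop_step[OF _ _ Suc.IH[of ?st1]])
      (use Suc.prems assms in \<open>auto simp: fun_eq_iff rd_pair mark_def wr_pair\<close>)
qed

lemma runs_home:
  assumes "st j = (t, a + x)" "st ip = (mark hp, hp + x)" "st ic = tz hc (replicate n (Work 0)) []"
    "\<bar>x\<bar> \<le> int n" "distinct [j, ip, ic]" "j < k" "ip < k" "ic < k"
  shows "runs k f (home j ip ic) st (4 * n + 5) (st(j := (t, a), ip := (mark hp, hp)))"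
proof -
  let ?w = "replicate n (Work 0)"
  let ?st1 = "st(ic := tz (hc - 1) (tl ?w) (hdb ?w # [Blank]))"
  let ?st2 = "st(ic := tz (hc - 1 - int n) [] (Blank # ?w @ [Blank]),
      j := (t, a + x - int n), ip := (mark hp, hp + x - int n))"
  let ?st3 = "st(ic := tz (hc - int n) [] ?w, j := (t, a + x - int n), ip := (mark hp, hp + x - int n))"
  let ?st4 = "st(ic := tz hc ?w [], j := (t, a + x - int n), ip := (mark hp, hp + x - int n))"
  have "runs k f (do_left ic) st 1 ?st1"
    using assms by (intro runs_Do) (auto simp: fun_eq_iff)
  moreover have "runs k f (retreat j ip ic) ?st1 (n + 1) ?st2"
    by (rule runs_eq[OF runs_home_left[of ?st1 ic hc n "[Blank]" j ip k f]]) (use assms in \<open>auto simp: fun_eq_iff\<close>)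
  moreover have "runs k f (do_right ic) ?st2 1 ?st3"
    using assms by (intro runs_Do) (auto simp: fun_eq_iff)
  moreover have "runs k f (scan_right ic) ?st3 (n + 1) ?st4"
    by (rule runs_eq[OF runs_Loop_right[of ?st3 ic "hc - int n" "[]" ?w]]) (use assms in \<open>auto simp: fun_eq_iff\<close>)
  \<comment> \<open>The distance to the mark is now \<open>n - x\<close>, at most twice the
    counter.\<close>
  moreover have "runs k f (seek_mark j ip) ?st4
      (2 * n + 1) (st(j := (t, a), ip := (mark hp, hp)))"
    by (rule runs_eq[OF runs_home_right[of ?st4 j t a "nat (int n - x)" ip hp]])
      (use assms in \<open>auto simp: fun_eq_iff\<close>)
  ultimately show ?thesis
    unfolding home_def
    by (intro runs_mono[OF runs_Seq[OF _ runs_Seq[OF _ runs_Seq[OF _ runs_Seq]]]]) auto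
qed

lemma map_of_offset:
  "map_of (map (\<lambda>i. (b + i, a i)) [0..<K]) j = (if b \<le> j \<and> j < b + K then Some (a (j - b)) else None)"
  by (induction K) (auto simp: map_add_def)

lemma app_offset: "app (map (\<lambda>i. (b + i, a i)) [0..<K]) st =
  (\<lambda>j. if b \<le> j \<and> j < b + K then wr (a (j - b)) (st j) else st j)"
  by (auto simp: app_def map_of_offset)

lemma app_offset': "app (map (\<lambda>i. (i + b, a i)) [0..<K]) st =
  (\<lambda>j. if b \<le> j \<and> j < b + K then wr (a (j - b)) (st j) else st j)"
  using app_offset[of b a K st] by (simp add: add.commute)

abbreviation "sweep_left b K l \<equiv> Loop (\<lambda>s. s l \<noteq> Blank) (\<lambda>s. (l, s l, MLeft) # map (\<lambda>i. (b + i, s (b + i), MLeft)) [0..<K])"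

abbreviation "wipe_right b K l \<equiv> Loop (\<lambda>s. s l \<noteq> Blank) (\<lambda>s. (l, s l, MRight) # map (\<lambda>i. (b + i, Blank, MRight)) [0..<K])"

abbreviation "wipe_back b K l \<equiv> Loop (\<lambda>s. s l \<noteq> Blank) (\<lambda>s. (l, Blank, MLeft) # map (\<lambda>i. (b + i, Blank, MRight)) [0..<K])"

text \<open>The counter is a ruler of length n used three times: to move all heads n cells left, to
  blank n cells on the way back, and, being erased itself, to blank n more. This clears the
  half-open window of radius n around each head.\<close>

definition wipe :: "nat \<Rightarrow> nat \<Rightarrow> nat \<Rightarrow> prog" where
  "wipe b K ic = Seq (do_left ic)
     (Seq (sweep_left b K ic)
     (Seq (do_right ic)
     (Seq (wipe_right b K ic)
     (Seq (do_left ic)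
     (wipe_back b K ic)))))"

definition on_range :: "nat \<Rightarrow> nat \<Rightarrow> (stape \<Rightarrow> stape) \<Rightarrow> store \<Rightarrow> store" where
  "on_range b K g st = (\<lambda>j. if b \<le> j \<and> j < b + K then g (st j) else st j)"

definition blank_from :: "nat \<Rightarrow> stape \<Rightarrow> stape" where
  "blank_from n T = (\<lambda>i. if snd T \<le> i \<and> i < snd T + int n then Blank else fst T i, snd T + int n)"

lemma blank_from_0: "blank_from 0 T = T"
  by (auto simp: blank_from_def prod_eq_iff fun_eq_iff)

lemma runs_wipe_left:
  assumes "st ic = tz (h - 1) (tl (replicate n (Work 0))) (hdb (replicate n (Work 0)) # r)"
    "b + K \<le> ic" "ic < k"
  shows "runs k f (sweep_left b K ic) st (n + 1)
    ((on_range b K (\<lambda>T. (fst T, snd T - int n)) st)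
       (ic := tz (h - 1 - int n) [] (Blank # replicate n (Work 0) @ r)))"
  using assms(1)
proof (induction n arbitrary: st h r)
  case 0
  then show ?case using assms(2-) by (intro runs_Loop_end) (auto simp: fun_eq_iff on_range_def blank_from_0 rd_pair mark_def)
next
  case (Suc n)
  let ?w = "replicate n (Work 0)"
  let ?st1 = "(on_range b K (\<lambda>T. (fst T, snd T - 1)) st)(ic := tz (h - 1 - 1) (tl ?w) (hdb ?w # Work 0 # r))"
  show ?case
    by (rule runs_Loop_step[OF _ _ Suc.IH[of ?st1 "h - 1" "Work 0 # r"]])
      (use Suc.prems assms in \<open>auto simp: fun_eq_iff on_range_def app_offset' wr_rd rd_def[of "st _"] wr_def[of _ "st _"] blank_from_def
        algebra_simps replicate_Suc_shift\<close>)
qed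

lemma runs_wipe_right:
  assumes "st ic = tz h l (replicate n (Work 0))" "b + K \<le> ic" "ic < k"
  shows "runs k f (wipe_right b K ic) st (n + 1)
    ((on_range b K (blank_from n) st)(ic := tz (h + int n) (replicate n (Work 0) @ l) []))"
  using assms(1)
proof (induction n arbitrary: st h l)
  case 0
  then show ?case using assms(2-) by (intro runs_Loop_end) (auto simp: fun_eq_iff on_range_def blank_from_0 rd_pair mark_def)
next
  case (Suc n)
  let ?w = "replicate n (Work 0)"
  let ?st1 = "(on_range b K (blank_from 1) st)(ic := tz (h + 1) (Work 0 # l) ?w)"
  show ?case
    by (rule runs_Loop_step[OF _ _ Suc.IH[of ?st1 "h + 1" "Work 0 # l"]])
      (use Suc.prems assms in \<open>auto simp: fun_eq_iff on_range_def app_offset' wr_rd wr_def[of _ "st _"] blank_from_def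
        algebra_simps replicate_Suc_shift\<close>)
qed

lemma runs_wipe_back:
  assumes "st ic = tz (h - 1) (tl (replicate n (Work 0))) (hdb (replicate n (Work 0)) # [])"
    "b + K \<le> ic" "ic < k"
  shows "runs k f (wipe_back b K ic) st (n + 1)
    ((on_range b K (blank_from n) st)(ic := tz (h - 1 - int n) [] []))"
  using assms(1)
proof (induction n arbitrary: st h)
  case 0
  then show ?case using assms(2-) by (intro runs_Loop_end) (auto simp: fun_eq_iff on_range_def blank_from_0 rd_pair mark_def)
next
  case (Suc n)
  let ?w = "replicate n (Work 0)"
  let ?st1 = "(on_range b K (blank_from 1) st)(ic := tz (h - 1 - 1) (tl ?w) [hdb ?w])"
  show ?case
    by (rule runs_Loop_step[OF _ _ Suc.IH[of ?st1 "h - 1"]])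
      (use Suc.prems assms in \<open>auto simp: fun_eq_iff on_range_def app_offset' wr_rd wr_def[of _ "st _"] blank_from_def
        algebra_simps replicate_Suc_shift\<close>)
qed

lemma runs_wipe:
  assumes ic: "st ic = tz hc (replicate n (Work 0)) []" "b + K \<le> ic" "ic < k"
    and near: "\<And>j i. b \<le> j \<Longrightarrow> j < b + K \<Longrightarrow> fst (st j) i \<noteq> Blank \<Longrightarrow>
      snd (st j) - int n \<le> i \<and> i < snd (st j) + int n"
  shows "runs k f (wipe b K ic) st (3 * n + 6)
    ((on_range b K (\<lambda>T. (\<lambda>_. Blank, snd T + int n)) st)(ic := tz (hc - int n - 1) [] []))"
proof -
  let ?w = "replicate n (Work 0)"
  let ?st1 = "st(ic := tz (hc - 1) (tl ?w) (hdb ?w # [Blank]))"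
  let ?st2 = "(on_range b K (\<lambda>T. (fst T, snd T - int n)) st)
     (ic := tz (hc - 1 - int n) [] (Blank # ?w @ [Blank]))"
  let ?st3 = "(on_range b K (\<lambda>T. (fst T, snd T - int n)) st)(ic := tz (hc - int n) [] ?w)"
  let ?st4 = "(on_range b K (\<lambda>T. blank_from n (fst T, snd T - int n)) st)(ic := tz hc ?w [])"
  let ?st5 = "(on_range b K (\<lambda>T. blank_from n (fst T, snd T - int n)) st)(ic := tz (hc - 1) (tl ?w) [hdb ?w])"
  let ?st6 = "(on_range b K (\<lambda>T. (\<lambda>_. Blank, snd T + int n)) st)(ic := tz (hc - int n - 1) [] [])"
  have "runs k f (do_left ic) st 1 ?st1"
    using ic by (intro runs_Do) (auto simp: fun_eq_iff)
  moreover have "runs k f (sweep_left b K ic) ?st1 (n + 1) ?st2"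
    by (rule runs_eq[OF runs_wipe_left[of ?st1 ic hc n "[Blank]" b K]])
      (use ic in \<open>auto simp: fun_eq_iff on_range_def\<close>)
  moreover have "runs k f (do_right ic) ?st2 1 ?st3"
    using ic by (intro runs_Do) (auto simp: fun_eq_iff)
  moreover have "runs k f (wipe_right b K ic) ?st3 (n + 1) ?st4"
    by (rule runs_eq[OF runs_wipe_right[of ?st3 ic "hc - int n" "[]" n b K]])
      (use ic in \<open>auto simp: fun_eq_iff on_range_def\<close>)
  moreover have "runs k f (do_left ic) ?st4 1 ?st5"
    using ic by (intro runs_Do) (auto simp: fun_eq_iff)
  moreover have "runs k f (wipe_back b K ic) ?st5 (n + 1) ?st6"
    by (rule runs_eq[OF runs_wipe_back[of ?st5 ic hc n b K]])
      (use ic near in \<open>force simp: fun_eq_iff on_range_def blank_from_def algebra_simps\<close>)+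
  ultimately show ?thesis
    unfolding wipe_def
    by (intro runs_mono[OF runs_Seq[OF _ runs_Seq[OF _ runs_Seq[OF _ runs_Seq[OF _ runs_Seq]]]]]) auto
qed

lemma wf_prog_go_left: "basic \<subseteq> S \<Longrightarrow> j < k \<Longrightarrow> wf_prog k S (go_left j)"
  by (auto simp: go_left_def basic_def)

lemma wf_prog_home: "basic \<subseteq> S \<Longrightarrow> j < k \<Longrightarrow> ip < k \<Longrightarrow> ic < k \<Longrightarrow> wf_prog k S (home j ip ic)"
  by (auto simp: home_def basic_def)

lemma wf_prog_wipe: "basic \<subseteq> S \<Longrightarrow> b + K \<le> ic \<Longrightarrow> ic < k \<Longrightarrow> wf_prog k S (wipe b K ic)"
  by (auto simp: wipe_def basic_def)

lemma queries_parts [simp]: "queries (go_left j) = 0" "queries (home j ip ic) = 0" "queries (wipe b K ic) = 0"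
  by (simp_all add: go_left_def home_def wipe_def)

section \<open>Embedding a Turing machine into a program\<close>

definition tm_step_until :: "'a tm_scheme \<Rightarrow> nat set \<Rightarrow> config \<Rightarrow> config \<Rightarrow> bool" where
  "tm_step_until M X c c' \<longleftrightarrow> state c \<notin> X \<and> tm_step M c c'"

text \<open>Runs \<open>M\<close> on the tapes from \<open>b\<close> on, until it halts or enters a state of \<open>X\<close>. The head of
  tape \<open>ip\<close>, which carries a mark in its initial cell, follows tape 1 of \<open>M\<close>; tape \<open>ic\<close> counts steps.\<close>

definition embed_aut ::
  "'a tm_scheme \<Rightarrow> nat set \<Rightarrow> nat \<Rightarrow> nat \<Rightarrow> nat \<Rightarrow> (nat \<Rightarrow> acts) \<Rightarrow> nat \<Rightarrow> aut" where
  "embed_aut M X b ip ic fl q0 = (\<lambda>q s. case q of 0 \<Rightarrow> (Some (Suc q0), [(ip, Work 0, MStay)])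
   | Suc q \<Rightarrow> (let rs = map (\<lambda>j. s (b + j)) [0..<tape_count M] in
       if q \<in> X \<or> (\<nexists>q' as. (q, rs, q', as) \<in> delta M) then (None, fl q)
       else let (q', as) = (SOME (q', as). (q, rs, q', as) \<in> delta M) in
         (Some (Suc q'), (ip, s ip, snd (as ! 1)) # (ic, Work 0, MRight) #
            map (\<lambda>j. (b + j, as ! j)) [0..<tape_count M])))"

lemma embed_aut_0: "embed_aut M X b ip ic fl q0 0 s = (Some (Suc q0), [(ip, Work 0, MStay)])"
  by (simp add: embed_aut_def)

lemma embed_aut_stop:
  assumes "q \<in> X \<or> (\<nexists>q' as. (q, map (\<lambda>j. s (b + j)) [0..<tape_count M], q', as) \<in> delta M)"
  shows "embed_aut M X b ip ic fl q0 (Suc q) s = (None, fl q)"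
  unfolding embed_aut_def Let_def using assms by simp

lemma embed_aut_go:
  assumes "q \<notin> X" "(q, map (\<lambda>j. s (b + j)) [0..<tape_count M], q1, as1) \<in> delta M"
    "(SOME (q', as). (q, map (\<lambda>j. s (b + j)) [0..<tape_count M], q', as) \<in> delta M) = (q', as)"
  shows "embed_aut M X b ip ic fl q0 (Suc q) s =
    (Some (Suc q'), (ip, s ip, snd (as ! 1)) # (ic, Work 0, MRight) #
       map (\<lambda>j. (b + j, as ! j)) [0..<tape_count M])"
proof -
  have "\<not> (q \<in> X \<or> (\<nexists>q' as. (q, map (\<lambda>j. s (b + j)) [0..<tape_count M], q', as) \<in> delta M))"
    using assms(1,2) by blast
  then show ?thesis
    unfolding embed_aut_def Let_def by (simp only: nat.case if_False assms(3) prod.case)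
qed

text \<open>\<open>h\<close> gives the cells that act as origins of the embedded tapes; they drift
  because heads are not returned between runs. \<open>hp\<close> is the marked cell of
  \<open>ip\<close>, and the counter may carry symbols from before the run.\<close>

definition embed_store :: "nat \<Rightarrow> nat \<Rightarrow> nat \<Rightarrow> nat \<Rightarrow> store \<Rightarrow> (nat \<Rightarrow> int) \<Rightarrow> int \<Rightarrow> int \<Rightarrow> nat \<Rightarrow> config \<Rightarrow> store" where
  "embed_store K b ip ic st h hp hc n c = (\<lambda>j.
     if b \<le> j \<and> j < b + K then (\<lambda>i. tape c (j - b) (i - h (j - b)), pos c (j - b) + h (j - b))
     else if j = ip then (mark hp, hp + pos c 1)
     else if j = ic then tz (hc + int n) (replicate n (Work 0)) []
     else st j)"

lemma embed_scanned:
  assumes "b + K \<le> k"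
  shows "map (\<lambda>j. scan k (embed_store K b ip ic st h hp hc n c) (b + j)) [0..<K] = scanned K c"
  using assms by (auto simp: scanned_def embed_store_def rd_pair)

text \<open>Determinism makes the transition chosen by \<open>SOME\<close> in
  \<open>embed_aut\<close> the one used by the given step.\<close>

lemma embed_step:
  assumes M: "deterministic M" "wf_tm M" "tm_step_until M X c c'"
    and k: "b + tape_count M \<le> k" "b + tape_count M \<le> ip" "b + tape_count M \<le> ic" "ip < k" "ic < k" "ip \<noteq> ic"
  shows "\<exists>al. embed_aut M X b ip ic fl q0 (Suc (state c))
      (scan k (embed_store (tape_count M) b ip ic st h hp hc n c)) = (Some (Suc (state c')), al) \<and>
    app al (embed_store (tape_count M) b ip ic st h hp hc n c) =
      embed_store (tape_count M) b ip ic st h hp hc (Suc n) c'"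
proof -
  let ?K = "tape_count M"
  let ?s = "embed_store ?K b ip ic st h hp hc n c"
  obtain q as where q: "(state c, scanned ?K c, q, as) \<in> delta M" "c' = perform q as c"
    using M(3) by (auto simp: tm_step_until_def tm_step_def)
  have len: "length as = ?K" "2 \<le> ?K"
    using M(2) q(1) by (auto simp: wf_tm_def)
  have some: "(SOME (q', as'). (state c, scanned ?K c, q', as') \<in> delta M) = (q, as)"
    by (rule some_equality) (use M(1) q(1) in \<open>auto simp: deterministic_def\<close>)
  let ?al = "(ip, scan k ?s ip, snd (as ! 1)) # (ic, Work 0, MRight) # map (\<lambda>j. (b + j, as ! j)) [0..<?K]"
  have "embed_aut M X b ip ic fl q0 (Suc (state c)) (scan k ?s) = (Some (Suc (state c')), ?al)"
    using q M(3) some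
    by (subst embed_aut_go[of _ _ _ _ _ q as q as])
      (simp_all add: embed_scanned[OF k(1)] tm_step_until_def, simp add: perform_def)
  moreover have "app ?al ?s = embed_store ?K b ip ic st h hp hc (Suc n) c'"
  proof
    fix j
    show "app ?al ?s j = embed_store ?K b ip ic st h hp hc (Suc n) c' j"
    proof (cases "b \<le> j \<and> j < b + ?K")
      case True
      then have "app ?al ?s j = wr (as ! (j - b)) (?s j)"
        using k by (simp add: app_offset)
      also have "\<dots> = embed_store ?K b ip ic st h hp hc (Suc n) c' j"
        using True q(2) len by (auto simp: embed_store_def perform_def wr_def fun_eq_iff)
      finally show ?thesis .
    next
      case False
      then show ?thesis
        using k q(2) len
        by (auto simp: app_offset' embed_store_def perform_def wr_pair rd_pair algebra_simps)
    qed
  qed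
  ultimately show ?thesis by blast
qed

lemma embed_arun:
  assumes "(tm_step_until M X ^^ T) c c'" "state c' \<in> X \<or> (\<nexists>c''. tm_step M c' c'')"
    and M: "deterministic M" "wf_tm M"
    and k: "b + tape_count M \<le> k" "b + tape_count M \<le> ip" "b + tape_count M \<le> ic" "ip < k" "ic < k" "ip \<noteq> ic"
  shows "arun k (embed_aut M X b ip ic fl q0) (Suc (state c))
      (embed_store (tape_count M) b ip ic st h hp hc n c) (Suc T)
      (app (fl (state c')) (embed_store (tape_count M) b ip ic st h hp hc (n + T) c'))"
  using assms(1)
proof (induction T arbitrary: c n)
  case 0
  have "\<not> (\<exists>q' as. (state c', scanned (tape_count M) c', q', as) \<in> delta M)" if "state c' \<notin> X"
    using assms(2) that by (auto simp: tm_step_def)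
  then have "embed_aut M X b ip ic fl q0 (Suc (state c'))
     (scan k (embed_store (tape_count M) b ip ic st h hp hc n c')) = (None, fl (state c'))"
    by (intro embed_aut_stop) (auto simp: embed_scanned[OF k(1)])
  from arun.stop[of "embed_aut M X b ip ic fl q0" "Suc (state c')" k, OF this] show ?case
    using 0 by simp
next
  case (Suc T)
  then obtain c1 where c1: "tm_step_until M X c c1" "(tm_step_until M X ^^ T) c1 c'"
    by (meson relpowp_Suc_D2)
  from embed_step[OF M c1(1) k] obtain al where
    "embed_aut M X b ip ic fl q0 (Suc (state c))
      (scan k (embed_store (tape_count M) b ip ic st h hp hc n c)) = (Some (Suc (state c1)), al)"
    "app al (embed_store (tape_count M) b ip ic st h hp hc n c) =
      embed_store (tape_count M) b ip ic st h hp hc (Suc n) c1" by blast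
  then show ?case
    using Suc.IH[OF c1(2), of "Suc n"] by - (rule arun.go[of _ _ _ _ "Suc (state c1)" al], simp_all)
qed

text \<open>The condition on \<open>st\<close> is imposed after the mark has been written, so it
  fits both a blank tape \<open>ip\<close> and one that still carries the mark of an earlier
  run.\<close>

lemma embed_runs:
  assumes "(tm_step_until M X ^^ T) c c'" "state c' \<in> X \<or> (\<nexists>c''. tm_step M c' c'')"
    and M: "deterministic M" "wf_tm M"
    and k: "b + tape_count M \<le> k" "b + tape_count M \<le> ip" "b + tape_count M \<le> ic" "ip < k" "ic < k" "ip \<noteq> ic"
    and st: "st(ip := wr (Work 0, MStay) (st ip)) = embed_store (tape_count M) b ip ic st h hp hc n c"
  shows "runs k f (Aut N (embed_aut M X b ip ic fl (state c))) st (T + 2)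
      (app (fl (state c')) (embed_store (tape_count M) b ip ic st h hp hc (n + T) c'))"
proof -
  have "arun k (embed_aut M X b ip ic fl (state c)) (Suc (state c)) (app [(ip, Work 0, MStay)] st) (Suc T)
      (app (fl (state c')) (embed_store (tape_count M) b ip ic st h hp hc (n + T) c'))"
    unfolding app_Cons app_Nil st by (rule embed_arun[OF assms(1-10)])
  from arun.go[of "embed_aut M X b ip ic fl (state c)" 0 k st, OF embed_aut_0 this]
  have "arun k (embed_aut M X b ip ic fl (state c)) 0 st (Suc (Suc T))
      (app (fl (state c')) (embed_store (tape_count M) b ip ic st h hp hc (n + T) c'))" .
  then show ?thesis
    by (rule runs_Aut) simp
qed

definition tm_syms :: "'a tm_scheme \<Rightarrow> sym set" where
  "tm_syms M = (\<Union>(q, rs, q', as) \<in> delta M. set rs \<union> fst ` set as)"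

definition tm_states :: "'a tm_scheme \<Rightarrow> nat set" where
  "tm_states M = (\<Union>(q, rs, q', as) \<in> delta M. {q, q'})"

lemma finite_tm_syms: "wf_tm M \<Longrightarrow> finite (tm_syms M)"
  by (auto simp: wf_tm_def tm_syms_def)

lemma finite_tm_states: "wf_tm M \<Longrightarrow> finite (tm_states M)"
  by (auto simp: wf_tm_def tm_states_def)

lemma embed_wf:
  assumes M: "wf_tm M" "\<And>q. q \<in> tm_states M \<Longrightarrow> q < N" "q0 < N"
    and S: "tm_syms M \<subseteq> S" "basic \<subseteq> S" "\<And>q j x m. (j, x, m) \<in> set (fl q) \<Longrightarrow> j < k \<and> x \<in> S"
    and k: "b + tape_count M \<le> k" "ip < k" "ic < k"
  shows "wf_prog k S (Aut (Suc N) (embed_aut M X b ip ic fl q0))"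
proof -
  have "(\<forall>q'. fst (embed_aut M X b ip ic fl q0 q s) = Some q' \<longrightarrow> q' < Suc N) \<and>
      (\<forall>(j, x, m) \<in> set (snd (embed_aut M X b ip ic fl q0 q s)). j < k \<and> x \<in> S)"
    if s: "\<forall>j. s j \<in> S" for q s
  proof (cases q)
    case 0
    then show ?thesis
      using M S k by (auto simp: embed_aut_0 basic_def)
  next
    case (Suc q)
    let ?rs = "map (\<lambda>j. s (b + j)) [0..<tape_count M]"
    show ?thesis
    proof (cases "q \<in> X \<or> (\<nexists>q' as. (q, ?rs, q', as) \<in> delta M)")
      case True
      then show ?thesis
        using Suc S(3) embed_aut_stop[OF True] by auto
    next
      case False
      obtain q' as where e: "(SOME (q', as). (q, ?rs, q', as) \<in> delta M) = (q', as)"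
        by fastforce
      have "\<exists>x. (\<lambda>(q', as). (q, ?rs, q', as) \<in> delta M) x"
        using False by auto
      from someI_ex[OF this] have d: "(q, ?rs, q', as) \<in> delta M"
        unfolding e by simp
      have "q' \<in> tm_states M"
        unfolding tm_states_def by (rule UN_I[OF d]) simp
      then have "q' < N" by (rule M(2))
      have len: "length as = tape_count M"
        using M(1) d unfolding wf_tm_def by blast
      have "fst ` set as \<subseteq> tm_syms M"
        unfolding tm_syms_def by (rule subsetI, rule UN_I[OF d]) simp
      then have as: "fst ` set as \<subseteq> S" using S(1) by (rule order_trans)
      have as_S: "x \<in> S" if "as ! j = (x, m)" "j < tape_count M" for x m j
        using as nth_mem[of j as] that len by force
      have "embed_aut M X b ip ic fl q0 (Suc q) s = (Some (Suc q'), (ip, s ip, snd (as ! 1)) #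
          (ic, Work 0, MRight) # map (\<lambda>j. (b + j, as ! j)) [0..<tape_count M])"
        using False by (intro embed_aut_go[OF _ d e]) blast
      then show ?thesis
        using Suc s S(2) k as_S \<open>q' < N\<close> by (auto simp: basic_def)
    qed
  qed
  then show ?thesis by simp
qed

text \<open>Outside the input of length \<open>l\<close> only visited cells can be nonblank, and a
  cell visited within \<open>n\<close> steps is within \<open>n\<close> of cell 0 and within
  \<open>n\<close> of the present head. The first bound limits the length of outputs and queries,
  the second is what wiping needs.\<close>

definition near :: "nat \<Rightarrow> nat \<Rightarrow> (int \<Rightarrow> sym) \<Rightarrow> int \<Rightarrow> bool" where
  "near l n t p \<longleftrightarrow> \<bar>p\<bar> \<le> int n \<and>
     (\<forall>i. t i \<noteq> Blank \<longrightarrow> 0 \<le> i \<and> i < int l \<or> \<bar>i\<bar> \<le> int n \<and> \<bar>i - p\<bar> \<le> int n)"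

lemma near_step:
  assumes "near l n (tape c j) (pos c j)" "tm_step M c c'"
  shows "near l (Suc n) (tape c' j) (pos c' j)"
proof -
  obtain q as where c': "c' = perform q as c"
    using assms(2) by (auto simp: tm_step_def)
  have "\<bar>offset m\<bar> \<le> 1" for m
    by (cases m) auto
  note o = this[of "snd (as ! j)"]
  show ?thesis
    unfolding near_def
  proof (intro conjI allI impI)
    show "\<bar>pos c' j\<bar> \<le> int (Suc n)"
      using assms(1) o by (auto simp: c' perform_def near_def)
    fix i
    assume i: "tape c' j i \<noteq> Blank"
    show "0 \<le> i \<and> i < int l \<or> \<bar>i\<bar> \<le> int (Suc n) \<and> \<bar>i - pos c' j\<bar> \<le> int (Suc n)"
    proof (cases "j < length as \<and> i = pos c j")
      case True
      then show ?thesis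
        using assms(1) o by (auto simp: c' perform_def near_def)
    next
      case False
      then have "tape c j i \<noteq> Blank"
        using i by (auto simp: c' perform_def split: if_splits)
      then have "0 \<le> i \<and> i < int l \<or> \<bar>i\<bar> \<le> int n \<and> \<bar>i - pos c j\<bar> \<le> int n"
        using assms(1) by (simp add: near_def)
      moreover have "\<bar>pos c' j - pos c j\<bar> \<le> 1"
        using o by (auto simp: c' perform_def)
      ultimately show ?thesis
        by linarith
    qed
  qed
qed

lemma near_steps:
  assumes "(tm_step_until M X ^^ T) c c'" "near l n (tape c j) (pos c j)"
  shows "near l (n + T) (tape c' j) (pos c' j)"
  using assms
proof (induction T arbitrary: c n)
  case (Suc T)
  then obtain c1 where c1: "tm_step_until M X c c1" "(tm_step_until M X ^^ T) c1 c'"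
    by (meson relpowp_Suc_D2)
  have "near l (Suc n) (tape c1 j) (pos c1 j)"
    using near_step[OF Suc.prems(2)] c1(1) by (auto simp: tm_step_until_def)
  from Suc.IH[OF c1(2) this] show ?case
    by simp
qed auto

text \<open>The time bound covers all computations, halting or not, so there is a longest one, and
  its last configuration has no successor.\<close>

lemma poly_time_halts:
  assumes "poly_time M"
  obtains p :: "nat poly" where
    "\<And>x. \<exists>T c'. T \<le> poly p (length x) \<and> (tm_step M ^^ T) (init_config M x) c' \<and> (\<nexists>c''. tm_step M c' c'')"
proof -
  obtain p :: "nat poly" where p: "\<And>x cs. computation (tm_step M) (init_config M x) cs
      \<Longrightarrow> length cs - 1 \<le> poly p (length x)"
    using assms by (auto simp: poly_time_def)
  have "\<exists>T c'. T \<le> poly p (length x) \<and> (tm_step M ^^ T) (init_config M x) c' \<and> (\<nexists>c''. tm_step M c' c'')" for x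
  proof -
    let ?P = "\<lambda>T. \<exists>c'. (tm_step M ^^ T) (init_config M x) c'"
    have b: "T \<le> poly p (length x)" if "?P T" for T
    proof -
      obtain cs where "computation (tm_step M) (init_config M x) cs" "length cs = Suc T"
        using \<open>?P T\<close> by (auto simp: relpowp_computation)
      then show ?thesis
        using p[of x cs] by simp
    qed
    have "?P 0" by auto
    then obtain T where T: "?P T" "\<And>T'. ?P T' \<Longrightarrow> T' \<le> T"
      using Nat.ex_has_greatest_nat[of ?P 0 "poly p (length x)"] b by blast
    then obtain c' where c': "(tm_step M ^^ T) (init_config M x) c'" by blast
    have "\<nexists>c''. tm_step M c' c''"
    proof
      assume "\<exists>c''. tm_step M c' c''"
      then have "?P (Suc T)" using c' relpowp_Suc_I by metis
      then show False using T(2)[of "Suc T"] by simp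
    qed
    then show ?thesis
      using b[OF T(1)] c' by blast
  qed
  then show thesis
    by (rule that)
qed

section \<open>The parts of the diagonal program\<close>

lemma Blank_notin_Bits [simp]: "Blank \<notin> Bit ` A" "Bit b \<noteq> Blank"
  by auto

text \<open>The query to \<open>f\<close> and the argument of \<open>g\<close> are the same string,
  so both are written at once, tape 4 being the input tape of \<open>G\<close>. Each symbol is also
  counted, so that the counter later covers the input block when the tapes are wiped.\<close>

definition put :: "nat \<Rightarrow> bool \<Rightarrow> acts" where
  "put ic b = [(1, Bit b, MRight), (4, Bit b, MRight), (ic, Work 0, MRight)]"

abbreviation "write_ones l \<equiv> Loop (\<lambda>s. s 3 \<noteq> Blank) (\<lambda>s. (3, s 3, MLeft) # put l True)"

abbreviation "write_word l \<equiv> Loop (\<lambda>s. s 3 \<noteq> Blank) (\<lambda>s. (3, s 3, MRight) # put l (s 3 = Bit True))"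

text \<open>Writes the pair of \<open>w1\<close> and precision |w| + 2: a leftward pass over
  \<open>w\<close> yields the unary part, the way back the copy of \<open>w\<close>. The second 1
  and the separating 0 are written while the head of tape 3 turns round.\<close>

definition write_query :: "nat \<Rightarrow> prog" where
  "write_query ic = Seq (Do (\<lambda>s. put ic True)) (Seq (Do (\<lambda>s. (3, Blank, MLeft) # put ic True))
     (Seq (write_ones ic)
     (Seq (Do (\<lambda>s. (3, Blank, MRight) # put ic False))
     (Seq (write_word ic)
     (Seq (Do (\<lambda>s. put ic True)) (go_left 4))))))"

definition query_store :: "store \<Rightarrow> nat \<Rightarrow> int \<Rightarrow> int \<Rightarrow> bool list \<Rightarrow> stape \<Rightarrow> store" where
  "query_store st ic h4 hc u T = st(1 := tz (int (length u)) (map Bit (rev u)) [],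
     4 := tz (h4 + int (length u)) (map Bit (rev u)) [],
     ic := tz (hc + int (length u)) (replicate (length u) (Work 0)) [], 3 := T)"

lemma app_put:
  assumes "4 < ic"
  shows "app (put ic b) (query_store st ic h4 hc u T) = query_store st ic h4 hc (u @ [b]) T"
    "app ((3, a) # put ic b) (query_store st ic h4 hc u T) = query_store st ic h4 hc (u @ [b]) (wr a T)"
  using assms by (auto simp: put_def query_store_def fun_eq_iff replicate_append_same algebra_simps)

lemma query_store_3 [simp]: "query_store st ic h4 hc u T 3 = T"
  by (simp add: query_store_def)

lemma query_store_upd_3 [simp]:
  "(query_store st ic h4 hc u T)(3 := T') = query_store st ic h4 hc u T'"
  by (simp add: query_store_def)

lemma runs_write_ones:
  assumes "4 < ic" "ic < k" "Blank \<notin> set l"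
  shows "runs k f (write_ones ic)
    (query_store st ic h4 hc u (tz (h - 1) (tl l) (hdb l # r))) (length l + 1)
    (query_store st ic h4 hc (u @ replicate (length l) True) (tz (h - 1 - int (length l)) [] (Blank # rev l @ r)))"
  using assms(3)
proof (induction l arbitrary: u h r)
  case Nil
  show ?case using assms by (intro runs_Loop_end) auto
next
  case (Cons z l)
  show ?case
    by (rule runs_Loop_step[OF _ _ Cons.IH[of "u @ [True]" "h - 1" "z # r"]])
      (use Cons.prems assms in \<open>auto simp: app_put algebra_simps\<close>)
qed

lemma runs_write_copy:
  assumes "4 < ic" "ic < k"
  shows "runs k f (write_word ic)
    (query_store st ic h4 hc u (tz h l (map Bit w))) (length w + 1)
    (query_store st ic h4 hc (u @ w) (tz (h + int (length w)) (map Bit (rev w) @ l) []))"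
proof (induction w arbitrary: u h l)
  case Nil
  show ?case using assms by (intro runs_Loop_end) auto
next
  case (Cons z w)
  show ?case
    by (rule runs_Loop_step[OF _ _ Cons.IH[of "u @ [z]" "h + 1" "Bit z # l"]])
      (use assms in \<open>auto simp: app_put algebra_simps\<close>)
qed

lemma runs_write_query:
  assumes "st 1 = tz 0 [] []" "st 3 = tz h3 (map Bit (rev w)) []" "st 4 = tz h4 [] []" "st ic = tz hc [] []"
    "5 < ic" "ic < k" and u: "u = unary_pair (w @ [True]) (length w + 2)"
  shows "runs k f (write_query ic) st (5 * length w + 13)
    (st(1 := tz (int (length u)) (map Bit (rev u)) [], 4 := tz h4 [] (map Bit u),
       ic := tz (hc + int (length u)) (replicate (length u) (Work 0)) []))"
proof -
  let ?Q = "query_store st ic h4 hc"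
  let ?l = "map Bit (rev w)"
  let ?n = "length w"
  have st: "st = ?Q [] (tz h3 ?l [])"
    using assms by (auto simp: query_store_def fun_eq_iff)
  let ?u1 = "[True, True] @ replicate ?n True"
  have "runs k f (Do (\<lambda>s. put ic True)) (?Q [] (tz h3 ?l [])) 1 (?Q [True] (tz h3 ?l []))"
    using assms by (intro runs_Do) (auto simp: app_put)
  moreover have "runs k f (Do (\<lambda>s. (3, Blank, MLeft) # put ic True)) (?Q [True] (tz h3 ?l [])) 1
      (?Q [True, True] (tz (h3 - 1) (tl ?l) (hdb ?l # [Blank])))"
    using assms by (intro runs_Do) (auto simp: app_put)
  moreover have "runs k f (write_ones ic)
      (?Q [True, True] (tz (h3 - 1) (tl ?l) (hdb ?l # [Blank]))) (?n + 1)
      (?Q ?u1 (tz (h3 - 1 - int ?n) [] (Blank # rev ?l @ [Blank])))"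
    by (rule runs_eq[OF runs_write_ones]) (use assms in auto)
  moreover have "runs k f (Do (\<lambda>s. (3, Blank, MRight) # put ic False))
      (?Q ?u1 (tz (h3 - 1 - int ?n) [] (Blank # rev ?l @ [Blank]))) 1
      (?Q (?u1 @ [False]) (tz (h3 - int ?n) [] (map Bit w)))"
    using assms by (intro runs_Do) (auto simp: app_put rev_map)
  moreover have "runs k f (write_word ic)
      (?Q (?u1 @ [False]) (tz (h3 - int ?n) [] (map Bit w))) (?n + 1)
      (?Q ((?u1 @ [False]) @ w) (tz h3 ?l []))"
    by (rule runs_eq[OF runs_write_copy]) (use assms in auto)
  moreover have "runs k f (Do (\<lambda>s. put ic True)) (?Q ((?u1 @ [False]) @ w) (tz h3 ?l [])) 1 (?Q u (tz h3 ?l []))"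
    using assms by (intro runs_Do) (auto simp: app_put unary_pair_def)
  moreover have "runs k f (go_left 4) (?Q u (tz h3 ?l [])) (length u + 3)
     (st(1 := tz (int (length u)) (map Bit (rev u)) [], 4 := tz h4 [] (map Bit u),
       ic := tz (hc + int (length u)) (replicate (length u) (Work 0)) []))"
  proof -
    have "?Q u (tz h3 ?l []) 4 = tz (h4 + int (length u)) (map Bit (rev u)) []"
      using assms by (auto simp: query_store_def)
    from runs_eq[OF runs_go_left[of "?Q u (tz h3 ?l [])", OF this]] show ?thesis
      using assms by (auto simp: query_store_def fun_eq_iff rev_map)
  qed
  moreover have "length u = 2 * ?n + 4"
    by (simp add: u unary_pair_def)
  ultimately show ?thesis
    unfolding write_query_def st[symmetric]
    by (intro runs_mono[OF runs_Seq[OF _ runs_Seq[OF _ runs_Seq[OF _ runs_Seq[OF _ runs_Seq[OF _ runs_Seq]]]]]]) auto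
qed

section \<open>Comparing the leading digits of an oracle answer with the threshold\<close>

primrec advance :: "nat \<Rightarrow> prog" where
  "advance 0 = Do (\<lambda>s. [])"
| "advance (Suc m) = Seq (Do (\<lambda>s. [(2, s 2, MRight)])) (advance m)"

text \<open>\<open>m\<close> is a constant of the martingale, so the shift by \<open>m\<close>
  digits is spelled out in the program.\<close>

lemma runs_advance:
  assumes "2 < k"
  shows "runs k f (advance m) st (m + 1) (st(2 := (fst (st 2), snd (st 2) + int m)))"
proof (induction m arbitrary: st)
  case 0
  show ?case by (auto intro!: runs_Do)
next
  case (Suc m)
  have "runs k f (Do (\<lambda>s. [(2, s 2, MRight)])) st 1 (st(2 := (fst (st 2), snd (st 2) + 1)))"
    using assms by (intro runs_Do) (auto simp: wr_rd)
  from runs_Seq[OF this Suc.IH] show ?case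
    unfolding advance.simps by (rule runs_eq) (auto simp: fun_eq_iff)
qed

abbreviation "skip_zeros l \<equiv> Loop (\<lambda>s. s 5 = Bit False) (\<lambda>s. [(2, s 2, MRight), (5, s 5, MRight), (l, Work 0, MRight)])"

text \<open>With the least significant digit first, 2^kk is \<open>kk\<close> zeros followed by a
  one. Moving along these zeros on tapes 5 and 2 in parallel divides the answer by \<open>g\<close>
  as a mere shift of position. The counter grows along, since the head of tape 5 leaves its
  origin.\<close>

lemma runs_skip_zeros:
  assumes "st 2 = (t2, a2)" "st 5 = (t5, a5)" "st ic = tz hc (replicate n (Work 0)) []"
    "\<And>i. i < kk \<Longrightarrow> t5 (a5 + int i) = Bit False" "t5 (a5 + int kk) = Bit True" "5 < ic" "ic < k"
  shows "runs k f (skip_zeros ic)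
    st (kk + 1) (st(2 := (t2, a2 + int kk), 5 := (t5, a5 + int kk),
      ic := tz (hc + int kk) (replicate (n + kk) (Work 0)) []))"
  using assms(1-5)
proof (induction kk arbitrary: st a2 a5 hc n)
  case 0
  then show ?case using assms(6,7) by (intro runs_Loop_end) (auto simp: fun_eq_iff rd_pair)
next
  case (Suc kk)
  let ?st = "st(2 := (t2, a2 + 1), 5 := (t5, a5 + 1), ic := tz (hc + 1) (replicate (Suc n) (Work 0)) [])"
  have *: "t5 (a5 + 1 + int i) = Bit False" if "i < kk" for i
    using Suc.prems(4)[of "Suc i"] that by (simp add: algebra_simps)
  have **: "t5 (a5 + 1 + int kk) = Bit True"
    using Suc.prems(5) by (simp add: algebra_simps)
  have ***: "t5 a5 = Bit False"
    using Suc.prems(4)[of 0] by simp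
  show ?case
    by (rule runs_Loop_step[OF _ _ Suc.IH[of ?st "a2 + 1" "a5 + 1" "hc + 1" "Suc n", OF _ _ _ * **]])
      (use Suc.prems(1-3) *** assms(6,7) in \<open>auto simp: fun_eq_iff rd_pair wr_pair algebra_simps\<close>)
qed

lemma tz_left_hdb [simp]: "tz h (hdb l # tl l) r = tz h l r"
  by (cases l) auto

abbreviation "compare \<equiv> Loop (\<lambda>s. s 2 = Bit True \<and> s 3 \<noteq> Blank) (\<lambda>s. [(2, s 2, MLeft), (3, s 3, MLeft)])"

text \<open>\<open>j\<close> is the number of ones found, and \<open>l\<close> is a ruler for
  \<open>length l\<close> comparisons. If the ruler is used up, the next digit has not been looked
  at; \<open>store_verdict\<close> does that.\<close>

lemma runs_compare:
  assumes "st 2 = (t, a)" "st 3 = tz (h - 1) (tl l) (hdb l # r)" "Blank \<notin> set l" "3 < k"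
  shows "\<exists>j\<le>length l. (\<forall>i<j. t (a - int i) = Bit True) \<and> (t (a - int j) \<noteq> Bit True \<or> j = length l) \<and>
    runs k f compare st (length l + 1)
     (st(2 := (t, a - int j), 3 := tz (h - 1 - int j) (tl (drop j l)) (hdb (drop j l) # rev (take j l) @ r)))"
  using assms(1-3)
proof (induction l arbitrary: st a h r)
  case Nil
  then show ?case using assms(4) by (auto simp: rd_pair fun_eq_iff intro!: runs_Loop_end)
next
  case (Cons z l)
  show ?case
  proof (cases "t a = Bit True")
    case False
    then show ?thesis
      using Cons.prems assms(4) by (intro exI[of _ 0]) (auto simp: rd_pair fun_eq_iff intro!: runs_Loop_end)
  next
    case True
    let ?st = "st(2 := (t, a - 1), 3 := tz (h - 1 - 1) (tl l) (hdb l # z # r))"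
    have "?st 2 = (t, a - 1)" "?st 3 = tz (h - 1 - 1) (tl l) (hdb l # z # r)" "Blank \<notin> set l"
      using Cons.prems by auto
    from Cons.IH[of ?st "a - 1" "h - 1" "z # r", OF this]
    obtain j where j: "j \<le> length l" "\<forall>i<j. t (a - 1 - int i) = Bit True"
      "t (a - 1 - int j) \<noteq> Bit True \<or> j = length l"
      and r: "runs k f compare ?st (length l + 1)
       (?st(2 := (t, a - 1 - int j), 3 := tz (h - 1 - 1 - int j) (tl (drop j l)) (hdb (drop j l) # rev (take j l) @ z # r)))"
      by blast
    have "t (a - int i) = Bit True" if "i < Suc j" for i
      using j(2) True that by (cases i) (auto simp: algebra_simps)
    moreover have "t (a - int (Suc j)) \<noteq> Bit True \<or> Suc j = length (z # l)"
      using j(3) by (auto simp: algebra_simps)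
    moreover have "runs k f compare st (length (z # l) + 1)
     (st(2 := (t, a - int (Suc j)), 3 := tz (h - 1 - int (Suc j)) (tl (drop (Suc j) (z # l)))
       (hdb (drop (Suc j) (z # l)) # rev (take (Suc j) (z # l)) @ r)))"
      by (rule runs_Loop_step[OF _ _ r])
        (use Cons.prems assms(4) True in \<open>auto simp: fun_eq_iff rd_pair wr_pair algebra_simps\<close>)
    moreover have "Suc j \<le> length (z # l)" using j(1) by simp
    ultimately show ?thesis
      by blast
  qed
qed

abbreviation "overflow_check i \<equiv> Do (\<lambda>s. [(2, s 2, MLeft), (3, s 3, MLeft), (i, if s 2 = Blank then Blank else Work 1, MStay)])"

abbreviation "store_verdict i \<equiv> Do (\<lambda>s. [(3, s 3, MRight), (i, Bit (s i = Blank \<and> \<not> (s 2 = Bit True \<and> s 3 = Blank)), MStay)])"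

abbreviation "append_verdict i \<equiv> Do (\<lambda>s. [(3, s i, MRight), (i, Blank, MStay)])"

text \<open>Once \<open>home\<close> is over, the marked cell of \<open>ip\<close> is reused: it
  records whether there is a digit at the exponent itself, and then the verdict, until the head of
  tape 3 is back at the end of the prefix and can append it. The verdict negates the test, since 0
  is appended when the value is large.\<close>

definition test :: "nat \<Rightarrow> nat \<Rightarrow> nat \<Rightarrow> prog" where
  "test m ip ic = Seq (advance m)
     (Seq (skip_zeros ic)
     (Seq (overflow_check ip)
     (Seq compare
     (Seq (store_verdict ip)
     (Seq (scan_right 3)
     (append_verdict ip))))))"

text \<open>The test of whether \<open>v / 2\<^sup>k \<ge> 2\<^sup>m (1 - 2\<^sup>-\<^sup>(\<^sup>n\<^sup>+\<^sup>1\<^sup>))\<close> on the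
  binary digits of \<open>v\<close>, where \<open>e = m + k\<close>.\<close>

definition large :: "(int \<Rightarrow> sym) \<Rightarrow> int \<Rightarrow> nat \<Rightarrow> bool" where
  "large t e n \<longleftrightarrow> t e \<noteq> Blank \<or> (\<forall>i\<le>n. t (e - 1 - int i) = Bit True)"

lemma hdb_Blank_iff: "Blank \<notin> set l \<Longrightarrow> hdb l = Blank \<longleftrightarrow> l = []"
  by (cases l) auto

lemma runs_test:
  assumes "st 2 = (t2, 0)" "st 5 = (t5, a5)" "st ic = tz hc (replicate n (Work 0)) []"
    "st 3 = tz h3 (map Bit (rev w)) []" "st ip = (mark hp, hp)"
    "\<And>i. i < kk \<Longrightarrow> t5 (a5 + int i) = Bit False" "t5 (a5 + int kk) = Bit True"
    "5 < ip" "ip < k" "5 < ic" "ic < k" "ip \<noteq> ic"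
  shows "\<exists>p2. runs k f (test m ip ic) st (m + kk + 2 * length w + 10)
    (st(2 := (t2, p2), 5 := (t5, a5 + int kk), ic := tz (hc + int kk) (replicate (n + kk) (Work 0)) [],
      3 := tz (h3 + 1) (Bit (\<not> large t2 (int (m + kk)) (length w)) # map Bit (rev w)) [], ip := (\<lambda>_. Blank, hp)))"
proof -
  let ?l = "map Bit (rev w)"
  let ?e = "int m + int kk"
  let ?c = "tz (hc + int kk) (replicate (n + kk) (Work 0)) []"
  let ?s0 = "st(2 := (t2, int m))"
  let ?s1 = "st(2 := (t2, ?e), 5 := (t5, a5 + int kk), ic := ?c)"
  let ?fl = "if t2 ?e = Blank then Blank else Work 1"
  let ?T = "(\<lambda>i. if i = hp then ?fl else Blank, hp)"
  let ?s2 = "?s1(2 := (t2, ?e - 1), 3 := tz (h3 - 1) (tl ?l) (hdb ?l # [Blank]), ip := ?T)"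
  have 1: "runs k f (advance m) st (m + 1) ?s0"
    by (rule runs_eq[OF runs_advance]) (use assms in auto)
  have 2: "runs k f (skip_zeros ic)
      ?s0 (kk + 1) ?s1"
    by (rule runs_eq[OF runs_skip_zeros[of ?s0 t2 "int m" t5 a5 ic hc n kk]]) (use assms in \<open>auto simp: fun_eq_iff\<close>)
  have 3: "runs k f (overflow_check ip) ?s1 1 ?s2"
    by (rule runs_Do) (use assms in \<open>auto simp: fun_eq_iff rd_pair wr_pair mark_def\<close>)
  obtain j where j: "j \<le> length ?l" "\<forall>i<j. t2 (?e - 1 - int i) = Bit True"
      "t2 (?e - 1 - int j) \<noteq> Bit True \<or> j = length ?l"
    and 4: "runs k f compare ?s2 (length ?l + 1)
     (?s2(2 := (t2, ?e - 1 - int j), 3 := tz (h3 - 1 - int j) (tl (drop j ?l)) (hdb (drop j ?l) # rev (take j ?l) @ [Blank])))"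
    using runs_compare[of ?s2 t2 "?e - 1" h3 ?l "[Blank]" k f] assms by auto
  let ?s3 = "?s2(2 := (t2, ?e - 1 - int j), 3 := tz (h3 - 1 - int j) (tl (drop j ?l)) (hdb (drop j ?l) # rev (take j ?l) @ [Blank]))"
  let ?b = "\<not> large t2 (int (m + kk)) (length w)"
  have "Blank \<notin> set (drop j ?l)"
    by (metis Blank_notin_Bits(1) in_set_dropD list.set_map)
  then have end_iff: "hdb (drop j ?l) = Blank \<longleftrightarrow> j = length w"
    using j(1) by (auto simp: hdb_Blank_iff)
  \<comment> \<open>The test asks for one digit more than the ruler has cells: the loop must consume
    the whole ruler and the digit behind it must be a one too.\<close>
  have "(\<forall>i\<le>length w. t2 (?e - 1 - int i) = Bit True) \<longleftrightarrow> t2 (?e - 1 - int j) = Bit True \<and> j = length w"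
    using j by (auto simp: le_less)
  then have b: "(?fl = Blank \<and> \<not> (t2 (?e - 1 - int j) = Bit True \<and> hdb (drop j ?l) = Blank)) = ?b"
    unfolding end_iff by (auto simp: large_def)
  let ?s4 = "?s1(2 := (t2, ?e - 1 - int j), 3 := tz (h3 - int j) (drop j ?l) (rev (take j ?l)),
     ip := (\<lambda>i. if i = hp then Bit ?b else Blank, hp))"
  have 5: "runs k f (store_verdict ip) ?s3 1 ?s4"
    by (rule runs_Do) (use assms b in \<open>auto simp: fun_eq_iff rd_pair wr_pair algebra_simps\<close>)
  let ?s5 = "?s4(3 := tz h3 ?l [])"
  have nb: "Blank \<notin> set (rev (take j ?l))"
    by (auto dest: in_set_takeD)
  have 6: "runs k f (scan_right 3) ?s4 (length w + 1) ?s5"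
    by (rule runs_eq[OF runs_Loop_right[of ?s4 3 "h3 - int j" "drop j ?l" "rev (take j ?l)"]])
      (use assms j nb in \<open>auto simp: fun_eq_iff\<close>)
  have 7: "runs k f (append_verdict ip) ?s5 1
    (st(2 := (t2, ?e - 1 - int j), 5 := (t5, a5 + int kk), ic := ?c,
      3 := tz (h3 + 1) (Bit ?b # ?l) [], ip := (\<lambda>_. Blank, hp)))"
    by (rule runs_Do) (use assms in \<open>auto simp: fun_eq_iff rd_pair wr_pair\<close>)
  show ?thesis
    unfolding test_def
    by (rule exI[of _ "?e - 1 - int j"], rule runs_mono[OF runs_Seq[OF 1 runs_Seq[OF 2 runs_Seq[OF 3 runs_Seq[OF 4 runs_Seq[OF 5 runs_Seq[OF 6 7]]]]]]]) auto
qed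

section \<open>Counting down the input string in the standard enumeration\<close>

abbreviation "borrow \<equiv> Loop (\<lambda>s. s 0 = Bit False) (\<lambda>s. [(0, Bit True, MLeft)])"

text \<open>\<open>std_string n\<close> is n + 1 in binary without its leading 1, so the predecessor
  is a binary decrement in which a block of zeros turns into a block of ones that is one shorter.
  The blank tape \<open>ic\<close> remembers by \<open>Work 1\<close> that the borrow met a 1. If it
  ran off the left end instead, either the string was empty, and \<open>Work 0\<close> is written to
  stop the main loop, or the last action deletes the leftmost of the new ones; in the former case of
  a 1 the same action merely steps off the blank to the left of the string.\<close>

definition decrement :: "nat \<Rightarrow> prog" where
  "decrement ic = Seq (scan_right 0)
     (Seq (do_left 0)
     (Seq borrow
     (Seq (Do (\<lambda>s. if s 0 = Bit True then [(0, Bit False, MLeft), (ic, Work 1, MStay)] else [(0, Blank, MRight)]))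
     (Seq (Loop (\<lambda>s. s ic = Work 1 \<and> s 0 \<noteq> Blank) (\<lambda>s. [(0, s 0, MLeft)]))
     (Do (\<lambda>s. if s ic \<noteq> Work 1 \<and> s 0 = Blank then [(0, Work 0, MStay)]
        else [(0, Blank, MRight), (ic, Blank, MStay)]))))))"

lemma runs_borrow:
  assumes "st 0 = tz (h - 1) (tl (replicate j (Bit False) @ l)) (hdb (replicate j (Bit False) @ l) # r)"
    "hdb l \<noteq> Bit False" "0 < k"
  shows "runs k f borrow st (j + 1)
    (st(0 := tz (h - 1 - int j) (tl l) (hdb l # replicate j (Bit True) @ r)))"
  using assms(1)
proof (induction j arbitrary: st h r)
  case 0
  then show ?case using assms(2,3) by (intro runs_Loop_end) (auto simp: fun_eq_iff)
next
  case (Suc j)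
  let ?l = "replicate j (Bit False) @ l"
  show ?case
    by (rule runs_Loop_step[OF _ _ Suc.IH[of "st(0 := tz (h - 1 - 1) (tl ?l) (hdb ?l # Bit True # r))" "h - 1" "Bit True # r"]])
      (use Suc.prems assms(2,3) in \<open>auto simp: fun_eq_iff replicate_Suc_shift algebra_simps\<close>)
qed

text \<open>For odd \<open>n\<close> only the last bit changes. For \<open>n = 2 * a\<close> with
  positive \<open>a\<close> the last bit turns from 0 into 1 and the borrow passes on to the strings
  with indices a and a - 1.\<close>

lemma std_string_pred:
  "(\<exists>j y. rev (std_string (Suc n)) = replicate j False @ True # y \<and> rev (std_string n) = replicate j True @ False # y) \<or>
   (\<exists>j. rev (std_string (Suc n)) = replicate (Suc j) False \<and> rev (std_string n) = replicate j True)"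
proof (induction n rule: less_induct)
  case (less n)
  show ?case
  proof (cases "even n")
    case False
    then obtain a where "n = 2 * a + 1" by (rule oddE)
    then show ?thesis
      by (intro disjI1 exI[of _ 0] exI[of _ "rev (std_string a)"])
        (simp add: std_string.simps[of "Suc (Suc _)"] std_string.simps[of "Suc _"])
  next
    case True
    then obtain a where n: "n = 2 * a" by (rule evenE)
    then have S: "rev (std_string (Suc n)) = False # rev (std_string a)"
      by (subst std_string.simps) simp
    show ?thesis
    proof (cases a)
      case 0
      then show ?thesis
        using S n by (intro disjI2 exI[of _ 0]) (simp add: std_string.simps)
    next
      case (Suc b)
      then have "rev (std_string n) = True # rev (std_string b)"
        using n by (subst std_string.simps) simp
      moreover have "b < n" using Suc n by simp
      ultimately show ?thesis
        using less.IH[of b] S unfolding Suc by (metis replicate_Suc append_Cons)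
    qed
  qed
qed

lemma runs_decrement:
  assumes "st 0 = tz h [] (map Bit (std_string i))" "st ic = tz hc [] []" "0 < ic" "ic < k"
  shows "\<exists>h'. runs k f (decrement ic) st (3 * length (std_string i) + 10)
    (st(0 := if i = 0 then tz h [] [Work 0] else tz h' [] (map Bit (std_string (i - 1)))))"
proof -
  let ?x = "std_string i"
  let ?l = "map Bit (rev ?x)"
  let ?n = "length ?x"
  have 1: "runs k f (scan_right 0) st (?n + 1) (st(0 := tz (h + int ?n) ?l []))"
    by (rule runs_eq[OF runs_Loop_right[of st 0 h "[]" "map Bit ?x"]]) (use assms in \<open>auto simp: rev_map\<close>)
  have 2: "runs k f (do_left 0) (st(0 := tz (h + int ?n) ?l [])) 1
      (st(0 := tz (h + int ?n - 1) (tl ?l) (hdb ?l # [Blank])))"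
    by (rule runs_Do) (use assms in auto)
  \<comment> \<open>The outcomes of the borrow loop after \<open>j\<close> zeros: empty input, zeros
    only, or a 1 at the head of \<open>y\<close>.\<close>
  have "\<exists>j y. rev ?x = replicate j False @ y \<and> hdb (map Bit y) \<noteq> Bit False \<and>
     (y = [] \<and> j = 0 \<and> i = 0 \<or>
      y = [] \<and> 0 < i \<and> 0 < j \<and> rev (std_string (i - 1)) = replicate (j - 1) True \<or>
      0 < i \<and> (\<exists>z. y = True # z \<and> rev (std_string (i - 1)) = replicate j True @ False # z))"
  proof (cases i)
    case 0
    then show ?thesis by (intro exI[of _ 0] exI[of _ "[]"]) (simp add: std_string.simps)
  next
    case (Suc n)
    from std_string_pred[of n] show ?thesis
    proof (elim disjE exE conjE)
      fix j y
      assume "rev (std_string (Suc n)) = replicate j False @ True # y" "rev (std_string n) = replicate j True @ False # y"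
      then show ?thesis using Suc by (intro exI[of _ j] exI[of _ "True # y"]) auto
    next
      fix j
      assume "rev (std_string (Suc n)) = replicate (Suc j) False" "rev (std_string n) = replicate j True"
      then show ?thesis using Suc by (intro exI[of _ "Suc j"] exI[of _ "[]"]) auto
    qed
  qed
  then obtain j y where jy: "rev ?x = replicate j False @ y" "hdb (map Bit y) \<noteq> Bit False"
    and cases: "y = [] \<and> j = 0 \<and> i = 0 \<or>
      y = [] \<and> 0 < i \<and> 0 < j \<and> rev (std_string (i - 1)) = replicate (j - 1) True \<or>
      0 < i \<and> (\<exists>z. y = True # z \<and> rev (std_string (i - 1)) = replicate j True @ False # z)" by blast
  have l: "?l = replicate j (Bit False) @ map Bit y"
    unfolding jy(1) by simp
  have n: "?n = j + length y"
    using arg_cong[OF jy(1), of length] by simp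
  let ?y = "map Bit y"
  let ?s3 = "st(0 := tz (h + int ?n - 1 - int j) (tl ?y) (hdb ?y # replicate j (Bit True) @ [Blank]))"
  have 3: "runs k f borrow
      (st(0 := tz (h + int ?n - 1) (tl ?l) (hdb ?l # [Blank]))) (j + 1) ?s3"
    by (rule runs_eq[OF runs_borrow[of _ "h + int ?n" j ?y "[Blank]"]]) (use assms jy(2) l in auto)
  let ?D = "Do (\<lambda>s. if s 0 = Bit True then [(0, Bit False, MLeft), (ic, Work 1, MStay)] else [(0, Blank, MRight)])"
  let ?L = "Loop (\<lambda>s. s ic = Work 1 \<and> s 0 \<noteq> Blank) (\<lambda>s. [(0, s 0, MLeft)])"
  let ?E = "Do (\<lambda>s. if s ic \<noteq> Work 1 \<and> s 0 = Blank then [(0, Work 0, MStay)] else [(0, Blank, MRight), (ic, Blank, MStay)])"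
  have "\<exists>h'. runs k f (Seq ?D (Seq ?L ?E)) ?s3 (?n + 4)
    (st(0 := if i = 0 then tz h [] [Work 0] else tz h' [] (map Bit (std_string (i - 1)))))"
    using cases
  proof (elim disjE conjE exE)
    assume y: "y = []" "j = 0" "i = 0"
    have a: "runs k f ?D ?s3 1 (st(0 := tz h [] []))"
      by (rule runs_Do) (use assms y n in auto)
    have b: "runs k f ?L (st(0 := tz h [] [])) 1 (st(0 := tz h [] []))"
      by (rule runs_Loop_end) (use assms in auto)
    have c: "runs k f ?E (st(0 := tz h [] [])) 1 (st(0 := tz h [] [Work 0]))"
      by (rule runs_Do) (use assms in auto)
    show ?thesis
      using runs_mono[OF runs_Seq[OF a runs_Seq[OF b c]]] y by auto
  next
    assume y: "y = []" "0 < i" "0 < j" "rev (std_string (i - 1)) = replicate (j - 1) True"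
    then obtain j' where j': "j = Suc j'" by (cases j) auto
    have x: "std_string (i - 1) = replicate j' True"
      using arg_cong[OF y(4), of rev] j' by simp
    let ?s4 = "st(0 := tz h [] (replicate (Suc j') (Bit True)))"
    have a: "runs k f ?D ?s3 1 ?s4"
      by (rule runs_Do) (use assms y n j' in \<open>auto simp flip: append_Cons\<close>)
    have b: "runs k f ?L ?s4 1 ?s4"
      by (rule runs_Loop_end) (use assms in auto)
    have c: "runs k f ?E ?s4 1 (st(0 := tz (h + 1) [] (replicate j' (Bit True))))"
      by (rule runs_Do) (use assms in \<open>auto simp: fun_eq_iff\<close>)
    show ?thesis
      using runs_mono[OF runs_Seq[OF a runs_Seq[OF b c]], of "?n + 4"] y x by auto
  next
    fix z
    assume y: "0 < i" "y = True # z" "rev (std_string (i - 1)) = replicate j True @ False # z"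
    have x: "std_string (i - 1) = rev z @ False # replicate j True"
      using arg_cong[OF y(3), of rev] by simp
    let ?z = "map Bit z"
    let ?h = "h + int ?n - 1 - int j"
    let ?s4 = "st(0 := tz (?h - 1) (tl ?z) (hdb ?z # Bit False # replicate j (Bit True) @ [Blank]), ic := tz hc [] [Work 1])"
    have a: "runs k f ?D ?s3 1 ?s4"
      by (rule runs_Do) (use assms y in \<open>auto simp: fun_eq_iff\<close>)
    have loop: "runs k f ?L st (length l + 1) (st(0 := tz (h - 1 - int (length l)) [] (Blank # rev l @ r)))"
      if "st 0 = tz (h - 1) (tl l) (hdb l # r)" "st ic = tz hc [] [Work 1]" "Blank \<notin> set l" for st h l r
      using that
    proof (induction l arbitrary: st h r)
      case Nil
      then show ?case using assms(3,4) by (intro runs_Loop_end) (auto simp: fun_eq_iff)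
    next
      case (Cons a l)
      show ?case
        by (rule runs_Loop_step[OF _ _ Cons.IH[of "st(0 := tz (h - 1 - 1) (tl l) (hdb l # a # r))" "h - 1" "a # r"]])
          (use Cons.prems assms(3,4) in \<open>auto simp: fun_eq_iff algebra_simps\<close>)
    qed
    let ?s5 = "?s4(0 := tz (?h - 1 - int (length ?z)) [] (Blank # rev ?z @ Bit False # replicate j (Bit True) @ [Blank]))"
    have b: "runs k f ?L ?s4 (length z + 1) ?s5"
      by (rule runs_eq[OF loop[of ?s4 ?h ?z]]) (use assms in auto)
    have e: "rev ?z @ Bit False # replicate j (Bit True) @ [Blank] = map Bit (std_string (i - 1)) @ [Blank]"
      unfolding x by (simp add: rev_map)
    have e: "tz h [] (rev ?z @ Bit False # replicate j (Bit True) @ [Blank]) = tz h [] (map Bit (std_string (i - 1)))" for h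
      unfolding e by (rule tz_snoc)
    have c: "runs k f ?E ?s5 1 (st(0 := tz (?h - int (length z)) [] (map Bit (std_string (i - 1)))))"
      by (rule runs_Do) (use assms e in \<open>auto simp: fun_eq_iff algebra_simps\<close>)
    show ?thesis
      using runs_mono[OF runs_Seq[OF a runs_Seq[OF b c]], of "?n + 4"] y n by auto
  qed
  then obtain h' where 4: "runs k f (Seq ?D (Seq ?L ?E)) ?s3 (?n + 4)
    (st(0 := if i = 0 then tz h [] [Work 0] else tz h' [] (map Bit (std_string (i - 1)))))" by blast
  show ?thesis
    unfolding decrement_def
    by (intro exI[of _ h'] runs_mono[OF runs_Seq[OF 1 runs_Seq[OF 2 runs_Seq[OF 3 4]]]]) (use n in auto)
qed

section \<open>The diagonal language\<close>

lemma tz_shift: "tz h [] xs = (\<lambda>i. write_tape xs (i - h), h)"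
  by (auto simp: tz_def nth_blank_def write_tape_def fun_eq_iff)

lemma nat_bits_power: "nat_bits (2 ^ k) = replicate k False @ [True]"
  by (induction k) (simp_all add: nat_bits.simps[of "2 * _"] nat_bits.simps[of 1] nat_bits.simps[of "Suc 0"] nat_bits.simps[of 0])

lemma read_tape_nth:
  assumes "read_tape t = xs" "i < length xs"
  shows "t (int i) = Bit (xs ! i)"
proof -
  let ?L = "LEAST n. t (int n) \<notin> range Bit"
  have L: "i < ?L"
    using assms by (auto simp: read_tape_def)
  then have "t (int i) \<in> range Bit"
    using not_less_Least[OF L] by simp
  moreover have "xs ! i = (t (int i) = Bit True)"
    using assms(1) L unfolding read_tape_def by auto
  ultimately show ?thesis by auto
qed

lemma poly_nat_mono: "x \<le> y \<Longrightarrow> poly (p :: nat poly) x \<le> poly p y"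
  by (induction p) (auto intro!: add_mono mult_mono)

text \<open>Closure of the time bound of E under polynomial overhead.\<close>

lemma poly_exp_bound: "\<exists>c'. \<forall>n. poly (p :: nat poly) (2 ^ (c * n + c)) \<le> 2 ^ (c' * n + c')"
proof (induction p)
  case 0
  show ?case by auto
next
  case (pCons a p)
  then obtain c' where c': "\<And>n. poly p (2 ^ (c * n + c)) \<le> 2 ^ (c' * n + c')" by blast
  have "poly (pCons a p) (2 ^ (c * n + c)) \<le> 2 ^ ((a + c + c' + 1) * n + (a + c + c' + 1))" for n
  proof -
    have "poly (pCons a p) (2 ^ (c * n + c)) \<le> a + 2 ^ (c * n + c) * 2 ^ (c' * n + c')"
      using c'[of n] by simp
    also have "\<dots> \<le> 2 ^ (a + c * n + c + c' * n + c') + 2 ^ (a + c * n + c + c' * n + c')"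
    proof (rule add_mono)
      have "a \<le> 2 ^ a" by (rule less_imp_le[OF less_exp])
      also have "\<dots> \<le> 2 ^ (a + c * n + c + c' * n + c')" by (rule power_increasing) auto
      finally show "a \<le> 2 ^ (a + c * n + c + c' * n + c')" .
      show "2 ^ (c * n + c) * 2 ^ (c' * n + c') \<le> (2 :: nat) ^ (a + c * n + c + c' * n + c')"
        by (simp flip: power_add)
    qed
    also have "\<dots> = 2 ^ Suc (a + c * n + c + c' * n + c')" by simp
    also have "\<dots> \<le> 2 ^ ((a + c + c' + 1) * n + (a + c + c' + 1))"
      by (rule power_increasing) (auto simp: algebra_simps)
    finally show ?thesis .
  qed
  then show ?case by blast
qed

text \<open>The first bound controls the number of rounds, one for each string up to the input; the
  second controls the cost of a single decrement.\<close>

lemma length_std_string: "Suc n < 2 ^ Suc (length (std_string n))" "length (std_string n) \<le> n"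
proof -
  have "Suc n < 2 ^ Suc (length (std_string n)) \<and> length (std_string n) \<le> n"
  proof (induction n rule: less_induct)
    case (less n)
    show ?case
    proof (cases "n = 0")
      case True
      then show ?thesis by (simp add: std_string.simps)
    next
      case False
      let ?a = "(n - 1) div 2"
      have "?a < n" using False by linarith
      then have "Suc ?a < 2 ^ Suc (length (std_string ?a))" "length (std_string ?a) \<le> ?a"
        using less.IH by blast+
      moreover have "length (std_string n) = Suc (length (std_string ?a))"
        using False by (subst std_string.simps) simp
      moreover have "n \<le> 2 * ?a + 2" "?a < n" using False by linarith+
      ultimately show ?thesis by (simp only: power_Suc) (intro conjI; linarith)
    qed
  qed
  then show "Suc n < 2 ^ Suc (length (std_string n))" "length (std_string n) \<le> n" by blast+
qed

lemma near_init: "near (length x) 0 (tape (init_config M x) j) (pos (init_config M x) j)"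
  by (auto simp: near_def init_config_def write_tape_def split: if_splits)

locale diagonal =
  fixes G :: tm and f :: "bool list \<Rightarrow> int" and g :: "bool list \<Rightarrow> nat" and m :: nat and p :: "nat poly"
  assumes G: "wf_tm G" "deterministic G"
    and G_run: "\<exists>T c'. T \<le> poly p (length x) \<and> (tm_step G ^^ T) (init_config G x) c' \<and>
      (\<nexists>c''. tm_step G c' c'') \<and> read_tape (tape c' 1) = nat_bits (g x)"
    and g_pow: "\<exists>k. g (unary_pair w r) = 2 ^ k"
begin

text \<open>Tape 0 holds the input, tape 3 the prefix built so far, the tapes from 4 on those of \<open>G\<close>,
  \<open>ip\<close> the position mark and \<open>ic\<close> the step counter.\<close>

abbreviation "K \<equiv> tape_count G"
abbreviation "ip \<equiv> 4 + K"
abbreviation "ic \<equiv> 5 + K"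
abbreviation "k \<equiv> 6 + K"

definition query_string :: "bool list \<Rightarrow> bool list" where
  "query_string w = unary_pair (w @ [True]) (length w + 2)"

definition exponent :: "bool list \<Rightarrow> nat" where
  "exponent w = (SOME k. g (query_string w) = 2 ^ k)"

text \<open>Stated on the symbols of the answer tape, exactly as the program tests them; the
  arithmetic meaning depends on the approximation property and enters through
  \<open>large_int\<close>.\<close>

definition next_bit :: "bool list \<Rightarrow> bool" where
  "next_bit w = (\<not> large (write_tape (int_syms (f (query_string w)))) (int (m + exponent w)) (length w))"

definition states_bound :: nat where
  "states_bound = Suc (Max (insert (start G) (tm_states G)))"

definition run_G :: prog where
  "run_G = Aut (Suc states_bound) (embed_aut G {} 4 ip ic (\<lambda>_. []) (start G))"

definition body :: prog where
  "body = Seq (write_query ic) (Seq run_G (Seq (home 5 ip ic) (Seq Query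
     (Seq (test m ip ic) (Seq (wipe 4 K ic) (decrement ic))))))"

text \<open>Tape 1 must stand at cell 0, from where queries are read, whereas the other heads may
  drift, so their positions are quantified. Tape 2 is left open because the reply replaces its
  content.\<close>

definition inv :: "nat \<Rightarrow> bool list \<Rightarrow> store \<Rightarrow> bool" where
  "inv i w st \<longleftrightarrow> (\<exists>h. st 0 = tz h [] (map Bit (std_string i))) \<and> st 1 = tz 0 [] [] \<and>
     (\<exists>h. st 3 = tz h (map Bit (rev w)) []) \<and> (\<forall>j. 4 \<le> j \<and> j < k \<longrightarrow> (\<exists>h. st j = (\<lambda>_. Blank, h)))"

text \<open>\<open>2 * n + 4\<close> is the length of the query for a prefix of length
  \<open>n\<close>. The running time of \<open>G\<close> enters 8 times directly and 4 times through
  the exponent, which is at most the query length plus that time.\<close>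

definition cost :: "nat \<Rightarrow> nat" where
  "cost n = 32 * n + 12 * poly p (2 * n + 4) + m + 100"

lemma cost_mono: "n \<le> n' \<Longrightarrow> cost n \<le> cost n'"
  using poly_nat_mono[of "2 * n + 4" "2 * n' + 4" p] by (simp add: cost_def)

lemma g_exponent: "g (query_string w) = 2 ^ exponent w"
  unfolding exponent_def using someI_ex[OF g_pow[of "w @ [True]" "length w + 2"]]
  by (simp add: query_string_def)

lemma K2: "2 \<le> K"
  using G(1) by (simp add: wf_tm_def)

lemma runs_body:
  assumes st: "inv i w st" and z: "length w + i \<le> z"
  shows "\<exists>st'. runs k f body st (cost z) st' \<and>
    (if i = 0 then rd (st' 0) = Work 0 \<and> (\<exists>h. st' 3 = tz h (map Bit (rev (w @ [next_bit w]))) [])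
     else inv (i - 1) (w @ [next_bit w]) st')"
proof -
  define u where "u = query_string w"
  define L where "L = length u"
  define kk where "kk = exponent w"
  have L: "L = 2 * length w + 4"
    by (simp add: L_def u_def query_string_def unary_pair_def)
  obtain h0 h3 where h0: "st 0 = tz h0 [] (map Bit (std_string i))" and h3: "st 3 = tz h3 (map Bit (rev w)) []"
    using st by (auto simp: inv_def)
  define h where "h j = snd (st (4 + j))" for j
  define hp where "hp = snd (st ip)"
  define hc where "hc = snd (st ic)"
  have blank: "st j = (\<lambda>_. Blank, snd (st j))" if "4 \<le> j" "j < k" for j
    using st that unfolding inv_def by (metis snd_conv)
  obtain T c' where T: "T \<le> poly p (length u)" "(tm_step G ^^ T) (init_config G u) c'"
    "\<nexists>c''. tm_step G c' c''" "read_tape (tape c' 1) = nat_bits (g u)"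
    using G_run by blast
  let ?c = "init_config G u"
  have T': "(tm_step_until G {} ^^ T) ?c c'"
  proof -
    have "tm_step_until G {} = tm_step G" by (auto simp: fun_eq_iff tm_step_until_def)
    then show ?thesis using T(2) by simp
  qed
  have near: "near L T (tape c' j) (pos c' j)" for j
    using near_steps[OF T' near_init] by (simp add: L_def)
  have out: "read_tape (tape c' 1) = replicate kk False @ [True]"
    using T(4) g_exponent[of w] by (simp add: u_def kk_def nat_bits_power)
  have out0: "tape c' 1 (int i) = Bit False" if "i < kk" for i
    using read_tape_nth[OF out, of i] that by (simp add: nth_append)
  have out1: "tape c' 1 (int kk) = Bit True"
    using read_tape_nth[OF out, of kk] by (simp add: nth_append)
  \<comment> \<open>The final 1 of the output sits in cell \<open>kk\<close>, and a nonblank cell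
    lies in the input block or within reach of the run.\<close>
  have kk: "kk \<le> L + T"
  proof -
    have "0 \<le> int kk \<and> int kk < int L \<or> \<bar>int kk\<bar> \<le> int T \<and> \<bar>int kk - pos c' 1\<bar> \<le> int T"
      using near[of 1] out1 unfolding near_def by (metis Blank_notin_Bits(2))
    then show ?thesis by linarith
  qed
  define s1 where "s1 = st(1 := tz (int L) (map Bit (rev u)) [], 4 := tz (h 0) [] (map Bit u),
       ic := tz (hc + int L) (replicate L (Work 0)) [])"
  have r1: "runs k f (write_query ic) st (5 * length w + 13) s1"
    unfolding s1_def L_def
    by (rule runs_write_query[where w = w and ?h3.0 = h3])
      (use st h3 blank[of 4] blank[of ic] K2 in \<open>auto simp: inv_def tz_blank h_def hc_def u_def query_string_def\<close>)
  \<comment> \<open>Writing the query has already put \<open>L\<close> symbols on the counter, so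
    the simulation starts at count \<open>L\<close>.\<close>
  have s1e: "s1(ip := wr (Work 0, MStay) (s1 ip)) = embed_store K 4 ip ic s1 h hp hc L ?c"
  proof
    fix j
    have a: "s1 j = (\<lambda>_. Blank, h (j - 4))" if "5 \<le> j" "j < 4 + K" for j
    proof -
      have "s1 j = st j" using that by (simp add: s1_def)
      also have "\<dots> = (\<lambda>_. Blank, h (j - 4))"
        using blank[of j] that by (simp add: h_def)
      finally show ?thesis .
    qed
    have b: "s1 ip = (\<lambda>_. Blank, hp)"
    proof -
      have "s1 ip = st ip" using K2 by (simp add: s1_def)
      then show ?thesis using blank[of ip] by (simp add: hp_def)
    qed
    consider "j = 4" | "5 \<le> j" "j < 4 + K" | "j = ip" | "j = ic" | "j < 4" | "k \<le> j" by linarith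
    then show "(s1(ip := wr (Work 0, MStay) (s1 ip))) j = embed_store K 4 ip ic s1 h hp hc L ?c j"
    proof cases
      case 1
      then show ?thesis
        using K2 by (simp add: embed_store_def s1_def init_config_def tz_shift)
    next
      case 2
      then show ?thesis
        using a[of j] by (simp add: embed_store_def init_config_def write_tape_def)
    next
      case 3
      then show ?thesis
        using b by (simp add: embed_store_def init_config_def wr_pair mark_def fun_eq_iff)
    next
      case 4
      then show ?thesis
        by (simp add: embed_store_def s1_def)
    qed (auto simp: embed_store_def)
  qed
  define s2 where "s2 = embed_store K 4 ip ic s1 h hp hc (L + T) c'"
  have r2: "runs k f run_G s1 (T + 2) s2"
  proof -
    have "start G = state ?c" by (simp add: init_config_def)
    then show ?thesis
      using embed_runs[OF T' _ G(2,1) _ _ _ _ _ _ s1e, where k = k and f = f and fl = "\<lambda>_. []"] T(3) K2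
      by (simp add: run_G_def s2_def)
  qed
  define t5 where "t5 = (\<lambda>i. tape c' 1 (i - h 1))"
  have s2_5: "s2 5 = (t5, h 1 + pos c' 1)"
    using K2 by (simp add: s2_def embed_store_def t5_def add.commute)
  define s3 where "s3 = s2(5 := (t5, h 1), ip := (mark hp, hp))"
  have r3: "runs k f (home 5 ip ic) s2 (4 * (L + T) + 5) s3"
    unfolding s3_def
    by (rule runs_home[of s2 5 t5 "h 1" "pos c' 1" ip hp ic "hc + int (L + T)"])
      (use K2 near[of 1] s2_5 in \<open>auto simp: s2_def embed_store_def near_def\<close>)
  have s3_1: "s3 1 = tz (int (length u)) (map Bit (rev u)) []"
    using K2 by (simp add: s3_def s2_def embed_store_def s1_def L_def)
  define t2 where "t2 = write_tape (int_syms (f u))"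
  define s4 where "s4 = s3(1 := (write_tape [], 0), 2 := (t2, 0))"
  have r4: "runs k f Query s3 1 s4"
    using runs_Query[of k f s3] unfolding s4_def t2_def s3_1 by (simp add: read_tape_tz)
  have s4s: "s4 2 = (t2, 0)" "s4 5 = (t5, h 1)" "s4 ic = tz (hc + int (L + T)) (replicate (L + T) (Work 0)) []"
    "s4 3 = tz h3 (map Bit (rev w)) []" "s4 ip = (mark hp, hp)"
    using K2 h3 by (simp_all add: s4_def s3_def s2_def embed_store_def s1_def)
  let ?w' = "w @ [next_bit w]"
  let ?n = "L + T + kk"
  obtain p2 where r5: "runs k f (test m ip ic) s4 (m + kk + 2 * length w + 10)
    (s4(2 := (t2, p2), 5 := (t5, h 1 + int kk), ic := tz (hc + int (L + T) + int kk) (replicate ?n (Work 0)) [],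
      3 := tz (h3 + 1) (Bit (\<not> large t2 (int (m + kk)) (length w)) # map Bit (rev w)) [], ip := (\<lambda>_. Blank, hp)))"
    using runs_test[of s4 t2 t5 "h 1" ic "hc + int (L + T)" "L + T" h3 w ip hp kk k f m, OF s4s] out0 out1 K2
    by (auto simp: t5_def)
  have nb: "next_bit w = (\<not> large t2 (int (m + kk)) (length w))"
    by (simp add: next_bit_def t2_def kk_def u_def)
  define s5 where "s5 = s4(2 := (t2, p2), 5 := (t5, h 1 + int kk),
      ic := tz (hc + int ?n) (replicate ?n (Work 0)) [],
      3 := tz (h3 + 1) (map Bit (rev ?w')) [], ip := (\<lambda>_. Blank, hp))"
  have r5: "runs k f (test m ip ic) s4 (m + kk + 2 * length w + 10) s5"
    using r5 unfolding s5_def nb by (simp add: add.assoc)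
  \<comment> \<open>The counter now holds \<open>L + T + kk\<close> symbols, enough for the input
    block, the moves of \<open>G\<close> and the \<open>kk\<close> further moves on tape 5.\<close>
  define s6 where "s6 = (on_range 4 K (\<lambda>T. (\<lambda>_. Blank, snd T + int ?n)) s5)(ic := tz (hc - 1) [] [])"
  have r6: "runs k f (wipe 4 K ic) s5 (3 * ?n + 6) s6"
  proof (rule runs_eq[OF runs_wipe[where hc = "hc + int ?n"]])
    show "s5 ic = tz (hc + int ?n) (replicate ?n (Work 0)) []"
      by (simp add: s5_def)
    fix j i
    assume j: "4 \<le> j" "j < 4 + K" and i: "fst (s5 j) i \<noteq> Blank"
    \<comment> \<open>The window is open on the right; one symbol of the query makes the bound
      strict.\<close>
    have L1: "1 \<le> L" using L by simp
    show "snd (s5 j) - int ?n \<le> i \<and> i < snd (s5 j) + int ?n"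
    proof (cases "j = 5")
      case True
      then have "s5 j = (t5, h 1 + int kk)"
        using K2 by (simp add: s5_def)
      then show ?thesis
        using i near[of 1] L1 by (auto simp: t5_def near_def)
    next
      case False
      then have "s5 j = (\<lambda>i. tape c' (j - 4) (i - h (j - 4)), pos c' (j - 4) + h (j - 4))"
        using j by (simp add: s5_def s4_def s3_def s2_def embed_store_def)
      then show ?thesis
        using i near[of "j - 4"] L1 by (auto simp: near_def)
    qed
  qed (auto simp: s6_def algebra_simps)
  have s6_0: "s6 0 = tz h0 [] (map Bit (std_string i))"
    using h0 by (simp add: s6_def on_range_def s5_def s4_def s3_def s2_def embed_store_def s1_def)
  obtain h' where r7: "runs k f (decrement ic) s6 (3 * length (std_string i) + 10)
     (s6(0 := if i = 0 then tz h0 [] [Work 0] else tz h' [] (map Bit (std_string (i - 1)))))"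
    using runs_decrement[of s6 h0 i ic "hc - 1" k f, OF s6_0] by (auto simp: s6_def)
  let ?s7 = "s6(0 := if i = 0 then tz h0 [] [Work 0] else tz h' [] (map Bit (std_string (i - 1))))"
  have "runs k f body st (cost z) ?s7"
    unfolding body_def
  proof (rule runs_mono[OF runs_Seq[OF r1 runs_Seq[OF r2 runs_Seq[OF r3 runs_Seq[OF r4 runs_Seq[OF r5 runs_Seq[OF r6 r7]]]]]]])
    have "T \<le> poly p (2 * z + 4)"
      using T(1) poly_nat_mono[of L "2 * z + 4" p] z L by (simp add: L_def)
    moreover have "length (std_string i) \<le> i" by (rule length_std_string)
    ultimately show "5 * length w + 13 + (T + 2 + (4 * (L + T) + 5 + (1 + (m + kk + 2 * length w + 10 +
        (3 * ?n + 6 + (3 * length (std_string i) + 10)))))) \<le> cost z"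
      using z L kk by (simp add: cost_def)
  qed
  moreover have s6_3: "s6 3 = tz (h3 + 1) (map Bit (rev ?w')) []"
    by (simp add: s6_def on_range_def s5_def)
  moreover have "inv (i - 1) ?w' ?s7" if "i \<noteq> 0"
  proof -
    have "\<exists>h. ?s7 j = (\<lambda>_. Blank, h)" if j: "4 \<le> j" "j < k" for j
    proof -
      consider "4 \<le> j" "j < 4 + K" | "j = ip" | "j = ic" using j by linarith
      then show ?thesis
      proof cases
        case 1
        then show ?thesis by (simp add: s6_def on_range_def)
      next
        case 2
        then show ?thesis by (simp add: s6_def on_range_def s5_def)
      next
        case 3
        then show ?thesis by (simp add: s6_def tz_blank)
      qed
    qed
    moreover have "?s7 1 = tz 0 [] []"
      by (simp add: s6_def on_range_def s5_def s4_def tz_write)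
    ultimately show ?thesis
      using that s6_3 by (auto simp: inv_def)
  qed
  ultimately show ?thesis
    by (intro exI[of _ ?s7]) auto
qed

primrec word :: "nat \<Rightarrow> bool list" where
  "word 0 = []"
| "word (Suc n) = word n @ [next_bit (word n)]"

lemma length_word [simp]: "length (word n) = n"
  by (induction n) auto

text \<open>\<open>z\<close> stays fixed while \<open>i\<close> falls, so all rounds share one cost
  bound. The body runs also when tape 0 holds the empty string; that round decides bit
  \<open>j + i\<close>.\<close>

lemma runs_main:
  assumes "inv i (word j) st" "j + i \<le> z"
  shows "\<exists>st' h. runs k f (While (\<lambda>s. s 0 \<noteq> Work 0) body) st (Suc i * (cost z + 1) + 1) st' \<and>
    st' 3 = tz h (map Bit (rev (word (Suc (j + i))))) []"
  using assms
proof (induction i arbitrary: j st)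
  case 0
  obtain st' h where st': "runs k f body st (cost z) st'" "rd (st' 0) = Work 0"
    "st' 3 = tz h (map Bit (rev (word (Suc j)))) []"
    using runs_body[OF 0(1), of z] 0(2) by auto
  have "rd (st 0) \<noteq> Work 0"
    using 0(1) by (auto simp: inv_def std_string.simps[of 0])
  then have "runs k f (While (\<lambda>s. s 0 \<noteq> Work 0) body) st (Suc (cost z + 1)) st'"
    using st' by (intro runs_While_True[OF _ st'(1) runs_While_False]) auto
  then show ?case
    using st'(3) by (intro exI[of _ st'] exI[of _ h]) (auto elim!: runs_mono)
next
  case (Suc i)
  obtain st1 where st1: "runs k f body st (cost z) st1" "inv i (word (Suc j)) st1"
    using runs_body[OF Suc.prems(1), of z] Suc.prems(2) by auto
  obtain st' h where st': "runs k f (While (\<lambda>s. s 0 \<noteq> Work 0) body) st1 (Suc i * (cost z + 1) + 1) st'"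
    "st' 3 = tz h (map Bit (rev (word (Suc (Suc j + i))))) []"
    using Suc.IH[OF st1(2)] Suc.prems(2) by auto
  have "hdb (map Bit x) \<noteq> Work 0" for x
    by (cases x) auto
  then have "rd (st 0) \<noteq> Work 0"
    using Suc.prems(1) by (auto simp: inv_def)
  then have "runs k f (While (\<lambda>s. s 0 \<noteq> Work 0) body) st (Suc (cost z + (Suc i * (cost z + 1) + 1))) st'"
    by (intro runs_While_True[OF _ st1(1) st'(1)]) auto
  then show ?case
    using st'(2) by (intro exI[of _ st'] exI[of _ h]) (auto elim!: runs_mono)
qed

text \<open>One step left from the end of the prefix, its last bit, the verdict on the input string,
  becomes a scanned symbol, as \<open>E_oracleI\<close> expects.\<close>

definition diag_prog :: prog where
  "diag_prog = Seq (While (\<lambda>s. s 0 \<noteq> Work 0) body) (do_left 3)"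

definition diag_set :: "bool list set" where
  "diag_set = {std_string n | n. next_bit (word n)}"

lemma runs_diag:
  "\<exists>st'. runs k f diag_prog (init_store (std_string n)) (Suc n * (cost n + 1) + 2) st' \<and>
     (scan k st' 3 = Bit True \<longleftrightarrow> std_string n \<in> diag_set)"
proof -
  have "inv n (word 0) (init_store (std_string n))"
    by (auto simp: inv_def init_store_def tz_write intro!: exI[of _ 0]) (simp_all add: tz_blank flip: tz_write)
  from runs_main[OF this, of n] obtain st' h where
    st': "runs k f (While (\<lambda>s. s 0 \<noteq> Work 0) body) (init_store (std_string n)) (Suc n * (cost n + 1) + 1) st'"
    "st' 3 = tz h (Bit (next_bit (word n)) # map Bit (rev (word n))) []"
    by auto
  have r: "runs k f (do_left 3) st' 1
      (st'(3 := tz (h - 1) (map Bit (rev (word n))) [Bit (next_bit (word n))]))"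
    by (rule runs_Do) (use st'(2) in auto)
  have "std_string n \<in> diag_set \<longleftrightarrow> next_bit (word n)"
    using bij_std_string by (auto simp: diag_set_def bij_def dest: injD)
  then show ?thesis
    unfolding diag_prog_def
    by (intro exI[of _ "st'(3 := tz (h - 1) (map Bit (rev (word n))) [Bit (next_bit (word n))])"] conjI
        runs_mono[OF runs_Seq[OF st'(1) r]]) auto
qed

lemma prefix_diag: "prefix_of (char_seq diag_set) n = word n"
proof (induction n)
  case 0
  show ?case by (simp add: prefix_of_def)
next
  case (Suc n)
  have "char_seq diag_set n = next_bit (word n)"
    using bij_std_string by (auto simp: char_seq_def diag_set_def bij_def dest: injD)
  then show ?case
    using Suc by (simp add: prefix_of_def)
qed

lemma wf_diag_prog:
  assumes S: "S = basic \<union> tm_syms G"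
  shows "wf_prog k S diag_prog"
proof -
  have b: "basic \<subseteq> S" "Blank \<in> S" "Work 0 \<in> S" "Work 1 \<in> S" "Bit b \<in> S" for b
    by (cases b; auto simp: S basic_def)+
  have adv: "wf_prog k S (advance i)" for i
    by (induction i) auto
  have "q < states_bound" if "q \<in> insert (start G) (tm_states G)" for q
    using that finite_tm_states[OF G(1)] by (auto simp: states_bound_def less_Suc_eq_le intro!: Max_ge)
  then have "wf_prog k S run_G"
    unfolding run_G_def using K2 S b(1) by (intro embed_wf G(1)) auto
  then show ?thesis
    using K2 b adv by (auto simp: diag_prog_def body_def write_query_def put_def test_def decrement_def
        wf_prog_go_left wf_prog_home wf_prog_wipe)
qed

lemma queries_diag_prog: "queries diag_prog = 1"
proof -
  have "queries (advance i) = 0" for i by (induction i) auto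
  then show ?thesis
    by (simp add: diag_prog_def body_def write_query_def test_def decrement_def run_G_def)
qed

theorem diag_in_E_oracle:
  assumes "f \<in> F"
  shows "diag_set \<in> E_oracle F"
proof -
  \<comment> \<open>The time bound of \<open>runs_diag\<close> with the variable in place of
    \<open>Suc n\<close>; by monotonicity 2 to the input length plus 1 may be inserted for
    it.\<close>
  define q :: "nat poly" where "q = [:0, 1:] * ([:m + 101, 32:] + smult 12 (pcompose p [:4, 2:])) + [:2:]"
  have q: "poly q x = x * (cost x + 1) + 2" for x
    by (simp add: q_def cost_def poly_pcompose algebra_simps)
  obtain c where c: "\<And>n. poly q (2 ^ (1 * n + 1)) \<le> 2 ^ (c * n + c)"
    using poly_exp_bound[of q 1] by blast
  show ?thesis
  proof (rule E_oracleI[OF assms _ _ _ wf_diag_prog[OF refl] queries_diag_prog])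
    fix x :: "bool list"
    obtain n where n: "x = std_string n"
      using bij_std_string by (metis bij_pointE)
    obtain st' where st': "runs k f diag_prog (init_store x) (Suc n * (cost n + 1) + 2) st'"
      "scan k st' 3 = Bit True \<longleftrightarrow> x \<in> diag_set"
      using runs_diag[of n] n by auto
    have "Suc n \<le> 2 ^ (1 * length x + 1)"
      using length_std_string(1)[of n] n by simp
    then have "Suc n * (cost n + 1) + 2 \<le> poly q (2 ^ (1 * length x + 1))"
      unfolding q by (intro add_mono mult_mono cost_mono) auto
    also have "\<dots> \<le> 2 ^ (c * length x + c)" by (rule c)
    finally show "\<exists>st'. runs k f diag_prog (init_store x) (2 ^ (c * length x + c)) st' \<and>
        (scan k st' 3 = Bit True \<longleftrightarrow> x \<in> diag_set)"
      using st' runs_mono by blast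
  qed (use G(1) finite_tm_syms[OF G(1)] in \<open>auto simp: basic_def\<close>)
qed

end

section \<open>Classes are not null in their own measure\<close>

lemma length_nat_bits: "length (nat_bits v) \<le> e \<longleftrightarrow> v < 2 ^ e"
proof (induction e arbitrary: v)
  case 0
  show ?case by (subst nat_bits.simps) simp
next
  case (Suc e)
  show ?case
  proof (cases "v = 0")
    case True
    then show ?thesis by (simp add: nat_bits.simps)
  next
    case False
    then have "length (nat_bits v) = Suc (length (nat_bits (v div 2)))"
      by (subst nat_bits.simps) simp
    then show ?thesis
      using Suc.IH[of "v div 2"] by (auto simp: div_less_iff_less_mult mult.commute)
  qed
qed

lemma nth_nat_bits: "i < length (nat_bits v) \<Longrightarrow> nat_bits v ! i = odd (v div 2 ^ i)"
proof (induction i arbitrary: v)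
  case 0
  then show ?case by (subst nat_bits.simps) (auto simp: nat_bits.simps[of 0])
next
  case (Suc i)
  have "v \<noteq> 0"
    using Suc.prems by (cases "v = 0") (simp_all add: nat_bits.simps[of 0])
  then have v: "nat_bits v = odd v # nat_bits (v div 2)"
    by (subst nat_bits.simps) simp
  then have "nat_bits v ! Suc i = nat_bits (v div 2) ! i" by simp
  also have "\<dots> = odd (v div 2 div 2 ^ i)"
    using Suc.prems v by (intro Suc.IH) simp
  finally show ?case by (simp add: div_mult2_eq)
qed

text \<open>Among the numbers with at most \<open>n\<close> binary digits only 2^n - 1 has ones
  throughout.\<close>

lemma all_odd_iff: "(\<forall>i<n. odd (v div 2 ^ i)) \<longleftrightarrow> 2 ^ n - 1 \<le> v" if "v < 2 ^ n" for v n :: nat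
  using that
proof (induction n arbitrary: v)
  case 0
  then show ?case by simp
next
  case (Suc n)
  have "(\<forall>i<Suc n. odd (v div 2 ^ i)) \<longleftrightarrow> odd v \<and> (\<forall>i<n. odd (v div 2 div 2 ^ i))"
    by (auto simp: less_Suc_eq_0_disj div_mult2_eq)
  also have "\<dots> \<longleftrightarrow> odd v \<and> 2 ^ n - 1 \<le> v div 2"
    using Suc.IH[of "v div 2"] Suc.prems by auto
  also have "\<dots> \<longleftrightarrow> 2 ^ Suc n - 1 \<le> v"
  proof -
    have "1 \<le> (2::nat) ^ n" by simp
    moreover have "v < 2 * 2 ^ n" using Suc.prems by simp
    ultimately show ?thesis
      unfolding power_Suc by presburger
  qed
  finally show ?case .
qed

text \<open>If \<open>v\<close> reaches 2^e, a digit at position \<open>e\<close> or beyond makes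
  that cell nonblank. Otherwise only the block of the top \<open>n + 1\<close> digits matters,
  because the threshold has ones there and zeros below.\<close>

lemma large_nat:
  "large (write_tape (map Bit (nat_bits v))) (int e) n \<longleftrightarrow> (2::real) ^ e - 2 ^ e / 2 ^ Suc n \<le> real v"
proof (cases "2 ^ e \<le> v")
  case True
  then have "e < length (nat_bits v)"
    using length_nat_bits[of v e] by simp
  then have "large (write_tape (map Bit (nat_bits v))) (int e) n"
    by (auto simp: large_def write_tape_def)
  moreover have "(2::real) ^ e \<le> real v"
    using True by (metis of_nat_le_iff of_nat_numeral of_nat_power)
  then have "(2::real) ^ e - 2 ^ e / 2 ^ Suc n \<le> real v"
    by (smt (verit) divide_nonneg_nonneg zero_le_power)
  ultimately show ?thesis by simp
next
  case False
  then have v: "v < 2 ^ e" by simp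
  then have le: "length (nat_bits v) \<le> e"
    using length_nat_bits by blast
  have cell: "write_tape (map Bit (nat_bits v)) (int e - 1 - int i) = Bit True \<longleftrightarrow> i < e \<and> odd (v div 2 ^ (e - 1 - i))" for i
  proof (cases "i < e")
    case True
    then have n: "nat (int e - 1 - int i) = e - 1 - i" "0 \<le> int e - 1 - int i" by linarith+
    show ?thesis
    proof (cases "e - 1 - i < length (nat_bits v)")
      case l: True
      then show ?thesis
        unfolding write_tape_def n(1) using n(2) True by (simp add: nth_nat_bits)
    next
      case False
      then have "v < 2 ^ (e - 1 - i)"
        using length_nat_bits[of v "e - 1 - i"] by simp
      then show ?thesis
        unfolding write_tape_def n(1) using False by simp
    qed
  qed (auto simp: write_tape_def)
  have blank: "write_tape (map Bit (nat_bits v)) (int e) = Blank"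
    using le by (simp add: write_tape_def)
  have large: "large (write_tape (map Bit (nat_bits v))) (int e) n \<longleftrightarrow> (\<forall>i\<le>n. i < e \<and> odd (v div 2 ^ (e - 1 - i)))"
    unfolding large_def blank cell by simp
  show ?thesis
  proof (cases "n < e")
    case True
    define a where "a = e - Suc n"
    have e: "e = a + Suc n" using True by (simp add: a_def)
    \<comment> \<open>The block of digits under test, read as a number below 2^(n+1).\<close>
    define x where "x = v div 2 ^ a"
    have x: "x < 2 ^ Suc n"
      using v by (simp add: x_def e div_less_iff_less_mult power_add mult.commute)
    have "(\<forall>i\<le>n. i < e \<and> odd (v div 2 ^ (e - 1 - i))) \<longleftrightarrow> (\<forall>j<Suc n. odd (x div 2 ^ j))"
    proof -
      have *: "v div 2 ^ (a + j) = x div 2 ^ j" for j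
        by (simp add: x_def power_add div_mult2_eq)
      show ?thesis
      proof (intro iffI allI impI conjI)
        fix j assume "\<forall>i\<le>n. i < e \<and> odd (v div 2 ^ (e - 1 - i))" "j < Suc n"
        then have "odd (v div 2 ^ (e - 1 - (n - j)))" by (meson diff_le_self)
        moreover have "e - 1 - (n - j) = a + j" using \<open>j < Suc n\<close> e by simp
        ultimately show "odd (x div 2 ^ j)" using * by simp
      next
        fix i assume "\<forall>j<Suc n. odd (x div 2 ^ j)" "i \<le> n"
        then have "odd (x div 2 ^ (n - i))" by simp
        moreover have "e - 1 - i = a + (n - i)" using \<open>i \<le> n\<close> e by simp
        ultimately show "odd (v div 2 ^ (e - 1 - i))" using * by simp
      qed (use e in simp)
    qed
    also have "\<dots> \<longleftrightarrow> 2 ^ Suc n - 1 \<le> x" by (rule all_odd_iff[OF x])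
    also have "\<dots> \<longleftrightarrow> (2 ^ Suc n - 1) * 2 ^ a \<le> v"
      by (simp only: x_def less_eq_div_iff_mult_less_eq zero_less_power pos2)
    also have "\<dots> \<longleftrightarrow> real ((2 ^ Suc n - 1) * 2 ^ a) \<le> real v" by (simp only: of_nat_le_iff)
    also have "real ((2 ^ Suc n - 1) * 2 ^ a) = 2 ^ e - 2 ^ e / 2 ^ Suc n"
      by (simp add: e power_add of_nat_diff algebra_simps)
    finally show ?thesis using large by simp
  next
    case False
    \<comment> \<open>The tested positions reach below digit 0, where the tape is blank, and the
      threshold lies strictly between 2^e - 1 and 2^e, above the integer \<open>v\<close>.\<close>
    then have "\<not> large (write_tape (map Bit (nat_bits v))) (int e) n"
      unfolding large by (intro notI) (auto dest: spec[of _ e])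
    moreover have "real v \<le> 2 ^ e - 1"
      using v by (metis Suc_leI add.commute le_diff_eq of_nat_Suc of_nat_le_iff of_nat_numeral of_nat_power)
    moreover have "(2::real) ^ e / 2 ^ Suc n < 1"
      using False by (simp add: divide_less_eq power_strict_increasing_iff del: power_Suc)
    ultimately show ?thesis by linarith
  qed
qed

text \<open>An approximation of a nonnegative value may be negative, but then its modulus is at most
  1/4, so minus sign and digits together stay below cell \<open>kk\<close>. As \<open>0 < m\<close>,
  the first tested positions are at or beyond \<open>kk\<close> and hence blank.\<close>

lemma large_int:
  assumes "\<bar>d - real_of_int v / 2 ^ kk\<bar> \<le> 1 / 2 ^ (n + 2)" "0 \<le> d" "0 < m"
  shows "large (write_tape (int_syms v)) (int (m + kk)) n \<longleftrightarrow> (2::real) ^ m - 2 ^ m / 2 ^ Suc n \<le> real_of_int v / 2 ^ kk"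
proof (cases "0 \<le> v")
  case True
  have "int_syms v = map Bit (nat_bits (nat v))"
    using True by (simp add: int_syms_def)
  then have "large (write_tape (int_syms v)) (int (m + kk)) n \<longleftrightarrow>
      (2::real) ^ (m + kk) - 2 ^ (m + kk) / 2 ^ Suc n \<le> real (nat v)"
    using large_nat[of "nat v" "m + kk" n] by simp
  also have "(2::real) ^ (m + kk) - 2 ^ (m + kk) / 2 ^ Suc n = (2 ^ m - 2 ^ m / 2 ^ Suc n) * 2 ^ kk"
    by (simp add: power_add algebra_simps)
  also have "real (nat v) = real_of_int v" using True by simp
  finally show ?thesis
    by (simp only: pos_le_divide_eq zero_less_power zero_less_numeral)
next
  case False
  define V where "V = nat \<bar>v\<bar>"
  have V: "real_of_int v = - real V" "0 < V" using False by (auto simp: V_def)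
  have "real V / 2 ^ kk \<le> 1 / 2 ^ (n + 2)"
    using assms(1,2) V by auto
  also have "\<dots> \<le> 1 / 4"
    using one_le_power[of "2::real" n] by (simp add: field_simps)
  finally have "4 * real V \<le> 2 ^ kk" by (simp add: field_simps)
  then have V4: "4 * V \<le> 2 ^ kk"
    by (metis of_nat_le_iff of_nat_mult of_nat_numeral of_nat_power)
  then obtain k' where k': "kk = Suc k'"
    using V(2) by (cases kk) auto
  have "V < 2 ^ k'"
    using V4 V(2) by (simp add: k')
  then have "length (nat_bits V) \<le> k'"
    using length_nat_bits by blast
  then have "length (int_syms v) \<le> kk"
    using False by (simp add: int_syms_def V_def k')
  then have "write_tape (int_syms v) (int (m + kk)) = Blank" "write_tape (int_syms v) (int (m + kk) - 1 - int 0) = Blank"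
    using assms(3) by (auto simp: write_tape_def nat_less_iff)
  then have "\<not> large (write_tape (int_syms v)) (int (m + kk)) n"
    unfolding large_def by (metis Blank_notin_Bits(2) le0)
  moreover have "real_of_int v / 2 ^ kk < 0" using V by simp
  moreover have "(2::real) ^ m / 2 ^ Suc n \<le> 2 ^ m" by (simp add: divide_le_eq one_le_power del: power_Suc)
  ultimately show ?thesis by linarith
qed

theorem not_measure_zero_E_oracle: "\<not> measure_zero \<Delta> (E_oracle \<Delta>)"
proof
  assume "measure_zero \<Delta> (E_oracle \<Delta>)"
  then obtain d where d: "class_martingale \<Delta> d" "\<And>A. A \<in> E_oracle \<Delta> \<Longrightarrow> succeeds_on d (char_seq A)"
    by (auto simp: measure_zero_def)
  then obtain f g where mart: "martingale d" and f: "f \<in> \<Delta>" and g: "poly_time_computable g"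
    and pow: "\<And>w r. \<exists>k. g (unary_pair w r) = 2 ^ k"
    and approx: "\<And>w r. \<bar>d w - real_of_int (f (unary_pair w r)) / real (g (unary_pair w r))\<bar> \<le> 1 / 2 ^ r"
    unfolding class_martingale_def by blast
  obtain G :: tm where G: "wf_tm G" "deterministic G" "poly_time G"
    "\<And>x cs. halting_computation (tm_step G) (init_config G x) cs \<Longrightarrow> read_tape (tape (last cs) 1) = nat_bits (g x)"
    using g unfolding poly_time_computable_def by blast
  obtain p :: "nat poly" where p: "\<And>x. \<exists>T c'. T \<le> poly p (length x) \<and> (tm_step G ^^ T) (init_config G x) c' \<and>
      (\<nexists>c''. tm_step G c' c'')"
    using poly_time_halts[OF G(3)] by blast
  have run: "\<exists>T c'. T \<le> poly p (length x) \<and> (tm_step G ^^ T) (init_config G x) c' \<and>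
      (\<nexists>c''. tm_step G c' c'') \<and> read_tape (tape c' 1) = nat_bits (g x)" for x
  proof -
    obtain T c' where T: "T \<le> poly p (length x)" "(tm_step G ^^ T) (init_config G x) c'" "\<nexists>c''. tm_step G c' c''"
      using p by blast
    then obtain cs where "computation (tm_step G) (init_config G x) cs" "last cs = c'"
      by (auto simp: relpowp_computation)
    then have "read_tape (tape c' 1) = nat_bits (g x)"
      using G(4)[of x cs] T(3) by (auto simp: halting_computation_def)
    then show ?thesis using T by blast
  qed
  obtain m where m: "d [] < 2 ^ m"
    using real_arch_pow[of 2 "d []"] by auto
  \<comment> \<open>With exponent \<open>Suc m\<close> the first threshold is 2^m, half of the final
    bound and above \<open>d []\<close>.\<close>
  interpret diagonal G f g "Suc m" p
    by unfold_locales (use G run pow in auto)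
  have nonneg: "0 \<le> d w" and avg: "d w = (d (w @ [False]) + d (w @ [True])) / 2" for w
    using mart by (auto simp: martingale_def)
  have bound: "d (word n) \<le> 2 ^ Suc m - 2 ^ Suc m / 2 ^ Suc n" for n
  proof (induction n)
    case 0
    show ?case using m by simp
  next
    case (Suc n)
    let ?w = "word n"
    let ?D = "(2::real) ^ Suc m - 2 ^ Suc m / 2 ^ Suc n"
    let ?a = "real_of_int (f (query_string ?w)) / 2 ^ exponent ?w"
    have a: "\<bar>d (?w @ [True]) - ?a\<bar> \<le> 1 / 2 ^ (n + 2)"
      using approx[of "?w @ [True]" "n + 2"] g_exponent[of ?w] by (simp add: query_string_def)
    have next_bit: "next_bit ?w \<longleftrightarrow> \<not> ?D \<le> ?a"
      unfolding next_bit_def using large_int[OF a nonneg, of "Suc m"] by simp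
    have "d (word (Suc n)) \<le> ?D + 1 / 2 ^ (n + 2)"
    proof (cases "next_bit ?w")
      case True
      then show ?thesis using a next_bit by simp
    next
      case False
      then have "?D \<le> ?a" using next_bit by simp
      then have "?D - 1 / 2 ^ (n + 2) \<le> d (?w @ [True])" using a by linarith
      \<comment> \<open>If \<open>d\<close> is almost \<open>?D\<close> on \<open>w1\<close>,
        averaging with the bound \<open>?D\<close> on \<open>w\<close> leaves at most
        \<open>?D\<close> plus the error on \<open>w0\<close>.\<close>
      then show ?thesis using False Suc.IH avg[of ?w] by simp
    qed
    also have "\<dots> \<le> 2 ^ Suc m - 2 ^ Suc m / 2 ^ Suc (Suc n)"
    proof -
      have "(1::real) / 2 ^ (n + 2) \<le> 2 ^ Suc m / 2 ^ (n + 2)"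
        by (intro divide_right_mono one_le_power) auto
      moreover have "(2::real) ^ Suc m / 2 ^ Suc n = 2 * (2 ^ Suc m / 2 ^ (n + 2))"
        by (simp add: field_simps)
      ultimately show ?thesis by simp
    qed
    finally show ?case .
  qed
  have "d (prefix_of (char_seq diag_set) n) \<le> 2 ^ Suc m" for n
  proof -
    have "(0::real) \<le> 2 ^ Suc m / 2 ^ Suc n" by simp
    then show ?thesis unfolding prefix_diag using bound[of n] by linarith
  qed
  then have "limsup (\<lambda>n. ereal (d (prefix_of (char_seq diag_set) n))) \<le> ereal (2 ^ Suc m)"
    by (intro Limsup_bounded always_eventually) simp
  moreover have "succeeds_on d (char_seq diag_set)"
    by (intro d(2) diag_in_E_oracle f)
  ultimately show False
    by (simp add: succeeds_on_def)
qed

section \<open>Path counts under extension of a machine\<close>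

lemma computation_unfold:
  "computation step c cs \<longleftrightarrow> (\<exists>ds. cs = c # ds \<and> (ds = [] \<or> (\<exists>c'. step c c' \<and> computation step c' ds)))"
  by (cases cs) (auto simp: computation_def successively_Cons)

lemma halting_computation_unfold:
  "halting_computation step c cs \<longleftrightarrow> (\<exists>ds. cs = c # ds \<and>
     ((ds = [] \<and> (\<nexists>c'. step c c')) \<or> (\<exists>c'. step c c' \<and> halting_computation step c' ds)))"
  by (cases cs) (auto simp: halting_computation_def computation_def successively_Cons)

abbreviation "halting_path M \<equiv> halting_computation (tm_step M)"

text \<open>The successor makes the base at least 1, so its powers also bound the single path from a
  halted configuration.\<close>

definition tm_bound :: "'a tm_scheme \<Rightarrow> nat" where
  "tm_bound M = Suc (card (delta M))"

text \<open>Paths are split by their first step. Finiteness is as important as the bound: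
  \<open>card\<close> is 0 on infinite sets, and path counts could not be added.\<close>

lemma card_halting_computations:
  assumes "finite (delta M)" "\<And>cs. computation (tm_step M) c cs \<Longrightarrow> length cs \<le> Suc n"
  shows "finite {cs. halting_path M c cs} \<and>
    card {cs. halting_path M c cs} \<le> tm_bound M ^ n"
  using assms(2)
proof (induction n arbitrary: c)
  case 0
  have "{cs. halting_path M c cs} \<subseteq> {[c]}"
  proof
    fix cs assume cs: "cs \<in> {cs. halting_path M c cs}"
    then have "length cs \<le> 1" using 0 by (auto simp: halting_computation_def)
    then show "cs \<in> {[c]}"
      using cs by (cases cs) (auto simp: halting_computation_def computation_def)
  qed
  then show ?case
    using finite_subset card_mono[of "{[c]}"] by fastforce
next
  case (Suc n)
  let ?H = "\<lambda>c. {cs. halting_path M c cs}"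
  let ?N = "{c'. tm_step M c c'}"
  have N: "?N \<subseteq> (\<lambda>(q, rs, q', as). perform q' as c) ` delta M"
    by (force simp: tm_step_def)
  then have finN: "finite ?N" using assms(1) finite_surj by blast
  have cardN: "card ?N \<le> tm_bound M"
    using surj_card_le[OF assms(1) N] by (simp add: tm_bound_def)
  have IH: "finite (?H c') \<and> card (?H c') \<le> tm_bound M ^ n" if "c' \<in> ?N" for c'
  proof (rule Suc.IH)
    fix cs assume "computation (tm_step M) c' cs"
    then have "computation (tm_step M) c (c # cs)"
      using that computation_unfold by blast
    then show "length cs \<le> Suc n" using Suc.prems by fastforce
  qed
  show ?case
  proof (cases "?N = {}")
    case True
    then have "?H c = {[c]}"
      by (subst halting_computation_unfold) auto
    then show ?thesis by (simp add: tm_bound_def one_le_power del: power_Suc)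
  next
    case False
    then have H: "?H c = (\<lambda>cs. c # cs) ` (\<Union>c'\<in>?N. ?H c')"
      by (subst halting_computation_unfold) auto
    have "card (?H c) \<le> card (\<Union>c'\<in>?N. ?H c')"
      unfolding H by (rule card_image_le) (use finN IH in auto)
    also have "\<dots> \<le> (\<Sum>c'\<in>?N. card (?H c'))" by (rule card_UN_le[OF finN])
    also have "\<dots> \<le> (\<Sum>c'\<in>?N. tm_bound M ^ n)" by (rule sum_mono) (use IH in auto)
    also have "\<dots> \<le> tm_bound M ^ Suc n" using cardN by simp
    finally show ?thesis
      unfolding H using finN IH by auto
  qed
qed

section \<open>Machines that branch once more where a given machine halts\<close>

definition idle :: "sym list \<Rightarrow> (sym \<times> move) list" where
  "idle rs = map (\<lambda>x. (x, MStay)) rs"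

text \<open>All symbols that can be met on an input string; because this set is finite, every
  reading on which \<open>M\<close> halts can be given transitions.\<close>

definition tm_alphabet :: "'a tm_scheme \<Rightarrow> sym set" where
  "tm_alphabet M = {Blank, Bit False, Bit True} \<union> tm_syms M"

text \<open>A copy of \<open>M\<close> with renamed states; where \<open>M\<close> halts in state \<open>q\<close>, it branches into the
  states of \<open>F q\<close>.\<close>

definition extend_delta :: "'a tm_scheme \<Rightarrow> (nat \<Rightarrow> nat) \<Rightarrow> (nat \<Rightarrow> nat set) \<Rightarrow> trans set" where
  "extend_delta M s F = (\<lambda>(q, rs, q', as). (s q, rs, s q', as)) ` delta M \<union>
     (\<lambda>((q, rs), r). (s q, rs, r, idle rs)) `
       ((SIGMA (q, rs) : insert (start M) (tm_states M) \<times> words (tape_count M) (tm_alphabet M). F q)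
         \<inter> {((q, rs), r). \<nexists>q' as. (q, rs, q', as) \<in> delta M})"

text \<open>The offset \<open>a\<close> of the input tape is 0 when the input is taken over as it
  is, and 1 when a first bit has been consumed.\<close>

definition shift_config :: "(nat \<Rightarrow> nat) \<Rightarrow> int \<Rightarrow> config \<Rightarrow> config" where
  "shift_config s a c = \<lparr>state = s (state c), tape = (tape c)(0 := (\<lambda>i. tape c 0 (i - a))), pos = (pos c)(0 := pos c 0 + a)\<rparr>"

definition regular :: "'a tm_scheme \<Rightarrow> config \<Rightarrow> bool" where
  "regular M c \<longleftrightarrow> state c \<in> insert (start M) (tm_states M) \<and> (\<forall>j i. tape c j i \<in> tm_alphabet M)"

lemma regular_init: "regular M (init_config M x)"
proof -
  have "Bit b \<in> tm_alphabet M" "Blank \<in> tm_alphabet M" for b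
    by (cases b; simp add: tm_alphabet_def)+
  then show ?thesis
    by (auto simp: regular_def init_config_def intro!: write_tape_over)
qed

lemma regular_step:
  assumes "regular M c" "tm_step M c c'"
  shows "regular M c'"
proof -
  obtain q as where d: "(state c, scanned (tape_count M) c, q, as) \<in> delta M" "c' = perform q as c"
    using assms(2) by (auto simp: tm_step_def)
  have "q \<in> tm_states M"
    unfolding tm_states_def by (rule UN_I[OF d(1)]) simp
  moreover have "fst ` set as \<subseteq> tm_alphabet M"
    unfolding tm_alphabet_def tm_syms_def by (rule subsetI, rule UnI2, rule UN_I[OF d(1)]) simp
  then have "fst (as ! j) \<in> tm_alphabet M" if "j < length as" for j
    using that by auto
  ultimately show ?thesis
    using assms(1) d(2) by (auto simp: regular_def perform_def)
qed

lemma scanned_regular: "regular M c \<Longrightarrow> scanned (tape_count M) c \<in> words (tape_count M) (tm_alphabet M)"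
  by (auto simp: regular_def scanned_def words_def)

lemma scanned_shift: "scanned k (shift_config s a c) = scanned k c"
  by (auto simp: scanned_def shift_config_def)

lemma perform_shift:
  "0 < length as \<Longrightarrow> perform (s q) as (shift_config s a c) = shift_config s a (perform q as c)"
  by (auto simp: perform_def shift_config_def fun_eq_iff)

lemma inj_shift_config: "inj s \<Longrightarrow> inj (shift_config s a)"
proof (rule injI)
  fix c c' assume s: "inj s" and e: "shift_config s a c = shift_config s a c'"
  have "tape c j i = tape c' j i" for j i
  proof (cases "j = 0")
    case True
    have "tape (shift_config s a c) 0 (i + a) = tape (shift_config s a c') 0 (i + a)" using e by simp
    then show ?thesis using True by (simp add: shift_config_def)
  next
    case False
    have "tape (shift_config s a c) j i = tape (shift_config s a c') j i" using e by simp
    then show ?thesis using False by (simp add: shift_config_def)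
  qed
  moreover have "pos c j = pos c' j" for j
  proof -
    have "pos (shift_config s a c) j = pos (shift_config s a c') j" using e by simp
    then show ?thesis by (auto simp: shift_config_def split: if_splits)
  qed
  moreover have "state c = state c'"
    using e s by (auto simp: shift_config_def inj_eq)
  ultimately show "c = c'" by (simp add: fun_eq_iff)
qed

text \<open>Agreement with \<open>extend_delta\<close> is demanded only in states
  \<open>s q\<close>, so \<open>M'\<close> may have a start state of its own and hold several
  renamed copies of \<open>M\<close>.\<close>

locale extension =
  fixes M :: tm and s :: "nat \<Rightarrow> nat" and F :: "nat \<Rightarrow> nat set" and M' :: tm
  assumes M: "wf_tm M" and s: "inj s" and F: "\<And>q. F q \<noteq> {}" "\<And>q. F q \<subseteq> {1, 2}"
    and tc: "tape_count M' = tape_count M"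
    and delta': "\<And>q rs q' as. (s q, rs, q', as) \<in> delta M' \<longleftrightarrow> (s q, rs, q', as) \<in> extend_delta M s F"
    and final: "\<And>q rs q' as. (q, rs, q', as) \<in> delta M' \<Longrightarrow> q \<notin> {1, 2}"
begin

definition finish :: "int \<Rightarrow> nat \<Rightarrow> config \<Rightarrow> config" where
  "finish a r c = perform r (idle (scanned (tape_count M) c)) (shift_config s a c)"

lemma state_finish [simp]: "state (finish a r c) = r"
  by (simp add: finish_def perform_def)

lemma step_iff:
  assumes "regular M c"
  shows "tm_step M' (shift_config s a c) d \<longleftrightarrow>
    (\<exists>c'. tm_step M c c' \<and> d = shift_config s a c') \<or>
    (\<nexists>c'. tm_step M c c') \<and> (\<exists>r \<in> F (state c). d = finish a r c)"
proof -
  let ?rs = "scanned (tape_count M) c"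
  have pos: "0 < length as" if "(q, rs, q', as) \<in> delta M" for q rs q' as
  proof -
    have "length as = tape_count M" "2 \<le> tape_count M" using M that unfolding wf_tm_def by blast+
    then show ?thesis by (simp add: M)
  qed
  have "tm_step M' (shift_config s a c) d \<longleftrightarrow>
      (\<exists>q as. (s (state c), ?rs, q, as) \<in> extend_delta M s F \<and> d = perform q as (shift_config s a c))"
    unfolding tm_step_def tc scanned_shift using delta' by (simp add: shift_config_def)
  also have "\<dots> \<longleftrightarrow> (\<exists>q as. (state c, ?rs, q, as) \<in> delta M \<and> d = perform (s q) as (shift_config s a c)) \<or>
      (\<nexists>q as. (state c, ?rs, q, as) \<in> delta M) \<and> (\<exists>r \<in> F (state c). d = finish a r c)"
  proof -
    have "(s (state c), ?rs, q, as) \<in> extend_delta M s F \<longleftrightarrow>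
        (\<exists>q'. q = s q' \<and> (state c, ?rs, q', as) \<in> delta M) \<or>
        (\<nexists>q as. (state c, ?rs, q, as) \<in> delta M) \<and> q \<in> F (state c) \<and> as = idle ?rs" for q as
    proof -
      have 1: "(s (state c), ?rs, q, as) \<in> (\<lambda>(q, rs, q', as). (s q, rs, s q', as)) ` delta M \<longleftrightarrow>
          (\<exists>q'. q = s q' \<and> (state c, ?rs, q', as) \<in> delta M)"
        using s by (force simp: image_iff inj_eq)
      have 2: "state c \<in> insert (start M) (tm_states M)" "?rs \<in> words (tape_count M) (tm_alphabet M)"
        using assms scanned_regular by (auto simp: regular_def)
      have 3: "(s (state c), ?rs, q, as) \<in> (\<lambda>((q, rs), r). (s q, rs, r, idle rs)) `
       ((SIGMA (q, rs) : insert (start M) (tm_states M) \<times> words (tape_count M) (tm_alphabet M). F q)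
         \<inter> {((q, rs), r). \<nexists>q' as. (q, rs, q', as) \<in> delta M}) \<longleftrightarrow>
        (\<nexists>q as. (state c, ?rs, q, as) \<in> delta M) \<and> q \<in> F (state c) \<and> as = idle ?rs" (is "?l \<longleftrightarrow> ?r")
      proof
        assume ?l
        then show ?r using s by (auto simp: inj_eq)
      next
        assume ?r
        then show ?l
          using 2 by (intro image_eqI[of _ _ "((state c, ?rs), q)"]) auto
      qed
      show ?thesis unfolding extend_delta_def Un_iff 1 3 ..
    qed
    note this[simp]
    show ?thesis unfolding finish_def by auto
  qed
  also have "\<dots> \<longleftrightarrow> (\<exists>c'. tm_step M c c' \<and> d = shift_config s a c') \<or>
    (\<nexists>c'. tm_step M c c') \<and> (\<exists>r \<in> F (state c). d = finish a r c)"
    unfolding tm_step_def using perform_shift pos by metis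
  finally show ?thesis .
qed

lemma no_step_finish: "r \<in> F q \<Longrightarrow> \<not> tm_step M' (finish a r c) d"
  using F(2)[of q] final[of r] by (auto simp: tm_step_def)

text \<open>The copy mirrors \<open>M\<close> step by step until \<open>M\<close> halts; then the
  only freedom is the final state, and states 1 and 2 have no transitions.\<close>

lemma halting_iff:
  assumes "regular M c"
  shows "halting_path M' (shift_config s a c) ds \<longleftrightarrow>
    (\<exists>cs r. halting_path M c cs \<and> r \<in> F (state (last cs)) \<and>
       ds = map (shift_config s a) cs @ [finish a r (last cs)])"
  using assms
proof (induction ds arbitrary: c)
  case Nil
  show ?case by (auto simp: halting_computation_def computation_def)
next
  case (Cons d ds)
  let ?e = "shift_config s a"
  show ?case
  proof (cases "\<exists>c'. tm_step M c c'")
    case True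
    then have "halting_path M' (?e c) (d # ds) \<longleftrightarrow>
        d = ?e c \<and> (\<exists>c'. tm_step M c c' \<and> halting_path M' (?e c') ds)"
      by (subst halting_computation_unfold) (auto simp: step_iff[OF Cons.prems])
    also have "\<dots> \<longleftrightarrow> d = ?e c \<and> (\<exists>c' cs r. tm_step M c c' \<and> halting_path M c' cs \<and>
        r \<in> F (state (last cs)) \<and> ds = map ?e cs @ [finish a r (last cs)])"
      using Cons.IH regular_step[OF Cons.prems] by blast
    also have "\<dots> \<longleftrightarrow> (\<exists>cs r. halting_path M c cs \<and> r \<in> F (state (last cs)) \<and>
       d # ds = map ?e cs @ [finish a r (last cs)])"
    proof
      assume "d = ?e c \<and> (\<exists>c' cs r. tm_step M c c' \<and> halting_path M c' cs \<and>
        r \<in> F (state (last cs)) \<and> ds = map ?e cs @ [finish a r (last cs)])"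
      then obtain c' cs r where *: "d = ?e c" "tm_step M c c'" "halting_path M c' cs"
        "r \<in> F (state (last cs))" "ds = map ?e cs @ [finish a r (last cs)]" by blast
      moreover have "cs \<noteq> []" using *(3) by (auto simp: halting_computation_def computation_def)
      moreover have "halting_path M c (c # cs)"
        using * halting_computation_unfold by blast
      ultimately show "\<exists>cs r. halting_path M c cs \<and> r \<in> F (state (last cs)) \<and>
       d # ds = map ?e cs @ [finish a r (last cs)]"
        by (intro exI[of _ "c # cs"] exI[of _ r]) auto
    next
      assume "\<exists>cs r. halting_path M c cs \<and> r \<in> F (state (last cs)) \<and>
       d # ds = map ?e cs @ [finish a r (last cs)]"
      then obtain cs r where *: "halting_path M c cs" "r \<in> F (state (last cs))"
       "d # ds = map ?e cs @ [finish a r (last cs)]" by blast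
      then obtain cs' c' where "cs = c # cs'" "tm_step M c c'" "halting_path M c' cs'"
        using True halting_computation_unfold by blast
      moreover from this have "cs' \<noteq> []" by (auto simp: halting_computation_def computation_def)
      ultimately show "d = ?e c \<and> (\<exists>c' cs r. tm_step M c c' \<and> halting_path M c' cs \<and>
        r \<in> F (state (last cs)) \<and> ds = map ?e cs @ [finish a r (last cs)])"
        using *(2,3) by auto
    qed
    finally show ?thesis .
  next
    case False
    have fin: "halting_path M' (finish a r c) ds \<longleftrightarrow> ds = [finish a r c]" if "r \<in> F (state c)" for r
      by (subst halting_computation_unfold) (auto simp: no_step_finish[OF that])
    have "halting_path M c cs \<longleftrightarrow> cs = [c]" for cs
      using False by (subst halting_computation_unfold) auto
    moreover have "halting_path M' (?e c) (d # ds) \<longleftrightarrow>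
        d = ?e c \<and> (\<exists>r\<in>F (state c). ds = [finish a r c])"
      using False F(1)[of "state c"] fin
      by (subst halting_computation_unfold) (auto simp: step_iff[OF Cons.prems])
    ultimately show ?thesis by auto
  qed
qed

text \<open>For a fixed final state \<open>r\<close> the correspondence of
  \<open>halting_iff\<close> is injective, because renaming and shifting are.\<close>

lemma card_halting:
  assumes "regular M c"
  shows "card {ds. halting_path M' (shift_config s a c) ds \<and> state (last ds) = r} =
    card {cs. halting_path M c cs \<and> r \<in> F (state (last cs))}"
proof -
  let ?g = "\<lambda>cs. map (shift_config s a) cs @ [finish a r (last cs)]"
  have "{ds. halting_path M' (shift_config s a c) ds \<and> state (last ds) = r} =
      ?g ` {cs. halting_path M c cs \<and> r \<in> F (state (last cs))}"
    by (auto simp: halting_iff[OF assms])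
  moreover have "inj ?g"
    by (rule injI) (use inj_shift_config[OF s] in \<open>auto simp: inj_map_eq_map\<close>)
  ultimately show ?thesis
    by (simp add: card_image inj_on_subset)
qed

lemma computation_bound:
  assumes "regular M c" "computation (tm_step M') (shift_config s a c) ds"
  shows "\<exists>cs. computation (tm_step M) c cs \<and> length ds \<le> Suc (length cs)"
  using assms
proof (induction ds arbitrary: c)
  case Nil
  then show ?case by (simp add: computation_def)
next
  case (Cons d ds)
  have one: "computation (tm_step M) c [c]" by (simp add: computation_def)
  from Cons.prems(2) consider "ds = []" | d' where "tm_step M' (shift_config s a c) d'" "computation (tm_step M') d' ds"
    using computation_unfold by blast
  then show ?case
  proof cases
    case 1
    then show ?thesis using one by force
  next
    case 2
    from 2(1) consider c' where "tm_step M c c'" "d' = shift_config s a c'" | r where "r \<in> F (state c)" "d' = finish a r c"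
      using step_iff[OF Cons.prems(1)] by blast
    then show ?thesis
    proof cases
      case c': 1
      then obtain cs where "computation (tm_step M) c' cs" "length ds \<le> Suc (length cs)"
        using Cons.IH regular_step[OF Cons.prems(1)] 2(2) by blast
      moreover from this have "computation (tm_step M) c (c # cs)"
        using c' computation_unfold by blast
      ultimately show ?thesis by (intro exI[of _ "c # cs"]) auto
    next
      case r: 2
      then have "ds = [d']"
        using 2(2) no_step_finish[OF r(1)] by (subst (asm) computation_unfold) auto
      then show ?thesis using one by (intro exI[of _ "[c]"]) auto
    qed
  qed
qed

end

lemma finite_tm_alphabet: "wf_tm M \<Longrightarrow> finite (tm_alphabet M)"
  by (simp add: tm_alphabet_def finite_tm_syms)

lemma finite_extend_delta:
  assumes "wf_tm M" "\<And>q. F q \<subseteq> {1, 2}"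
  shows "finite (extend_delta M s F)"
proof -
  have "finite (F q)" for q using assms(2)[of q] finite_subset by blast
  then show ?thesis
    unfolding extend_delta_def using assms(1) finite_tm_states[OF assms(1)]
      finite_words[OF finite_tm_alphabet[OF assms(1)]]
    by (intro finite_UnI finite_imageI finite_Int disjI1 finite_SigmaI) (auto simp: wf_tm_def)
qed

lemma extend_delta_wf:
  assumes "wf_tm M" "(q, rs, q', as) \<in> extend_delta M s F"
  shows "length rs = tape_count M" "length as = tape_count M" "q \<in> range s"
  using assms by (fastforce simp: extend_delta_def wf_tm_def words_def idle_def)+

theorem sharpP_subset_gapP: "sharpP \<subseteq> gapP"
proof
  fix f assume "f \<in> sharpP"
  then obtain M where mach: "wf_tm M" "poly_time M" "\<And>x. f x = int (card (accepting_paths M x))"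
    by (auto simp: sharpP_def)
  \<comment> \<open>Adding 3 keeps 1 and 2 free. As 1 belongs to every \<open>F q\<close>, all paths
    of \<open>M\<close> get an accepting extension; only the rejecting ones also get a rejecting
    one.\<close>
  define s where "s = (\<lambda>q::nat. q + 3)"
  define F where "F = (\<lambda>q. if q = accept M then {1} else {1, 2::nat})"
  define M' :: tm where "M' = \<lparr>tape_count = tape_count M, start = s (start M), accept = 1, delta = extend_delta M s F\<rparr>"
  interpret extension M s F M'
  proof
    show "q \<notin> {1, 2}" if "(q, rs, q', as) \<in> delta M'" for q rs q' as
      using extend_delta_wf(3)[OF mach(1), of q rs q' as s F] that by (auto simp: M'_def s_def)
  qed (use mach(1) in \<open>auto simp: s_def F_def M'_def inj_def\<close>)
  have init: "init_config M' x = shift_config s 0 (init_config M x)" for x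
    by (auto simp: init_config_def shift_config_def M'_def fun_eq_iff)
  obtain p :: "nat poly" where p: "\<And>x cs. computation (tm_step M) (init_config M x) cs \<Longrightarrow> length cs - 1 \<le> poly p (length x)"
    using mach(2) by (auto simp: poly_time_def)
  have "wf_tm M'"
    using mach(1) finite_extend_delta[OF mach(1), of F s] extend_delta_wf(1,2)[OF mach(1)] F(2)
    by (auto simp: wf_tm_def M'_def)
  moreover have "poly_time M'"
    unfolding poly_time_def
  proof (intro exI[of _ "p + 1"] allI impI)
    fix x cs assume "computation (tm_step M') (init_config M' x) cs"
    then obtain ds where "computation (tm_step M) (init_config M x) ds" "length cs \<le> Suc (length ds)"
      unfolding init using computation_bound[OF regular_init] by blast
    then show "length cs - 1 \<le> poly (p + 1) (length x)"
      using p[of x ds] by simp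
  qed
  moreover have "f x = int (card (accepting_paths M' x)) - int (card (rejecting_paths M' x))" for x
  proof -
    let ?H = "\<lambda>P. {cs. halting_path M (init_config M x) cs \<and> P (state (last cs))}"
    have "card (accepting_paths M' x) = card (?H (\<lambda>q. 1 \<in> F q))"
      unfolding accepting_paths_def init using card_halting[OF regular_init, where r = 1]
      by (simp add: M'_def)
    also have "?H (\<lambda>q. 1 \<in> F q) = accepting_paths M x \<union> rejecting_paths M x"
      by (auto simp: F_def accepting_paths_def rejecting_paths_def)
    also have "card \<dots> = card (accepting_paths M x) + card (rejecting_paths M x)"
    proof (rule card_Un_disjoint)
      have "length cs \<le> Suc (poly p (length x))" if "computation (tm_step M) (init_config M x) cs" for cs
        using p[OF that] by simp
      then have fin: "finite {cs. halting_path M (init_config M x) cs}"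
        using card_halting_computations[of M "init_config M x" "poly p (length x)"] mach(1) by (auto simp: wf_tm_def)
      show "finite (accepting_paths M x)" "finite (rejecting_paths M x)"
        by (auto simp: accepting_paths_def rejecting_paths_def intro: finite_subset[OF _ fin])
    qed (auto simp: accepting_paths_def rejecting_paths_def)
    finally have acc: "card (accepting_paths M' x) = card (accepting_paths M x) + card (rejecting_paths M x)" .
    have "rejecting_paths M' x =
        {ds. halting_path M' (shift_config s 0 (init_config M x)) ds \<and> state (last ds) = 2}"
    proof -
      have "accept M' = 1" by (simp add: M'_def)
      moreover have "state (last ds) = 1 \<or> state (last ds) = 2"
        if "halting_path M' (shift_config s 0 (init_config M x)) ds" for ds
        using that by (auto simp: halting_iff[OF regular_init] dest: subsetD[OF F(2)])
      ultimately show ?thesis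
        unfolding rejecting_paths_def init by force
    qed
    then have "card (rejecting_paths M' x) = card (?H (\<lambda>q. 2 \<in> F q))"
      using card_halting[OF regular_init, where r = 2] by simp
    also have "?H (\<lambda>q. 2 \<in> F q) = rejecting_paths M x"
      by (auto simp: F_def rejecting_paths_def)
    finally show ?thesis using acc mach(3) by simp
  qed
  ultimately show "f \<in> gapP"
    unfolding gapP_def by blast
qed

text \<open>Parity separates the two copies of \<open>M\<close>, and the offset 3 avoids the start
  state 0 and the final states 1 and 2.\<close>

definition branch_state :: "bool \<Rightarrow> nat \<Rightarrow> nat" where
  "branch_state b q = 2 * q + 3 + of_bool b"

text \<open>State 1 is the accepting one: copy \<open>False\<close> accepts where \<open>M\<close>
  does, copy \<open>True\<close> where \<open>M\<close> rejects.\<close>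

definition branch_final :: "tm \<Rightarrow> bool \<Rightarrow> nat \<Rightarrow> nat set" where
  "branch_final M b q = (if (q = accept M) = b then {2} else {1})"

text \<open>Depending on the first input bit, counts the accepting or the rejecting paths of \<open>M\<close> on the
  remaining input.\<close>

definition split_tm :: "tm \<Rightarrow> tm" where
  "split_tm M = \<lparr>tape_count = tape_count M, start = 0, accept = 1,
     delta = (\<Union>b. insert (0, Bit b # replicate (tape_count M - 1) Blank, branch_state b (start M),
         (Blank, MRight) # replicate (tape_count M - 1) (Blank, MStay))
       (extend_delta M (branch_state b) (branch_final M b)))\<rparr>"

lemma split_tm_delta:
  "(q, rs, q', as) \<in> delta (split_tm M) \<longleftrightarrow> (\<exists>b. q = 0 \<and> rs = Bit b # replicate (tape_count M - 1) Blank \<and>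
      q' = branch_state b (start M) \<and> as = (Blank, MRight) # replicate (tape_count M - 1) (Blank, MStay) \<or>
     (q, rs, q', as) \<in> extend_delta M (branch_state b) (branch_final M b))"
  by (auto simp: split_tm_def)

lemma split_tm_sel: "start (split_tm M) = 0" "accept (split_tm M) = 1" "tape_count (split_tm M) = tape_count M"
  by (simp_all add: split_tm_def)

lemma branch_state_ge:
  assumes "wf_tm M" "(q, rs, q', as) \<in> extend_delta M (branch_state b) F"
  shows "3 \<le> q"
  using extend_delta_wf(3)[OF assms] by (auto simp: branch_state_def)

lemma split_tm_extension:
  assumes "wf_tm M"
  shows "extension M (branch_state b) (branch_final M b) (split_tm M)"
proof
  show "(branch_state b q, rs, q', as) \<in> delta (split_tm M) \<longleftrightarrow>
      (branch_state b q, rs, q', as) \<in> extend_delta M (branch_state b) (branch_final M b)" for q rs q' as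
  proof -
    have uniq: "b' = b" if b': "(branch_state b q, rs, q', as) \<in> extend_delta M (branch_state b') (branch_final M b')" for b'
    proof -
      obtain q1 where "branch_state b q = branch_state b' q1"
        using extend_delta_wf(3)[OF assms b'] by blast
      then show ?thesis by (cases b; cases b'; simp add: branch_state_def; presburger)
    qed
    have nz: "branch_state b q \<noteq> 0" by (simp add: branch_state_def)
    show ?thesis
      unfolding split_tm_delta
    proof (intro iffI)
      assume "(branch_state b q, rs, q', as) \<in> extend_delta M (branch_state b) (branch_final M b)"
      then show "\<exists>b'. branch_state b q = 0 \<and> rs = Bit b' # replicate (tape_count M - 1) Blank \<and>
          q' = branch_state b' (start M) \<and> as = (Blank, MRight) # replicate (tape_count M - 1) (Blank, MStay) \<or>
          (branch_state b q, rs, q', as) \<in> extend_delta M (branch_state b') (branch_final M b')"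
        by blast
    qed (use nz uniq in auto)
  qed
  show "q \<notin> {1, 2}" if "(q, rs, q', as) \<in> delta (split_tm M)" for q rs q' as
    using that unfolding split_tm_delta by (auto dest!: branch_state_ge[OF assms])
qed (use assms in \<open>auto simp: branch_state_def branch_final_def split_tm_def inj_def\<close>)

text \<open>The consumed bit is erased, so what remains is the initial configuration of
  \<open>M\<close> on \<open>x\<close> with cell 1 as origin.\<close>

lemma split_tm_first_step:
  assumes "wf_tm M"
  shows "tm_step (split_tm M) (init_config (split_tm M) (b # x)) d \<longleftrightarrow>
    d = shift_config (branch_state b) 1 (init_config M x)"
proof -
  let ?k = "tape_count M" and ?c = "init_config (split_tm M) (b # x)"
  have k: "2 \<le> ?k" using assms by (simp add: wf_tm_def)
  let ?rs = "Bit b # replicate (?k - 1) Blank"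
  let ?as = "(Blank, MRight) # replicate (?k - 1) (Blank, MStay)"
  have rs: "scanned (tape_count (split_tm M)) ?c = ?rs"
  proof (rule nth_equalityI)
    show "length (scanned (tape_count (split_tm M)) ?c) = length ?rs"
      using k by (simp add: scanned_def split_tm_sel)
    fix i assume "i < length (scanned (tape_count (split_tm M)) ?c)"
    then have "i < ?k" by (simp add: scanned_def split_tm_sel)
    then show "scanned (tape_count (split_tm M)) ?c ! i = ?rs ! i"
      by (cases i) (simp_all add: scanned_def init_config_def split_tm_sel write_tape_def)
  qed
  have "(0, ?rs, q, as) \<in> delta (split_tm M) \<longleftrightarrow> q = branch_state b (start M) \<and> as = ?as" for q as
    unfolding split_tm_delta by (auto dest!: branch_state_ge[OF assms])
  then have "tm_step (split_tm M) ?c d \<longleftrightarrow> d = perform (branch_state b (start M)) ?as ?c"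
    unfolding tm_step_def rs by (simp add: init_config_def split_tm_sel)
  also have "perform (branch_state b (start M)) ?as ?c = shift_config (branch_state b) 1 (init_config M x)"
  proof (rule config.equality)
    have nth: "?as ! j = (Blank, if j = 0 then MRight else MStay)" if "j < ?k" for j
      using that by (cases j) simp_all
    have len: "length ?as = ?k" using k by simp
    have w: "(write_tape (map Bit (b # x)))(0 := Blank) = (\<lambda>i. write_tape (map Bit x) (i - 1))"
    proof
      fix i :: int
      consider "i < 0" | "i = 0" | j where "i = 1 + int j"
        by (metis add.commute int_one_le_iff_zero_less linorder_cases nat_le_iff zle_iff_zadd zless_iff_Suc_zadd)
      then show "((write_tape (map Bit (b # x)))(0 := Blank)) i = write_tape (map Bit x) (i - 1)"
        by cases (auto simp: write_tape_def nat_add_distrib)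
    qed
    show "tape (perform (branch_state b (start M)) ?as ?c) = tape (shift_config (branch_state b) 1 (init_config M x))"
      unfolding perform_def len using k nth w
      by (auto simp: fun_eq_iff shift_config_def init_config_def) (auto simp: write_tape_def)
    show "pos (perform (branch_state b (start M)) ?as ?c) = pos (shift_config (branch_state b) 1 (init_config M x))"
      unfolding perform_def len using k nth by (auto simp: fun_eq_iff shift_config_def init_config_def)
  qed (simp_all add: perform_def shift_config_def init_config_def)
  finally show ?thesis .
qed

lemma card_split_tm:
  assumes "wf_tm M"
  shows "card (accepting_paths (split_tm M) (b # x)) =
    card (if b then rejecting_paths M x else accepting_paths M x)"
proof -
  interpret extension M "branch_state b" "branch_final M b" "split_tm M"
    by (rule split_tm_extension[OF assms])
  let ?c = "init_config (split_tm M) (b # x)"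
  let ?d = "shift_config (branch_state b) 1 (init_config M x)"
  let ?H = "{ds. halting_path (split_tm M) ?d ds \<and> state (last ds) = 1}"
  have "accepting_paths (split_tm M) (b # x) = (\<lambda>ds. ?c # ds) ` ?H"
  proof -
    have "accept (split_tm M) = 1" by (simp add: split_tm_def)
    moreover have "halting_path (split_tm M) ?c cs \<longleftrightarrow>
        (\<exists>ds. cs = ?c # ds \<and> halting_path (split_tm M) ?d ds)" for cs
      by (subst halting_computation_unfold) (auto simp: split_tm_first_step[OF assms])
    moreover have "ds \<noteq> []" if "halting_path (split_tm M) ?d ds" for ds
      using that by (simp add: halting_computation_def computation_def)
    ultimately show ?thesis
      unfolding accepting_paths_def by auto
  qed
  then have "card (accepting_paths (split_tm M) (b # x)) = card ?H"
    by (simp add: card_image)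
  also have "\<dots> = card {cs. halting_path M (init_config M x) cs \<and> 1 \<in> branch_final M b (state (last cs))}"
    by (rule card_halting[OF regular_init])
  also have "{cs. halting_path M (init_config M x) cs \<and> 1 \<in> branch_final M b (state (last cs))} =
      (if b then rejecting_paths M x else accepting_paths M x)"
    by (auto simp: branch_final_def accepting_paths_def rejecting_paths_def)
  finally show ?thesis .
qed

lemma split_tm_sharpP:
  assumes M: "wf_tm M" "poly_time M"
  shows "(\<lambda>x. int (card (accepting_paths (split_tm M) x))) \<in> sharpP"
proof -
  obtain p :: "nat poly" where p: "\<And>x cs. computation (tm_step M) (init_config M x) cs \<Longrightarrow> length cs - 1 \<le> poly p (length x)"
    using M(2) by (auto simp: poly_time_def)
  have "finite (delta (split_tm M))"
    unfolding split_tm_def using finite_extend_delta[OF M(1), of "branch_final M _"]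
    by (auto simp: branch_final_def)
  moreover have "2 \<le> tape_count M" using M(1) by (simp add: wf_tm_def)
  ultimately have "wf_tm (split_tm M)"
    using extend_delta_wf(1,2)[OF M(1)] by (auto simp: wf_tm_def split_tm_sel split_tm_delta)
  moreover have "poly_time (split_tm M)"
    unfolding poly_time_def
  proof (intro exI[of _ "p + 2"] allI impI)
    fix y cs assume cs: "computation (tm_step (split_tm M)) (init_config (split_tm M) y) cs"
    show "length cs - 1 \<le> poly (p + 2) (length y)"
    proof (cases y)
      case Nil
      \<comment> \<open>The start state has transitions only on a bit, so on the empty input the
        machine halts at once.\<close>
      have k: "0 < tape_count (split_tm M)" using M(1) by (simp add: wf_tm_def split_tm_def)
      have "scanned (tape_count (split_tm M)) (init_config (split_tm M) y) ! 0 = Blank"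
        using k Nil by (simp add: scanned_def init_config_def write_tape_def)
      moreover have "(0, rs, q, as) \<in> delta (split_tm M) \<Longrightarrow> rs ! 0 \<noteq> Blank" for rs q as
        unfolding split_tm_delta by (auto dest!: branch_state_ge[OF M(1)])
      ultimately have "\<not> tm_step (split_tm M) (init_config (split_tm M) y) d" for d
        unfolding tm_step_def by (metis init_config_def config.select_convs(1) split_tm_sel(1))
      then have "length cs = 1"
        using cs by (subst (asm) computation_unfold) auto
      then show ?thesis by simp
    next
      case (Cons b x)
      interpret extension M "branch_state b" "branch_final M b" "split_tm M"
        by (rule split_tm_extension[OF M(1)])
      from cs obtain ds where ds: "cs = init_config (split_tm M) y # ds"
        "ds = [] \<or> computation (tm_step (split_tm M)) (shift_config (branch_state b) 1 (init_config M x)) ds"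
        unfolding Cons by (subst (asm) computation_unfold) (auto simp: split_tm_first_step[OF M(1)])
      from ds(2) show ?thesis
      proof
        assume "computation (tm_step (split_tm M)) (shift_config (branch_state b) 1 (init_config M x)) ds"
        then obtain es where es: "computation (tm_step M) (init_config M x) es" "length ds \<le> Suc (length es)"
          using computation_bound[OF regular_init] by blast
        have "poly p (length x) \<le> poly p (length y)"
          by (rule poly_nat_mono) (simp add: Cons)
        then show ?thesis
          using p[OF es(1)] es(2) ds(1) by simp
      qed (use ds(1) in simp)
    qed
  qed
  ultimately show ?thesis
    unfolding sharpP_def by blast
qed

section \<open>Binary subtraction\<close>

text \<open>Subtraction with incoming borrow \<open>r\<close>, least significant digit first, the
  shorter operand being padded with zeros. The second result is the outgoing borrow.\<close>

fun sub :: "bool \<Rightarrow> bool list \<Rightarrow> bool list \<Rightarrow> bool list \<times> bool" where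
  "sub r [] [] = ([], r)"
| "sub r (a # as) [] = (let (ds, r') = sub (r \<and> \<not> a) as [] in ((a \<noteq> r) # ds, r'))"
| "sub r [] (b # bs) = (let (ds, r') = sub (b \<or> r) [] bs in ((b \<noteq> r) # ds, r'))"
| "sub r (a # as) (b # bs) = (let (ds, r') = sub (\<not> a \<and> b \<or> r \<and> a = b) as bs in (((a \<noteq> b) \<noteq> r) # ds, r'))"

fun val :: "bool list \<Rightarrow> int" where
  "val [] = 0"
| "val (b # bs) = of_bool b + 2 * val bs"

fun strip :: "bool list \<Rightarrow> bool list" where
  "strip [] = []"
| "strip (b # bs) = (if \<not> b \<and> strip bs = [] then [] else b # strip bs)"

lemma length_sub: "length (fst (sub r as bs)) = max (length as) (length bs)"
  by (induction r as bs rule: sub.induct) (auto simp: Let_def split: prod.splits)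

lemma val_sub:
  "val as - val bs - of_bool r =
     val (fst (sub r as bs)) - of_bool (snd (sub r as bs)) * 2 ^ length (fst (sub r as bs))"
proof (induction r as bs rule: sub.induct)
  case (2 r a as)
  then show ?case by (cases a; cases r) (auto simp: split_beta Let_def)
next
  case (3 r b bs)
  then show ?case by (cases b; cases r) (auto simp: split_beta Let_def)
next
  case (4 r a as b bs)
  then show ?case by (cases a; cases b; cases r) (auto simp: split_beta Let_def)
qed simp

lemma val_bounds: "0 \<le> val bs \<and> val bs < 2 ^ length bs"
  by (induction bs) (auto simp: of_bool_def)

lemma val_nat_bits: "val (nat_bits n) = int n"
proof (induction n rule: less_induct)
  case (less n)
  show ?case
  proof (cases "n = 0")
    case False
    then have "val (nat_bits n) = of_bool (odd n) + 2 * int (n div 2)"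
      using less by (subst nat_bits.simps) simp
    also have "\<dots> = int n" by (cases "even n") (auto elim!: evenE oddE)
    finally show ?thesis .
  qed (simp add: nat_bits.simps)
qed

lemma strip_Nil: "strip bs = [] \<longleftrightarrow> val bs = 0"
proof (induction bs)
  case (Cons b bs)
  then show ?case using val_bounds[of bs] by (auto simp: of_bool_def)
qed simp

lemma nat_bits_val: "nat_bits (nat (val bs)) = strip bs"
proof (induction bs)
  case Nil
  show ?case by (simp add: nat_bits.simps)
next
  case (Cons b bs)
  have v: "0 \<le> val bs" using val_bounds by blast
  show ?case
  proof (cases "val (b # bs) = 0")
    case True
    then have "strip (b # bs) = []" by (simp only: strip_Nil)
    moreover have "nat_bits (nat (val (b # bs))) = []" unfolding True by (simp add: nat_bits.simps[of 0])
    ultimately show ?thesis by simp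
  next
    case False
    define n where "n = nat (val (b # bs))"
    have n: "n = of_bool b + 2 * nat (val bs)" using v by (simp add: n_def nat_add_distrib nat_mult_distrib of_bool_def)
    have "n \<noteq> 0" using False v by (simp add: n_def of_bool_def split: if_splits)
    then have "nat_bits n = odd n # nat_bits (n div 2)" by (subst nat_bits.simps) simp
    also have "\<dots> = b # nat_bits (nat (val bs))" by (simp add: n)
    also have "nat_bits (nat (val bs)) = strip bs" by (rule Cons.IH)
    also have "b # strip bs = strip (b # bs)"
      using False strip_Nil[of bs] v by (auto simp: of_bool_def split: if_splits)
    finally show ?thesis by (simp only: n_def)
  qed
qed

lemma strip_decomp: "\<exists>j. bs = strip bs @ replicate j False"
proof (induction bs)
  case (Cons b bs)
  then obtain j where j: "bs = strip bs @ replicate j False" by blast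
  show ?case
  proof (cases "\<not> b \<and> strip bs = []")
    case True
    then have "b # bs = replicate (Suc j) False" using j by simp
    then show ?thesis using True by (intro exI[of _ "Suc j"]) simp
  next
    case False
    then show ?thesis using j by (intro exI[of _ j]) auto
  qed
qed simp

lemma last_strip: "strip bs \<noteq> [] \<Longrightarrow> last (strip bs)"
  by (induction bs) (auto split: if_splits)

text \<open>A final borrow reveals \<open>a < b\<close>; then the modulus is read off the opposite
  subtraction, which ends without a borrow.\<close>

lemma sub_int_syms:
  fixes a b :: nat
  defines "z \<equiv> int a - int b"
  shows "int_syms z = (if snd (sub False (nat_bits a) (nat_bits b))
    then Minus # map Bit (strip (fst (sub False (nat_bits b) (nat_bits a))))
    else map Bit (strip (fst (sub False (nat_bits a) (nat_bits b)))))"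
proof (cases "snd (sub False (nat_bits a) (nat_bits b))")
  case True
  let ?d = "fst (sub False (nat_bits a) (nat_bits b))" and ?e = "sub False (nat_bits b) (nat_bits a)"
  have neg: "z < 0"
    using val_sub[of "nat_bits a" "nat_bits b" False] val_bounds[of ?d] True by (simp add: val_nat_bits z_def)
  have "\<not> snd ?e"
    using val_sub[of "nat_bits b" "nat_bits a" False] val_bounds[of "fst ?e"] neg
    by (auto simp: val_nat_bits z_def)
  then have "val (fst ?e) = - z"
    using val_sub[of "nat_bits b" "nat_bits a" False] by (simp add: val_nat_bits z_def)
  then have "nat_bits (nat \<bar>z\<bar>) = strip (fst ?e)"
    using neg by (simp flip: nat_bits_val)
  then show ?thesis using True neg by (simp add: int_syms_def)
next
  case False
  let ?d = "fst (sub False (nat_bits a) (nat_bits b))"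
  have v: "val ?d = z"
    using val_sub[of "nat_bits a" "nat_bits b" False] False by (simp add: val_nat_bits z_def)
  then have "0 \<le> z" using val_bounds[of ?d] by simp
  then have "nat_bits (nat \<bar>z\<bar>) = strip ?d"
    using v by (simp flip: nat_bits_val)
  then show ?thesis using False \<open>0 \<le> z\<close> by (simp add: int_syms_def)
qed

text \<open>The digits of both differences share a work symbol, so one tape and one pass suffice;
  \<open>dec\<close> selects a component once the sign is known.\<close>

definition enc :: "bool \<times> bool \<Rightarrow> sym" where
  "enc p = Work (of_bool (fst p) + 2 * of_bool (snd p))"

definition dec :: "bool \<Rightarrow> sym \<Rightarrow> bool" where
  "dec neg x \<longleftrightarrow> (if neg then x \<in> {Work 2, Work 3} else x \<in> {Work 1, Work 3})"

lemma dec_enc: "dec neg (enc p) = (if neg then snd p else fst p)"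
  by (cases p; cases "fst p"; cases "snd p"; cases neg; simp add: dec_def enc_def)

lemma enc_not_Blank [simp]: "enc p \<noteq> Blank" "Blank \<notin> enc ` A"
  by (auto simp: enc_def)

text \<open>Subtracts tape 2 from tape \<open>iu\<close> and vice versa; the state holds the two borrows.\<close>

definition sub_aut :: "nat \<Rightarrow> nat \<Rightarrow> nat \<Rightarrow> aut" where
  "sub_aut iF iu iv = (\<lambda>q s. let a = (s iu = Bit True); b = (s 2 = Bit True); r1 = odd q; r2 = (2 \<le> q) in
     if s iu = Blank \<and> s 2 = Blank then (None, [(iF, Bit r1, MStay)])
     else (Some (of_bool (\<not> a \<and> b \<or> r1 \<and> a = b) + 2 * of_bool (\<not> b \<and> a \<or> r2 \<and> b = a)),
       [(iv, enc ((a \<noteq> b) \<noteq> r1, (b \<noteq> a) \<noteq> r2), MRight),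
        (iu, s iu, if s iu = Blank then MStay else MRight), (2, s 2, if s 2 = Blank then MStay else MRight)]))"

lemma sub_state: "odd (of_bool r1 + 2 * of_bool r2 :: nat) = r1" "(2 \<le> (of_bool r1 + 2 * of_bool r2 :: nat)) = r2"
  by (cases r1; cases r2; simp)+

lemma arun_eq: "arun k d q st t st' \<Longrightarrow> t = t' \<Longrightarrow> st' = st'' \<Longrightarrow> arun k d q st t' st''"
  by simp

text \<open>The state carries the borrow \<open>r1\<close> in the units and \<open>r2\<close> in the
  twos. The induction follows \<open>sub r1 as bs\<close>; the opposite subtraction consumes the
  same digits but has its own borrow, so \<open>r2\<close> is arbitrary.\<close>

lemma arun_sub:
  assumes "st iu = tz hu lu (map Bit as)" "st 2 = tz h2 l2 (map Bit bs)" "st iv = tz hv lv []" "st iF = tz hF [] [y]"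
    and k: "2 < iF" "2 < iu" "2 < iv" "distinct [iF, iu, iv]" "iF < k" "iu < k" "iv < k"
  shows "arun k (sub_aut iF iu iv) (of_bool r1 + 2 * of_bool r2) st (max (length as) (length bs) + 1)
    (st(iu := tz (hu + int (length as)) (map Bit (rev as) @ lu) [],
        2 := tz (h2 + int (length bs)) (map Bit (rev bs) @ l2) [],
        iv := tz (hv + int (max (length as) (length bs)))
          (rev (map enc (zip (fst (sub r1 as bs)) (fst (sub r2 bs as)))) @ lv) [],
        iF := tz hF [] [Bit (snd (sub r1 as bs))]))"
  using assms(1-4)
proof (induction r1 as bs arbitrary: r2 st hu lu h2 l2 hv lv rule: sub.induct)
  case (1 r)
  have e: "sub_aut iF iu iv (of_bool r + 2 * of_bool r2) (scan k st) = (None, [(iF, Bit r, MStay)])"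
    using 1 k by (simp add: sub_aut_def sub_state)
  have f: "st(iu := tz (hu + int (length ([] :: bool list))) (map Bit (rev []) @ lu) [],
        2 := tz (h2 + int (length ([] :: bool list))) (map Bit (rev []) @ l2) [],
        iv := tz (hv + int (max (length ([] :: bool list)) (length ([] :: bool list))))
          (rev (map enc (zip (fst (sub r [] [])) (fst (sub r2 [] [])))) @ lv) [],
        iF := tz hF [] [Bit (snd (sub r [] []))]) = app [(iF, Bit r, MStay)] st"
    using 1 k by (auto simp: fun_eq_iff)
  show ?case
    by (rule arun_eq[OF arun.stop[of "sub_aut iF iu iv" _ k st, OF e]], simp, rule f[symmetric])
next
  case (2 r a as)
  let ?q = "of_bool (r \<and> \<not> a) + 2 * of_bool (a \<or> r2) :: nat"
  let ?st = "st(iu := tz (hu + 1) (Bit a # lu) (map Bit as), iv := tz (hv + 1) (enc (a \<noteq> r, a \<noteq> r2) # lv) [])"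
  have e: "sub_aut iF iu iv (of_bool r + 2 * of_bool r2) (scan k st) = (Some ?q,
      [(iv, enc (a \<noteq> r, a \<noteq> r2), MRight), (iu, Bit a, MRight), (2, Blank, MStay)])" (is "_ = (_, ?al)")
    using 2 k by (cases a) (auto simp: sub_aut_def sub_state)
  have s: "app ?al st = ?st" using 2 k by (auto simp: fun_eq_iff)
  have IH: "arun k (sub_aut iF iu iv) ?q ?st (max (length as) (length ([] :: bool list)) + 1)
    (?st(iu := tz (hu + 1 + int (length as)) (map Bit (rev as) @ Bit a # lu) [],
        2 := tz (h2 + int (length ([] :: bool list))) (map Bit (rev []) @ l2) [],
        iv := tz (hv + 1 + int (max (length as) (length ([] :: bool list))))
          (rev (map enc (zip (fst (sub (r \<and> \<not> a) as [])) (fst (sub (a \<or> r2) [] as)))) @ enc (a \<noteq> r, a \<noteq> r2) # lv) [],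
        iF := tz hF [] [Bit (snd (sub (r \<and> \<not> a) as []))]))"
    by (rule "2.IH"[where st = ?st and hu = "hu + 1" and lu = "Bit a # lu" and hv = "hv + 1" and lv = "enc (a \<noteq> r, a \<noteq> r2) # lv" and ?h2.0 = h2 and ?l2.0 = l2 and ?r2.0 = "a \<or> r2"])
      (use 2(2-) k in auto)
  show ?case
  proof (rule arun_eq[OF arun.go[of "sub_aut iF iu iv" _ k st, OF e, unfolded s, OF IH]])
  qed (use 2(2-) k in \<open>auto simp: fun_eq_iff split_beta Let_def add.assoc\<close>)
next
  case (3 r b bs)
  let ?q = "of_bool (b \<or> r) + 2 * of_bool (r2 \<and> \<not> b) :: nat"
  let ?st = "st(2 := tz (h2 + 1) (Bit b # l2) (map Bit bs), iv := tz (hv + 1) (enc (b \<noteq> r, b \<noteq> r2) # lv) [])"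
  have e: "sub_aut iF iu iv (of_bool r + 2 * of_bool r2) (scan k st) = (Some ?q,
      [(iv, enc (b \<noteq> r, b \<noteq> r2), MRight), (iu, Blank, MStay), (2, Bit b, MRight)])" (is "_ = (_, ?al)")
    using 3 k by (cases b) (auto simp: sub_aut_def sub_state)
  have s: "app ?al st = ?st" using 3 k by (auto simp: fun_eq_iff)
  have IH: "arun k (sub_aut iF iu iv) ?q ?st (max (length ([] :: bool list)) (length bs) + 1)
    (?st(iu := tz (hu + int (length ([] :: bool list))) (map Bit (rev []) @ lu) [],
        2 := tz (h2 + 1 + int (length bs)) (map Bit (rev bs) @ Bit b # l2) [],
        iv := tz (hv + 1 + int (max (length ([] :: bool list)) (length bs)))
          (rev (map enc (zip (fst (sub (b \<or> r) [] bs)) (fst (sub (r2 \<and> \<not> b) bs [])))) @ enc (b \<noteq> r, b \<noteq> r2) # lv) [],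
        iF := tz hF [] [Bit (snd (sub (b \<or> r) [] bs))]))"
    by (rule "3.IH"[where st = ?st and hu = hu and lu = lu and hv = "hv + 1" and lv = "enc (b \<noteq> r, b \<noteq> r2) # lv" and ?h2.0 = "h2 + 1" and ?l2.0 = "Bit b # l2" and ?r2.0 = "r2 \<and> \<not> b"])
      (use 3(2-) k in auto)
  show ?case
  proof (rule arun_eq[OF arun.go[of "sub_aut iF iu iv" _ k st, OF e, unfolded s, OF IH]])
  qed (use 3(2-) k in \<open>auto simp: fun_eq_iff split_beta Let_def add.assoc\<close>)
next
  case (4 r a as b bs)
  let ?r1 = "\<not> a \<and> b \<or> r \<and> a = b" and ?r2 = "\<not> b \<and> a \<or> r2 \<and> b = a"
  let ?d = "enc ((a \<noteq> b) \<noteq> r, (b \<noteq> a) \<noteq> r2)"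
  let ?q = "of_bool ?r1 + 2 * of_bool ?r2 :: nat"
  let ?st = "st(iu := tz (hu + 1) (Bit a # lu) (map Bit as), 2 := tz (h2 + 1) (Bit b # l2) (map Bit bs), iv := tz (hv + 1) (?d # lv) [])"
  have e: "sub_aut iF iu iv (of_bool r + 2 * of_bool r2) (scan k st) = (Some ?q,
      [(iv, ?d, MRight), (iu, Bit a, MRight), (2, Bit b, MRight)])" (is "_ = (_, ?al)")
    using 4 k by (auto simp: sub_aut_def sub_state)
  have s: "app ?al st = ?st" using 4 k by (auto simp: fun_eq_iff)
  have IH: "arun k (sub_aut iF iu iv) ?q ?st (max (length as) (length bs) + 1)
    (?st(iu := tz (hu + 1 + int (length as)) (map Bit (rev as) @ Bit a # lu) [],
        2 := tz (h2 + 1 + int (length bs)) (map Bit (rev bs) @ Bit b # l2) [],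
        iv := tz (hv + 1 + int (max (length as) (length bs)))
          (rev (map enc (zip (fst (sub ?r1 as bs)) (fst (sub ?r2 bs as)))) @ ?d # lv) [],
        iF := tz hF [] [Bit (snd (sub ?r1 as bs))]))"
    by (rule "4.IH"[where st = ?st and hu = "hu + 1" and lu = "Bit a # lu" and hv = "hv + 1" and lv = "?d # lv" and ?h2.0 = "h2 + 1" and ?l2.0 = "Bit b # l2" and ?r2.0 = ?r2])
      (use 4(2-) k in auto)
  show ?case
  proof (rule arun_eq[OF arun.go[of "sub_aut iF iu iv" _ k st, OF e, unfolded s, OF IH]])
  qed (use 4(2-) k in \<open>auto simp: fun_eq_iff split_beta Let_def add.assoc\<close>)
qed

section \<open>Answering a GapP query by two queries to #P\<close>

abbreviation "erase_loop j \<equiv> Loop (\<lambda>s. s j \<noteq> Blank) (\<lambda>s. [(j, Blank, MLeft)])"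

abbreviation "erase_right j \<equiv> Loop (\<lambda>s. s j \<noteq> Blank) (\<lambda>s. [(j, Blank, MRight)])"

definition erase_left :: "nat \<Rightarrow> prog" where
  "erase_left j = Seq (do_left j)
     (Seq (erase_loop j) (do_right j))"

lemma runs_Loop_erase_left:
  assumes "st j = tz (h - 1) (tl l) [hdb l]" "Blank \<notin> set l" "j < k"
  shows "runs k f (erase_loop j) st (length l + 1)
    (st(j := tz (h - 1 - int (length l)) [] []))"
  using assms
proof (induction l arbitrary: st h)
  case Nil
  then show ?case by (intro runs_Loop_end) (auto simp: fun_eq_iff)
next
  case (Cons z l)
  show ?case
    by (rule runs_Loop_step[OF _ _ Cons.IH[of "st(j := tz (h - 1 - 1) (tl l) [hdb l])" "h - 1"]])
      (use Cons.prems in \<open>auto simp: fun_eq_iff algebra_simps\<close>)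
qed

lemma runs_erase_left:
  assumes "st j = tz h l []" "Blank \<notin> set l" "j < k"
  shows "runs k f (erase_left j) st (length l + 3) (st(j := tz (h - int (length l)) [] []))"
proof -
  let ?st1 = "st(j := tz (h - 1) (tl l) [hdb l])"
  let ?st2 = "st(j := tz (h - 1 - int (length l)) [] [])"
  have "runs k f (do_left j) st 1 ?st1"
    using assms by (intro runs_Do) (auto simp: fun_eq_iff)
  moreover have "runs k f (erase_loop j) ?st1 (length l + 1) ?st2"
    by (rule runs_eq[OF runs_Loop_erase_left[of ?st1 j h l]]) (use assms in \<open>auto simp: fun_eq_iff\<close>)
  moreover have "runs k f (do_right j) ?st2 1 (st(j := tz (h - int (length l)) [] []))"
    using assms by (intro runs_Do) (auto simp: fun_eq_iff algebra_simps)
  ultimately show ?thesis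
    unfolding erase_left_def by (intro runs_mono[OF runs_Seq[OF _ runs_Seq]]) auto
qed

lemma runs_Loop_erase_right:
  assumes "st j = tz h [] r" "Blank \<notin> set r" "j < k"
  shows "runs k f (erase_right j) st (length r + 1)
    (st(j := tz (h + int (length r)) [] []))"
  using assms
proof (induction r arbitrary: st h)
  case Nil
  then show ?case by (intro runs_Loop_end) (auto simp: fun_eq_iff)
next
  case (Cons z r)
  show ?case
    by (rule runs_Loop_step[OF _ _ Cons.IH[of "st(j := tz (h + 1) [] r)" "h + 1"]])
      (use Cons.prems in \<open>auto simp: fun_eq_iff algebra_simps\<close>)
qed

text \<open>The query tape of \<open>M\<close> may hold anything outside its query. The new query is
  written over it, and a blank behind the new query shields it from the old contents.\<close>

definition overwrite :: "(int \<Rightarrow> sym) \<Rightarrow> bool list \<Rightarrow> int \<Rightarrow> sym" where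
  "overwrite t ys = (\<lambda>i. if 0 \<le> i \<and> i < int (length ys) then Bit (ys ! nat i) else t i)"

lemma overwrite_Nil: "overwrite t [] = t"
  by (auto simp: overwrite_def fun_eq_iff)

lemma overwrite_snoc: "(overwrite t ys)(int (length ys) := Bit z) = overwrite t (ys @ [z])"
  by (auto simp: overwrite_def fun_eq_iff nth_append nat_less_iff)

lemma read_overwrite: "read_tape ((overwrite t ys)(int (length ys) := Blank)) = ys"
  by (rule read_tape_eqI) (auto simp: overwrite_def)

lemma Blank_notin_range_Bit [simp]: "Blank \<notin> range Bit"
  by auto

locale oracle_sim =
  fixes K :: nat
  assumes K: "3 \<le> K"
begin

text \<open>The first \<open>K\<close> tapes are those of the simulated machine, \<open>ip\<close> is the position mark of its query
  tape, \<open>ic\<close> the step counter, \<open>iq\<close> a copy of the query, \<open>iF\<close> a flag, \<open>iu\<close> the first answer and \<open>iv\<close> the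
  digits of the two differences.\<close>

abbreviation "ip \<equiv> K"
abbreviation "ic \<equiv> K + 1"
abbreviation "iq \<equiv> K + 2"
abbreviation "iF \<equiv> K + 3"
abbreviation "iu \<equiv> K + 4"
abbreviation "iv \<equiv> K + 5"
abbreviation "k \<equiv> K + 6"

abbreviation "copy_bits \<equiv> Loop (\<lambda>s. s 1 = Bit False \<or> s 1 = Bit True) (\<lambda>s. [(1, s 1, MRight), (iq, s 1, MRight)])"

abbreviation "back_both \<equiv> Loop (\<lambda>s. s iq \<noteq> Blank) (\<lambda>s. [(1, s 1, MLeft), (iq, s iq, MLeft)])"

text \<open>The query has to survive two oracle calls, each of which erases tape 1. The blank to the
  left of the copy leads both heads back to their starting cells.\<close>

definition copy_query :: prog where
  "copy_query = Seq copy_bits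
     (Seq (Do (\<lambda>s. [(1, s 1, MLeft), (iq, Blank, MLeft)]))
     (Seq back_both
     (Do (\<lambda>s. [(1, s 1, MRight), (iq, Blank, MRight), (iF, Bit False, MStay)]))))"

lemma runs_copy_bits:
  assumes "st 1 = (t, a)" "st iq = tz h l []"
    "\<And>i. i < length xs \<Longrightarrow> t (a + int i) = Bit (xs ! i)" "t (a + int (length xs)) \<notin> range Bit"
  shows "runs k f copy_bits st
    (length xs + 1) (st(1 := (t, a + int (length xs)), iq := tz (h + int (length xs)) (map Bit (rev xs) @ l) []))"
  using assms
proof (induction xs arbitrary: st a h l)
  case Nil
  then show ?case using K by (intro runs_Loop_end) (auto simp: fun_eq_iff rd_pair)
next
  case (Cons x xs)
  let ?st = "st(1 := (t, a + 1), iq := tz (h + 1) (Bit x # l) [])"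
  have 1: "t (a + 1 + int i) = Bit (xs ! i)" if "i < length xs" for i
    using Cons.prems(3)[of "Suc i"] that by (simp add: algebra_simps)
  have 2: "t (a + 1 + int (length xs)) \<notin> range Bit"
    using Cons.prems(4) by (simp add: algebra_simps)
  have 3: "t a = Bit x" using Cons.prems(3)[of 0] by simp
  show ?case
    by (rule runs_Loop_step[OF _ _ Cons.IH[of ?st "a + 1" "h + 1" "Bit x # l", OF _ _ 1 2]])
      (use Cons.prems(1,2) 3 K in \<open>auto simp: fun_eq_iff rd_pair wr_pair algebra_simps\<close>)
qed

lemma runs_back_both:
  assumes "st 1 = (t, a)" "st iq = tz (h - 1) (tl l) (hdb l # r)" "Blank \<notin> set l"
  shows "runs k f back_both st (length l + 1)
    (st(1 := (t, a - int (length l)), iq := tz (h - 1 - int (length l)) [] (Blank # rev l @ r)))"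
  using assms
proof (induction l arbitrary: st a h r)
  case Nil
  then show ?case using K by (intro runs_Loop_end) (auto simp: fun_eq_iff rd_pair)
next
  case (Cons z l)
  show ?case
    by (rule runs_Loop_step[OF _ _ Cons.IH[of "st(1 := (t, a - 1), iq := tz (h - 1 - 1) (tl l) (hdb l # z # r))" "a - 1" "h - 1" "z # r"]])
      (use Cons.prems K in \<open>auto simp: fun_eq_iff rd_pair wr_pair algebra_simps\<close>)
qed

lemma runs_copy_query:
  assumes "st 1 = (t, 0)" "st iq = tz h [] []" "st iF = tz hF [] [y]" "x = read_tape t" "t (int (length x)) \<notin> range Bit"
  shows "runs k f copy_query st (2 * length x + 4) (st(iq := tz h [] (map Bit x), iF := tz hF [] [Bit False]))"
proof -
  let ?n = "int (length x)" and ?l = "map Bit (rev x)"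
  let ?s1 = "st(1 := (t, ?n), iq := tz (h + ?n) ?l [])"
  let ?s2 = "st(1 := (t, ?n - 1), iq := tz (h + ?n - 1) (tl ?l) (hdb ?l # [Blank]))"
  let ?s3 = "st(1 := (t, - 1), iq := tz (h - 1) [] (Blank # rev ?l @ [Blank]))"
  have nth: "t (int i) = Bit (x ! i)" if "i < length x" for i
    using read_tape_nth[of t x] assms(4) that by simp
  have 1: "runs k f copy_bits st
      (length x + 1) ?s1"
    by (rule runs_eq[OF runs_copy_bits[of st t 0 h "[]" x]]) (use assms nth K in \<open>auto simp: fun_eq_iff\<close>)
  have 2: "runs k f (Do (\<lambda>s. [(1, s 1, MLeft), (iq, Blank, MLeft)])) ?s1 1 ?s2"
    by (rule runs_Do) (use K in \<open>auto simp: fun_eq_iff rd_pair wr_pair\<close>)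
  have 3: "runs k f back_both ?s2 (length x + 1) ?s3"
    by (rule runs_eq[OF runs_back_both[of ?s2 t "?n - 1" "h + ?n" ?l "[Blank]"]]) (use K in \<open>auto simp: fun_eq_iff\<close>)
  have 4: "runs k f (Do (\<lambda>s. [(1, s 1, MRight), (iq, Blank, MRight), (iF, Bit False, MStay)])) ?s3 1
      (st(iq := tz h [] (map Bit x), iF := tz hF [] [Bit False]))"
    by (rule runs_Do) (use K assms in \<open>auto simp: fun_eq_iff rd_pair wr_pair rev_map\<close>)
  show ?thesis
    unfolding copy_query_def by (rule runs_mono[OF runs_Seq[OF 1 runs_Seq[OF 2 runs_Seq[OF 3 4]]]]) simp
qed

abbreviation "write_bits \<equiv> Loop (\<lambda>s. s iq \<noteq> Blank) (\<lambda>s. [(1, s iq, MRight), (iq, s iq, MRight)])"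

text \<open>The flag on \<open>iF\<close> becomes the first bit of the query and so selects between
  the accepting and the rejecting paths counted by \<open>split_tm\<close>.\<close>

definition ask :: prog where
  "ask = Seq (Do (\<lambda>s. [(1, s iF, MRight)]))
     (Seq write_bits
     (Seq (Do (\<lambda>s. [(1, Blank, MStay)])) (Seq (go_left iq) Query)))"

lemma runs_write_bits:
  assumes "st 1 = (overwrite t ys, int (length ys))" "st iq = tz h l (map Bit xs)"
  shows "runs k f write_bits st (length xs + 1)
    (st(1 := (overwrite t (ys @ xs), int (length ys + length xs)), iq := tz (h + int (length xs)) (map Bit (rev xs) @ l) []))"
  using assms
proof (induction xs arbitrary: st ys h l)
  case Nil
  then show ?case using K by (intro runs_Loop_end) (auto simp: fun_eq_iff rd_pair)
next
  case (Cons x xs)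
  have a: "app [(1, Bit x, MRight), (iq, Bit x, MRight)] st =
      st(1 := (overwrite t (ys @ [x]), int (length (ys @ [x]))), iq := tz (h + 1) (Bit x # l) (map Bit xs))"
    using Cons.prems K by (simp add: wr_pair overwrite_snoc fun_upd_twist add.commute)
  show ?case
    by (rule runs_Loop_step[OF _ _ Cons.IH[of "st(1 := (overwrite t (ys @ [x]), int (length (ys @ [x]))), iq := tz (h + 1) (Bit x # l) (map Bit xs))"
      "ys @ [x]" "h + 1" "Bit x # l"]])
      (use Cons.prems K a in \<open>auto simp: algebra_simps simp del: app_Cons\<close>)
qed

lemma runs_ask:
  assumes "st 1 = (t, 0)" "st iq = tz h [] (map Bit x)" "st iF = tz hF [] [Bit b]"
  shows "runs k f ask st (2 * length x + 7) (st(1 := tz 0 [] [], 2 := tz 0 [] (int_syms (f (b # x)))))"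
proof -
  let ?n = "int (length x)"
  let ?s1 = "st(1 := (overwrite t [b], 1))"
  let ?s2 = "st(1 := (overwrite t (b # x), int (length (b # x))), iq := tz (h + ?n) (map Bit (rev x)) [])"
  let ?T = "((overwrite t (b # x))(int (length (b # x)) := Blank), int (length (b # x)))"
  let ?s3 = "st(1 := ?T, iq := tz (h + ?n) (map Bit (rev x)) [])"
  let ?s4 = "st(1 := ?T)"
  have 1: "runs k f (Do (\<lambda>s. [(1, s iF, MRight)])) st 1 ?s1"
    using overwrite_snoc[of t "[]" b] by (intro runs_Do) (use assms K in \<open>auto simp: fun_eq_iff wr_pair overwrite_Nil\<close>)
  have 2: "runs k f write_bits ?s1 (length x + 1) ?s2"
    by (rule runs_eq[OF runs_write_bits[of ?s1 t "[b]" h "[]" x]]) (use assms K in \<open>auto simp: fun_eq_iff\<close>)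
  have 3: "runs k f (Do (\<lambda>s. [(1, Blank, MStay)])) ?s2 1 ?s3"
    by (rule runs_Do) (use K in \<open>auto simp: wr_pair fun_upd_twist\<close>)
  have 4: "runs k f (go_left iq) ?s3 (length x + 3) ?s4"
    by (rule runs_eq[OF runs_go_left[of ?s3 iq "h + ?n" "map Bit (rev x)" "[]"]])
      (use assms K in \<open>auto simp: fun_eq_iff rev_map\<close>)
  have r: "read_tape (fst (?s4 1)) = b # x"
    using read_overwrite[of t "b # x"] by simp
  have 5: "runs k f Query ?s4 1 (st(1 := tz 0 [] [], 2 := tz 0 [] (int_syms (f (b # x)))))"
    by (rule runs_eq[OF runs_Query]) (use r in \<open>auto simp: tz_write\<close>)
  show ?thesis
    unfolding ask_def by (rule runs_mono[OF runs_Seq[OF 1 runs_Seq[OF 2 runs_Seq[OF 3 runs_Seq[OF 4 5]]]]]) simp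
qed

abbreviation "save_bits \<equiv> Loop (\<lambda>s. s iF = Bit False \<and> s 2 \<noteq> Blank) (\<lambda>s. [(2, s 2, MRight), (iu, s 2, MRight)])"

abbreviation "next_flag \<equiv> Do (\<lambda>s. [(iF, if s iF = Bit False then Bit True else Work 0, MStay)])"

text \<open>Only the first answer moves to \<open>iu\<close>; in the second round the flag is set,
  the loop ends at once and the answer stays on tape 2. The flag passes from 0 to 1 to
  \<open>Work 0\<close>, which ends \<open>two_queries\<close>.\<close>

definition save_answer :: prog where
  "save_answer = Seq save_bits
     (Seq (go_left iu) next_flag)"

lemma runs_save_bits:
  assumes "st 2 = tz h2 l2 (map Bit xs)" "st iu = tz hu lu []" "st iF = tz hF [] [Bit False]"
  shows "runs k f save_bits st (length xs + 1)
    (st(2 := tz (h2 + int (length xs)) (map Bit (rev xs) @ l2) [], iu := tz (hu + int (length xs)) (map Bit (rev xs) @ lu) []))"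
  using assms
proof (induction xs arbitrary: st h2 l2 hu lu)
  case Nil
  then show ?case using K by (intro runs_Loop_end) (auto simp: fun_eq_iff)
next
  case (Cons x xs)
  show ?case
    by (rule runs_Loop_step[OF _ _ Cons.IH[of "st(2 := tz (h2 + 1) (Bit x # l2) (map Bit xs), iu := tz (hu + 1) (Bit x # lu) [])"
      "h2 + 1" "Bit x # l2" "hu + 1" "Bit x # lu"]])
      (use Cons.prems K in \<open>auto simp: fun_eq_iff algebra_simps\<close>)
qed

text \<open>A loop instead of two copies of \<open>ask\<close>, because the compiled program may
  contain \<open>Query\<close> only once.\<close>

definition two_queries :: prog where
  "two_queries = While (\<lambda>s. s iF = Bit False \<or> s iF = Bit True) (Seq ask save_answer)"

lemma int_syms_nat: "int_syms (int n) = map Bit (nat_bits n)"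
  by (simp add: int_syms_def)

lemma runs_two_queries:
  assumes "st 1 = (t, 0)" "st iq = tz h [] (map Bit x)" "st iF = tz hF [] [Bit False]" "st iu = tz hu [] []"
    and f: "f (False # x) = int a" "f (True # x) = int b"
  shows "runs k f two_queries st (4 * length x + 2 * length (nat_bits a) + 30)
    (st(1 := tz 0 [] [], 2 := tz 0 [] (map Bit (nat_bits b)), iu := tz hu [] (map Bit (nat_bits a)), iF := tz hF [] [Work 0]))"
proof -
  let ?a = "nat_bits a" and ?b = "nat_bits b"
  let ?s1 = "st(1 := tz 0 [] [], 2 := tz 0 [] (map Bit ?a))"
  have 1: "runs k f ask st (2 * length x + 7) ?s1"
    by (rule runs_eq[OF runs_ask[of st t h x hF False]]) (use assms in \<open>auto simp: int_syms_nat\<close>)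
  let ?s2 = "?s1(2 := tz (int (length ?a)) (map Bit (rev ?a)) [], iu := tz (hu + int (length ?a)) (map Bit (rev ?a)) [])"
  have 2: "runs k f save_bits ?s1 (length ?a + 1) ?s2"
    by (rule runs_eq[OF runs_save_bits[of ?s1 0 "[]" ?a hu "[]" hF]]) (use assms K in \<open>auto simp: fun_eq_iff\<close>)
  let ?s3 = "?s2(iu := tz hu [] (map Bit ?a))"
  have 3: "runs k f (go_left iu) ?s2 (length ?a + 3) ?s3"
    by (rule runs_eq[OF runs_go_left[of ?s2 iu "hu + int (length ?a)" "map Bit (rev ?a)" "[]"]])
      (use assms K in \<open>auto simp: fun_eq_iff rev_map\<close>)
  let ?s4 = "?s3(iF := tz hF [] [Bit True])"
  have 4: "runs k f next_flag ?s3 1 ?s4"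
    by (rule runs_Do) (use assms K in \<open>auto simp: fun_eq_iff\<close>)
  have first: "runs k f (Seq ask save_answer) st (2 * length x + 2 * length ?a + 12) ?s4"
    unfolding save_answer_def by (rule runs_mono[OF runs_Seq[OF 1 runs_Seq[OF 2 runs_Seq[OF 3 4]]]]) simp
  let ?s5 = "?s4(1 := tz 0 [] [], 2 := tz 0 [] (map Bit ?b))"
  have 5: "runs k f ask ?s4 (2 * length x + 7) ?s5"
    by (rule runs_eq[OF runs_ask[of ?s4 "\<lambda>_. Blank" h x hF True]]) (use assms K in \<open>auto simp: int_syms_nat tz_blank\<close>)
  have 6: "runs k f save_bits ?s5 1 ?s5"
    by (rule runs_Loop_end) (use K in auto)
  have 7: "runs k f (go_left iu) ?s5 3 ?s5"
    by (rule runs_eq[OF runs_go_left[of ?s5 iu hu "[]" "map Bit ?a"]]) (use K in \<open>auto simp: fun_eq_iff\<close>)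
  let ?s6 = "st(1 := tz 0 [] [], 2 := tz 0 [] (map Bit ?b), iu := tz hu [] (map Bit ?a), iF := tz hF [] [Work 0])"
  have 8: "runs k f next_flag ?s5 1 ?s6"
    by (rule runs_Do) (use K in \<open>auto simp: fun_eq_iff\<close>)
  have second: "runs k f (Seq ask save_answer) ?s4 (2 * length x + 12) ?s6"
    unfolding save_answer_def by (rule runs_mono[OF runs_Seq[OF 5 runs_Seq[OF 6 runs_Seq[OF 7 8]]]]) simp
  have fin: "runs k f two_queries ?s6 1 ?s6"
    unfolding two_queries_def by (rule runs_While_False) (use K in auto)
  have "runs k f two_queries ?s4 (Suc (2 * length x + 12 + 1)) ?s6"
    unfolding two_queries_def
    by (rule runs_While_True[OF _ second fin[unfolded two_queries_def]]) (use K in auto)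
  then have "runs k f two_queries st (Suc (2 * length x + 2 * length ?a + 12 + Suc (2 * length x + 12 + 1))) ?s6"
    unfolding two_queries_def
    by (intro runs_While_True[OF _ first]) (use K assms in auto)
  then show ?thesis by (rule runs_mono) simp
qed

abbreviation "drop_zeros \<equiv> Loop (\<lambda>s. s iv \<noteq> Blank \<and> \<not> dec (s iF = Bit True) (s iv)) (\<lambda>s. [(iv, Blank, MLeft)])"

abbreviation "write_digits \<equiv> Loop (\<lambda>s. s iv \<noteq> Blank) (\<lambda>s. [(2, Bit (dec (s iF = Bit True) (s iv)), MRight), (iv, Blank, MRight)])"

abbreviation "put_sign \<equiv> Do (\<lambda>s. (iv, Blank, MRight) # (if s iF = Bit True then [(2, Minus, MRight)] else []))"

definition write_answer :: prog where
  "write_answer = Seq (do_left iv)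
     (Seq drop_zeros
     (Seq (scan_left iv)
     (Seq put_sign
     (Seq write_digits
     (go_left 2)))))"

lemma runs_drop_zeros:
  assumes "st iv = tz (h - 1) (tl (l @ l')) [hdb (l @ l')]" "st iF = tz hF [] [Bit neg]"
    "\<And>x. x \<in> set l \<Longrightarrow> x \<noteq> Blank \<and> \<not> dec neg x" "l' = [] \<or> dec neg (hdb l')"
  shows "runs k f drop_zeros st (length l + 1)
    (st(iv := tz (h - 1 - int (length l)) (tl l') [hdb l']))"
  using assms
proof (induction l arbitrary: st h)
  case Nil
  then show ?case by (intro runs_Loop_end) (auto simp: fun_eq_iff)
next
  case (Cons z l)
  show ?case
    by (rule runs_Loop_step[OF _ _ Cons.IH[of "st(iv := tz (h - 1 - 1) (tl (l @ l')) [hdb (l @ l')])" "h - 1"]])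
      (use Cons.prems in \<open>auto simp: fun_eq_iff algebra_simps\<close>)
qed

lemma runs_write_digits:
  assumes "st iv = tz h [] r" "st 2 = tz h2 l2 []" "st iF = tz hF [] [Bit neg]" "Blank \<notin> set r"
  shows "runs k f write_digits st (length r + 1)
    (st(iv := tz (h + int (length r)) [] [], 2 := tz (h2 + int (length r)) (rev (map (\<lambda>x. Bit (dec neg x)) r) @ l2) []))"
  using assms
proof (induction r arbitrary: st h h2 l2)
  case Nil
  then show ?case using K by (intro runs_Loop_end) (auto simp: fun_eq_iff)
next
  case (Cons z r)
  show ?case
    by (rule runs_Loop_step[OF _ _ Cons.IH[of "st(iv := tz (h + 1) [] r, 2 := tz (h2 + 1) (Bit (dec neg z) # l2) [])" "h + 1" "h2 + 1" "Bit (dec neg z) # l2"]])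
      (use Cons.prems K in \<open>auto simp: fun_eq_iff algebra_simps\<close>)
qed

lemma runs_write_answer:
  assumes "st iv = tz h (rev (map enc ps)) []" "st 2 = tz 0 [] []" "st iF = tz hF [] [Bit neg]"
    and ds: "ds = map (if neg then snd else fst) ps"
  shows "\<exists>h'. runs k f write_answer st (3 * length ps + 20)
    (st(iv := tz h' [] [], 2 := tz 0 [] ((if neg then [Minus] else []) @ map Bit (strip ds))))"
proof -
  obtain j where j: "ds = strip ds @ replicate j False"
    using strip_decomp by blast
  define m where "m = length (strip ds)"
  define p1 where "p1 = take m ps"
  define p2 where "p2 = drop m ps"
  have len: "length ds = length ps" by (simp add: ds)
  have ps: "ps = p1 @ p2" by (simp add: p1_def p2_def)
  have sel1: "map (if neg then snd else fst) p1 = strip ds"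
  proof -
    have "map (if neg then snd else fst) p1 = take m ds" by (simp add: p1_def ds take_map)
    also have "\<dots> = strip ds" by (subst j) (simp add: m_def)
    finally show ?thesis .
  qed
  have sel2: "map (if neg then snd else fst) p2 = replicate j False"
  proof -
    have "map (if neg then snd else fst) p2 = drop m ds" by (simp add: p2_def ds drop_map)
    also have "\<dots> = replicate j False" by (subst j) (simp add: m_def)
    finally show ?thesis .
  qed
  let ?l = "rev (map enc p2)" and ?l' = "rev (map enc p1)"
  let ?s1 = "st(iv := tz (h - 1) (tl (?l @ ?l')) [hdb (?l @ ?l')])"
  have 1: "runs k f (do_left iv) st 1 ?s1"
    by (rule runs_Do) (use assms(1) in \<open>auto simp: fun_eq_iff ps\<close>)
  let ?s2 = "st(iv := tz (h - 1 - int (length ?l)) (tl ?l') [hdb ?l'])"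
  have 2: "runs k f drop_zeros ?s1 (length ?l + 1) ?s2"
  proof (rule runs_eq[OF runs_drop_zeros[of ?s1 h ?l ?l' hF neg]])
    show "?s1 iF = tz hF [] [Bit neg]" using assms(3) by simp
    fix x assume "x \<in> set ?l"
    then obtain p where p: "p \<in> set p2" "x = enc p" by auto
    have "(if neg then snd else fst) p \<in> set (map (if neg then snd else fst) p2)" using p(1) by auto
    then have "\<not> (if neg then snd else fst) p" unfolding sel2 by auto
    then show "x \<noteq> Blank \<and> \<not> dec neg x" using p(2) by (auto simp: dec_enc)
  next
    show "?l' = [] \<or> dec neg (hdb ?l')"
    proof (cases p1 rule: rev_cases)
      case (snoc p1' p)
      then have "strip ds = map (if neg then snd else fst) p1' @ [(if neg then snd else fst) p]"
        using sel1 by simp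
      then have "(if neg then snd else fst) p" using last_strip[of ds] by simp
      then show ?thesis using snoc by (auto simp: dec_enc)
    qed simp
  qed (auto simp: fun_eq_iff)
  let ?s3 = "st(iv := tz (h - 1 - int (length ?l) - int (length ?l')) [] (Blank # map enc p1))"
  have 3: "runs k f (scan_left iv) ?s2 (length ?l' + 1) ?s3"
    by (rule runs_eq[OF runs_Loop_left[of ?s2 iv "h - int (length ?l)" ?l' "[]"]])
      (auto simp: fun_eq_iff algebra_simps)
  let ?h = "h - int (length ?l) - int (length ?l')"
  let ?pre = "if neg then [Minus] else []"
  let ?s4 = "st(iv := tz ?h [] (map enc p1), 2 := tz (int (length ?pre)) ?pre [])"
  have 4: "runs k f put_sign ?s3 1 ?s4"
    by (rule runs_Do) (use assms(2,3) K in \<open>auto simp: fun_eq_iff algebra_simps\<close>)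
  let ?r = "rev (map Bit (strip ds)) @ ?pre"
  let ?s5 = "st(iv := tz (?h + int (length p1)) [] [], 2 := tz (int (length ?r)) ?r [])"
  have bits: "map (\<lambda>x. Bit (dec neg x)) (map enc p1) = map Bit (strip ds)"
    by (simp add: dec_enc flip: sel1)
  have 5: "runs k f write_digits ?s4
      (length p1 + 1) ?s5"
  proof (rule runs_eq[OF runs_write_digits[of ?s4 ?h "map enc p1" "int (length ?pre)" ?pre hF neg]])
    have "length p1 = length (strip ds)" using arg_cong[OF sel1, of length] by simp
    then show "?s4(iv := tz (?h + int (length (map enc p1))) [] [],
        2 := tz (int (length ?pre) + int (length (map enc p1))) (rev (map (\<lambda>x. Bit (dec neg x)) (map enc p1)) @ ?pre) []) = ?s5"
      unfolding bits by (auto simp: fun_eq_iff algebra_simps)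
  qed (use assms(3) K in auto)
  have 6: "runs k f (go_left 2) ?s5 (length ?r + 3) (st(iv := tz (?h + int (length p1)) [] [], 2 := tz 0 [] (?pre @ map Bit (strip ds))))"
    by (rule runs_eq[OF runs_go_left[of ?s5 2 "int (length ?r)" ?r "[]"]]) (use K in \<open>auto simp: fun_eq_iff\<close>)
  have l: "length p1 + length p2 = length ps" "length (strip ds) = length p1"
    using ps arg_cong[OF sel1, of length] by auto
  show ?thesis
    unfolding write_answer_def
    by (rule exI, rule runs_mono[OF runs_Seq[OF 1 runs_Seq[OF 2 runs_Seq[OF 3 runs_Seq[OF 4 runs_Seq[OF 5 6]]]]]])
      (use l in auto)
qed

text \<open>Stands in for one oracle step of \<open>M\<close>: tapes 1 and 2 end up as
  \<open>oracle_reply\<close> leaves them, and \<open>iq\<close>, \<open>iu\<close>,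
  \<open>iv\<close> are blank again. The step counter is kept, because it has to bound the later
  segments too.\<close>

definition reply :: prog where
  "reply = Seq (home 1 ip ic) (Seq copy_query (Seq two_queries (Seq (Aut 4 (sub_aut iF iu iv))
     (Seq (erase_left 2) (Seq (erase_left iu) (Seq write_answer
       (erase_right iq)))))))"

lemma runs_reply:
  assumes "st 1 = (t, p)" "st ip = (mark 0, p)" "st ic = tz hc (replicate n (Work 0)) []" "\<bar>p\<bar> \<le> int n"
    "st iq = tz hq [] []" "st iF = tz hF [] [y]" "st iu = tz hu [] []" "st iv = tz hv [] []"
    "x = read_tape t" "t (int (length x)) \<notin> range Bit"
    and f: "f (False # x) = int a" "f (True # x) = int b"
  shows "\<exists>hq' hu' hv' y'. runs k f reply st (4 * n + 8 * length x + 10 * (length (nat_bits a) + length (nat_bits b)) + 90)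
    (st(1 := tz 0 [] [], 2 := tz 0 [] (int_syms (int a - int b)), ip := (mark 0, 0),
       iq := tz hq' [] [], iF := tz hF [] [y'], iu := tz hu' [] [], iv := tz hv' [] []))"
proof -
  let ?a = "nat_bits a" and ?b = "nat_bits b"
  let ?m = "max (length ?a) (length ?b)"
  let ?s1 = "st(1 := (t, 0), ip := (mark 0, 0))"
  have 1: "runs k f (home 1 ip ic) st (4 * n + 5) ?s1"
    by (rule runs_home[of st 1 t 0 p ip 0 ic hc n]) (use assms K in auto)
  let ?s2 = "?s1(iq := tz hq [] (map Bit x), iF := tz hF [] [Bit False])"
  have 2: "runs k f copy_query ?s1 (2 * length x + 4) ?s2"
    by (rule runs_copy_query[of ?s1 t hq hF y x]) (use assms K in auto)
  let ?s3 = "?s2(1 := tz 0 [] [], 2 := tz 0 [] (map Bit ?b), iu := tz hu [] (map Bit ?a), iF := tz hF [] [Work 0])"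
  have 3: "runs k f two_queries ?s2 (4 * length x + 2 * length ?a + 30) ?s3"
    by (rule runs_two_queries[of ?s2 t hq x hF hu f a b]) (use assms K in auto)
  let ?D1 = "fst (sub False ?a ?b)" and ?D2 = "fst (sub False ?b ?a)" and ?neg = "snd (sub False ?a ?b)"
  let ?ps = "zip ?D1 ?D2"
  let ?s4 = "?s3(iu := tz (hu + int (length ?a)) (map Bit (rev ?a)) [], 2 := tz (int (length ?b)) (map Bit (rev ?b)) [],
     iv := tz (hv + int ?m) (rev (map enc ?ps)) [], iF := tz hF [] [Bit ?neg])"
  have 4: "runs k f (Aut 4 (sub_aut iF iu iv)) ?s3 (?m + 1) ?s4"
  proof (rule runs_eq[OF runs_Aut])
    show "arun k (sub_aut iF iu iv) 0 ?s3 (?m + 1)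
      (?s3(iu := tz (hu + int (length ?a)) (map Bit (rev ?a) @ []) [],
        2 := tz (0 + int (length ?b)) (map Bit (rev ?b) @ []) [],
        iv := tz (hv + int ?m) (rev (map enc ?ps) @ []) [],
        iF := tz hF [] [Bit ?neg]))"
      using arun_sub[of ?s3 iu hu "[]" ?a 0 "[]" ?b iv hv "[]" iF hF "Work 0" k False False] assms K by simp
  qed auto
  let ?s5 = "?s4(2 := tz 0 [] [])"
  have 5: "runs k f (erase_left 2) ?s4 (length ?b + 3) ?s5"
    by (rule runs_eq[OF runs_erase_left[of ?s4 2 "int (length ?b)" "map Bit (rev ?b)"]]) (use K in \<open>auto simp: fun_eq_iff\<close>)
  let ?s6 = "?s5(iu := tz hu [] [])"
  have 6: "runs k f (erase_left iu) ?s5 (length ?a + 3) ?s6"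
    by (rule runs_eq[OF runs_erase_left[of ?s5 iu "hu + int (length ?a)" "map Bit (rev ?a)"]]) (use K in \<open>auto simp: fun_eq_iff\<close>)
  have sel: "(if ?neg then ?D2 else ?D1) = map (if ?neg then snd else fst) ?ps"
    using length_sub[of False ?a ?b] length_sub[of False ?b ?a] by (simp add: max.commute)
  have len: "length ?ps = ?m"
    using length_sub[of False ?a ?b] length_sub[of False ?b ?a] by (simp add: max.commute)
  obtain h' where 7: "runs k f write_answer ?s6 (3 * length ?ps + 20)
     (?s6(iv := tz h' [] [], 2 := tz 0 [] ((if ?neg then [Minus] else []) @ map Bit (strip (if ?neg then ?D2 else ?D1)))))"
    using runs_write_answer[of ?s6 "hv + int ?m" ?ps hF ?neg, OF _ _ _ sel] K by auto
  have z: "(if ?neg then [Minus] else []) @ map Bit (strip (if ?neg then ?D2 else ?D1)) = int_syms (int a - int b)"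
    by (simp add: sub_int_syms)
  let ?s7 = "?s6(iv := tz h' [] [], 2 := tz 0 [] (int_syms (int a - int b)))"
  have 7: "runs k f write_answer ?s6 (3 * length ?ps + 20) ?s7"
    using 7 unfolding z .
  have 8: "runs k f (erase_right iq) ?s7 (length x + 1)
     (st(1 := tz 0 [] [], 2 := tz 0 [] (int_syms (int a - int b)), ip := (mark 0, 0),
       iq := tz (hq + int (length x)) [] [], iF := tz hF [] [Bit ?neg], iu := tz hu [] [], iv := tz h' [] []))"
    by (rule runs_eq[OF runs_Loop_erase_right[of ?s7 iq hq "map Bit x"]]) (use K in \<open>auto simp: fun_eq_iff\<close>)
  show ?thesis
    unfolding reply_def
    by (rule exI[of _ "hq + int (length x)"], rule exI[of _ hu], rule exI[of _ h'], rule exI[of _ "Bit ?neg"],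
      rule runs_mono[OF runs_Seq[OF 1 runs_Seq[OF 2 runs_Seq[OF 3 runs_Seq[OF 4 runs_Seq[OF 5 runs_Seq[OF 6 runs_Seq[OF 7 8]]]]]]]])
      (use len in auto)
qed

lemma wf_prog_reply:
  assumes "basic \<subseteq> S"
  shows "wf_prog k S reply"
proof -
  have b: "Blank \<in> S" "Work 0 \<in> S" "Minus \<in> S" "Bit b \<in> S" for b
    using assms by (cases b; auto simp: basic_def)+
  have "enc p \<in> S" for p
    using assms by (cases p; cases "fst p"; cases "snd p"; auto simp: enc_def basic_def numeral_2_eq_2 numeral_3_eq_3)
  then have "wf_prog k S (Aut 4 (sub_aut iF iu iv))"
    using b K by (auto simp: sub_aut_def Let_def of_bool_def)
  then show ?thesis
    using b K assms by (auto simp: reply_def copy_query_def two_queries_def ask_def save_answer_def erase_left_def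
        write_answer_def wf_prog_home wf_prog_go_left)
qed

lemma queries_reply: "queries reply = 1"
  by (simp add: reply_def copy_query_def two_queries_def ask_def save_answer_def erase_left_def write_answer_def)

end

section \<open>E with GapP oracles\<close>

lemma runs_SeqE:
  assumes "runs k f (Seq p q) st n st2"
  obtains st1 n1 n2 where "runs k f p st n1 st1" "runs k f q st1 n2 st2" "n1 + n2 \<le> n"
proof -
  obtain t where t: "t \<le> n" "exec k f (Seq p q) st t st2"
    using assms by (auto simp: runs_def)
  from t(2) obtain t1 t2 st1 where "exec k f p st t1 st1" "exec k f q st1 t2 st2" "t = t1 + t2"
    by (cases rule: exec.cases) auto
  then show thesis
    using that[of t1 st1 t2] t(1) by (auto simp: runs_def)
qed

lemma read_tape_end: "t (int n) \<notin> range Bit \<Longrightarrow> t (int (length (read_tape t))) \<notin> range Bit \<and> length (read_tape t) \<le> n"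
  using LeastI[of "\<lambda>n. t (int n) \<notin> range Bit" n] Least_le[of "\<lambda>n. t (int n) \<notin> range Bit" n]
  by (simp add: read_tape_def)

text \<open>Up to the first query all steps are ordinary ones and can be left to the embedded
  machine. A halting run never ends in the query state, since a reply is always possible
  there.\<close>

lemma otm_segment:
  assumes "(otm_step f M ^^ T) c c'" "\<nexists>c''. otm_step f M c' c''"
  shows "\<exists>T1 c1. (tm_step_until M {query M} ^^ T1) c c1 \<and>
    (T1 = T \<and> c1 = c' \<and> state c' \<noteq> query M \<or>
     T1 < T \<and> state c1 = query M \<and> (otm_step f M ^^ (T - Suc T1)) (oracle_reply f M c1) c')"
  using assms(1)
proof (induction T arbitrary: c)
  case 0
  have "state c' \<noteq> query M"
    using assms(2) by (auto simp: otm_step_def)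
  then show ?case using 0 by (intro exI[of _ 0] exI[of _ c']) auto
next
  case (Suc T)
  then obtain c2 where c2: "otm_step f M c c2" "(otm_step f M ^^ T) c2 c'"
    by (meson relpowp_Suc_D2)
  show ?case
  proof (cases "state c = query M")
    case True
    then show ?thesis
      using c2 otm_step_def[of f M c c2] by (intro exI[of _ 0] exI[of _ c]) auto
  next
    case False
    then have s: "tm_step_until M {query M} c c2"
      using c2(1) by (auto simp: otm_step_def tm_step_until_def)
    obtain T1 c1 where *: "(tm_step_until M {query M} ^^ T1) c2 c1"
      "T1 = T \<and> c1 = c' \<and> state c' \<noteq> query M \<or>
       T1 < T \<and> state c1 = query M \<and> (otm_step f M ^^ (T - Suc T1)) (oracle_reply f M c1) c'"
      using Suc.IH[OF c2(2)] by blast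
    have "(tm_step_until M {query M} ^^ Suc T1) c c1"
      using s *(1) by (rule relpowp_Suc_I2)
    moreover have "Suc T1 = Suc T \<and> c1 = c' \<and> state c' \<noteq> query M \<or>
       Suc T1 < Suc T \<and> state c1 = query M \<and> (otm_step f M ^^ (Suc T - Suc (Suc T1))) (oracle_reply f M c1) c'"
      using *(2) by simp
    ultimately show ?thesis by blast
  qed
qed

locale gap_sim = oracle_sim "tape_count M" for M :: otm +
  fixes f f' :: "bool list \<Rightarrow> int" and acc rej :: "bool list \<Rightarrow> nat" and bits :: "nat \<Rightarrow> nat"
  assumes M: "wf_tm M" "deterministic M"
    and f: "f x = int (acc x) - int (rej x)"
    and f': "f' (False # x) = int (acc x)" "f' (True # x) = int (rej x)"
    and bits: "length x \<le> n \<Longrightarrow> length (nat_bits (acc x)) \<le> bits n" "length x \<le> n \<Longrightarrow> length (nat_bits (rej x)) \<le> bits n"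
begin

text \<open>\<open>Work 0\<close> calls for a reply; a bit says that \<open>M\<close> has halted,
  and with which verdict.\<close>

definition flag :: "nat \<Rightarrow> sym" where
  "flag q = (if q = query M then Work 0 else Bit (q = accept M))"

definition states_bound :: nat where
  "states_bound = Suc (Max (insert (start M) (insert (answer M) (tm_states M))))"

definition run_M :: "nat \<Rightarrow> prog" where
  "run_M q = Aut (Suc states_bound) (embed_aut M {query M} 0 ip ic (\<lambda>q. [(iF, flag q, MStay)]) q)"

definition serve :: prog where
  "serve = While (\<lambda>s. s iF = Work 0) (Seq reply (run_M (answer M)))"

text \<open>Holds at the start and after each reply. Embedded tapes have their true origins; the
  counter goes on from the \<open>n\<close> steps made so far. In \<open>near\<close> the input
  length is 0, as the query tape starts empty.\<close>

definition ready :: "config \<Rightarrow> nat \<Rightarrow> store \<Rightarrow> bool" where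
  "ready c n st \<longleftrightarrow> (\<forall>j<tape_count M. st j = (tape c j, pos c j)) \<and> pos c 1 = 0 \<and>
     wr (Work 0, MStay) (st ip) = (mark 0, 0) \<and> (\<exists>h. st ic = tz h (replicate n (Work 0)) []) \<and>
     (\<exists>h. st iq = tz h [] []) \<and> (\<exists>h. st iu = tz h [] []) \<and> (\<exists>h. st iv = tz h [] []) \<and>
     (\<exists>h y. st iF = tz h [] [y]) \<and> near 0 n (tape c 1) (pos c 1)"

lemma runs_run_M:
  assumes "ready c n st" "(tm_step_until M {query M} ^^ T) c c1" "state c1 = query M \<or> (\<nexists>c''. tm_step M c1 c'')"
  shows "\<exists>st1. runs k f' (run_M (state c)) st (T + 2) st1 \<and>
    (\<forall>j<tape_count M. st1 j = (tape c1 j, pos c1 j)) \<and> st1 ip = (mark 0, pos c1 1) \<and>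
    (\<exists>h. st1 ic = tz h (replicate (n + T) (Work 0)) []) \<and>
    (\<exists>h. st1 iq = tz h [] []) \<and> (\<exists>h. st1 iu = tz h [] []) \<and> (\<exists>h. st1 iv = tz h [] []) \<and>
    (\<exists>h. st1 iF = tz h [] [flag (state c1)]) \<and> near 0 (n + T) (tape c1 1) (pos c1 1)"
proof -
  let ?K = "tape_count M"
  obtain hc where hc: "st ic = tz (hc + int n) (replicate n (Work 0)) []"
    using assms(1) unfolding ready_def by (metis diff_add_cancel)
  have e: "st(ip := wr (Work 0, MStay) (st ip)) = embed_store ?K 0 ip ic st (\<lambda>_. 0) 0 hc n c"
    using assms(1) hc by (auto simp: fun_eq_iff embed_store_def ready_def)
  let ?st1 = "app [(iF, flag (state c1), MStay)] (embed_store ?K 0 ip ic st (\<lambda>_. 0) 0 hc (n + T) c1)"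
  have "runs k f' (run_M (state c)) st (T + 2) ?st1"
    unfolding run_M_def
    by (rule embed_runs[OF assms(2) _ M(2,1) _ _ _ _ _ _ e, where fl = "\<lambda>q. [(iF, flag q, MStay)]"]) (use assms(3) in auto)
  moreover have "near 0 (n + T) (tape c1 1) (pos c1 1)"
    using near_steps[OF assms(2)] assms(1) unfolding ready_def by blast
  ultimately show ?thesis
    using assms(1) K by (intro exI[of _ ?st1]) (auto simp: embed_store_def ready_def)
qed

text \<open>One segment with the reply that ends it: 13 = 1 + 4 + 8 collects the steps of the
  segment, the search for the origin and the handling of the query; each of the two answers
  contributes 10 times its length.\<close>

definition cost :: "nat \<Rightarrow> nat" where
  "cost z = 13 * z + 20 * bits (z + 1) + 110"

text \<open>Induction on the steps left. A segment that ends in a query also consumes the query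
  step, so there are at most \<open>T + 1\<close> segments; \<open>n + T\<close> does not grow from
  one to the next, so a single \<open>z\<close> bounds the cost of all.\<close>

lemma runs_serve:
  assumes "ready c n st" "(otm_step f M ^^ T) c c'" "\<nexists>c''. otm_step f M c' c''" "n + T \<le> z"
  shows "\<exists>st'. runs k f' (Seq (run_M (state c)) serve) st (Suc T * cost z) st' \<and>
    (rd (st' iF) = Bit True \<longleftrightarrow> state c' = accept M)"
  using assms(1,2,4)
proof (induction T arbitrary: c n st rule: less_induct)
  case (less T)
  obtain T1 c1 where T1: "(tm_step_until M {query M} ^^ T1) c c1"
    and alt: "T1 = T \<and> c1 = c' \<and> state c' \<noteq> query M \<or>
     T1 < T \<and> state c1 = query M \<and> (otm_step f M ^^ (T - Suc T1)) (oracle_reply f M c1) c'"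
    using otm_segment[OF less.prems(2) assms(3)] by blast
  have stop: "state c1 = query M \<or> (\<nexists>c''. tm_step M c1 c'')"
    using alt assms(3) by (auto simp: otm_step_def)
  obtain st1 where r1: "runs k f' (run_M (state c)) st (T1 + 2) st1"
    and st1: "\<And>j. j < tape_count M \<Longrightarrow> st1 j = (tape c1 j, pos c1 j)" "st1 ip = (mark 0, pos c1 1)"
      "\<exists>h. st1 ic = tz h (replicate (n + T1) (Work 0)) []"
      "\<exists>h. st1 iq = tz h [] []" "\<exists>h. st1 iu = tz h [] []" "\<exists>h. st1 iv = tz h [] []"
      "\<exists>h. st1 iF = tz h [] [flag (state c1)]" and near: "near 0 (n + T1) (tape c1 1) (pos c1 1)"
    using runs_run_M[OF less.prems(1) T1 stop] by blast
  obtain hc hq hu hv hF where h: "st1 ic = tz hc (replicate (n + T1) (Work 0)) []" "st1 iq = tz hq [] []"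
      "st1 iu = tz hu [] []" "st1 iv = tz hv [] []" "st1 iF = tz hF [] [flag (state c1)]"
    using st1 by blast
  from alt show ?case
  proof (elim disjE conjE)
    assume *: "T1 = T" "c1 = c'" "state c' \<noteq> query M"
    have "runs k f' serve st1 1 st1"
      unfolding serve_def by (rule runs_While_False) (use h(5) * in \<open>auto simp: flag_def\<close>)
    with r1 have "runs k f' (Seq (run_M (state c)) serve) st (T1 + 2 + 1) st1"
      by (rule runs_Seq)
    moreover have "T1 + 2 + 1 \<le> Suc T * cost z"
      using less.prems(3) * by (simp add: cost_def)
    ultimately show ?thesis
      using * h(5) by (intro exI[of _ st1]) (auto elim!: runs_mono simp: flag_def)
  next
    assume *: "T1 < T" "state c1 = query M" "(otm_step f M ^^ (T - Suc T1)) (oracle_reply f M c1) c'"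
    let ?c2 = "oracle_reply f M c1"
    define x where "x = read_tape (tape c1 1)"
    \<comment> \<open>Cells farther than \<open>n + T1\<close> from the origin are unvisited, so the
      query ends there at the latest.\<close>
    have "tape c1 1 (int (n + T1 + 1)) = Blank"
      using near by (fastforce simp: near_def)
    then have x: "tape c1 1 (int (length x)) \<notin> range Bit" "length x \<le> n + T1 + 1"
      using read_tape_end[of "tape c1 1" "n + T1 + 1"] by (simp_all add: x_def)
    obtain hq' hu' hv' y' where r2: "runs k f' reply st1
        (4 * (n + T1) + 8 * length x + 10 * (length (nat_bits (acc x)) + length (nat_bits (rej x))) + 90)
       (st1(1 := tz 0 [] [], 2 := tz 0 [] (int_syms (int (acc x) - int (rej x))), ip := (mark 0, 0),
         iq := tz hq' [] [], iF := tz hF [] [y'], iu := tz hu' [] [], iv := tz hv' [] []))"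
      using runs_reply[of st1 "tape c1 1" "pos c1 1" hc "n + T1" hq hF "flag (state c1)" hu hv x f' "acc x" "rej x"]
        st1(1)[of 1] st1(2) h x near f' K by (auto simp: x_def near_def)
    let ?st2 = "st1(1 := tz 0 [] [], 2 := tz 0 [] (int_syms (int (acc x) - int (rej x))), ip := (mark 0, 0),
         iq := tz hq' [] [], iF := tz hF [] [y'], iu := tz hu' [] [], iv := tz hv' [] [])"
    have ready: "ready ?c2 (n + T1) ?st2"
      unfolding ready_def
    proof (intro conjI allI impI)
      fix j assume "j < tape_count M"
      then show "?st2 j = (tape ?c2 j, pos ?c2 j)"
        using st1(1)[of j] K by (auto simp: oracle_reply_def f x_def simp flip: tz_write)
    qed (use h K in \<open>auto simp: oracle_reply_def near_def write_tape_def wr_pair mark_def fun_eq_iff\<close>)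
    have "T - Suc T1 < T" using *(1) by simp
    moreover have "n + T1 + (T - Suc T1) \<le> z" using less.prems(3) *(1) by simp
    ultimately obtain st' where
      r3: "runs k f' (Seq (run_M (state ?c2)) serve) ?st2 (Suc (T - Suc T1) * cost z) st'"
      and st': "rd (st' iF) = Bit True \<longleftrightarrow> state c' = accept M"
      using less.IH[OF _ ready *(3)] by blast
    have "state ?c2 = answer M" by (simp add: oracle_reply_def)
    with r3 obtain st3 n1 n2 where r4: "runs k f' (run_M (answer M)) ?st2 n1 st3" "runs k f' serve st3 n2 st'"
      and n12: "n1 + n2 \<le> Suc (T - Suc T1) * cost z"
      by (auto elim: runs_SeqE)
    let ?R = "4 * (n + T1) + 8 * length x + 10 * (length (nat_bits (acc x)) + length (nat_bits (rej x))) + 90"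
    have "runs k f' serve st1 (Suc (?R + n1 + n2)) st'"
      unfolding serve_def
      by (rule runs_While_True[OF _ runs_Seq[OF r2 r4(1)] r4(2)[unfolded serve_def]])
        (use h(5) *(2) in \<open>auto simp: flag_def\<close>)
    with r1 have "runs k f' (Seq (run_M (state c)) serve) st (T1 + 2 + Suc (?R + n1 + n2)) st'"
      by (rule runs_Seq)
    moreover have "T1 + 2 + Suc (?R + n1 + n2) \<le> Suc T * cost z"
    proof -
      have "length x \<le> z + 1" using x(2) less.prems(3) *(1) by simp
      then have "length (nat_bits (acc x)) \<le> bits (z + 1)" "length (nat_bits (rej x)) \<le> bits (z + 1)"
        using bits by blast+
      then have "T1 + 2 + Suc ?R \<le> cost z"
        using \<open>length x \<le> z + 1\<close> less.prems(3) *(1) by (simp add: cost_def)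
      moreover have "Suc (T - Suc T1) * cost z \<le> T * cost z"
        using *(1) by (intro mult_right_mono) auto
      ultimately show ?thesis using n12 by simp
    qed
    ultimately show ?thesis
      using st' by (intro exI[of _ st']) (auto elim!: runs_mono)
  qed
qed

lemma ready_init: "ready (init_config M x) 0 (init_store x)"
  using K by (auto simp: ready_def init_config_def init_store_def near_def wr_pair mark_def fun_eq_iff write_tape_def
      tz_def nth_blank_def)

definition sim_prog :: prog where
  "sim_prog = Seq (run_M (start M)) serve"

lemma wf_sim_prog:
  assumes "S = basic \<union> tm_syms M"
  shows "wf_prog k S sim_prog"
proof -
  have "q < states_bound" if "q \<in> insert (start M) (insert (answer M) (tm_states M))" for q
    unfolding states_bound_def less_Suc_eq_le using that finite_tm_states[OF M(1)] by (intro Max_ge) auto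
  moreover have "flag q \<in> basic" for q
    by (cases "q = accept M") (auto simp: flag_def basic_def)
  ultimately have "wf_prog k S (run_M q)" if "q \<in> {start M, answer M}" for q
    unfolding run_M_def using that assms by (intro embed_wf M(1)) auto
  then show ?thesis
    using wf_prog_reply[of S] assms by (auto simp: sim_prog_def serve_def)
qed

lemma queries_sim_prog: "queries sim_prog = 1"
  by (simp add: sim_prog_def serve_def run_M_def queries_reply)

end

text \<open>With branching B and time t there are at most B^t paths, so a count has O(t) digits;
  this keeps the subtraction polynomial in the length of the query.\<close>

lemma length_nat_bits_path_count:
  assumes M: "wf_tm M" "\<And>x cs. computation (tm_step M) (init_config M x) cs \<Longrightarrow> length cs - 1 \<le> poly p (length x)"
    and "length x \<le> n" "X \<subseteq> {cs. halting_path M (init_config M x) cs}"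
  shows "length (nat_bits (card X)) \<le> tm_bound M * poly p n + 1"
proof -
  let ?H = "{cs. halting_path M (init_config M x) cs}"
  let ?e = "poly p (length x)"
  have "length cs \<le> Suc ?e" if "computation (tm_step M) (init_config M x) cs" for cs
    using M(2)[OF that] by simp
  then have H: "finite ?H" "card ?H \<le> tm_bound M ^ ?e"
    using card_halting_computations[of M "init_config M x" ?e] M(1) by (auto simp: wf_tm_def)
  have "card X \<le> tm_bound M ^ ?e"
    using card_mono[OF H(1) assms(4)] H(2) by simp
  also have "\<dots> \<le> (2 ^ tm_bound M) ^ ?e"
    by (intro power_mono less_imp_le[OF less_exp]) simp
  also have "\<dots> = 2 ^ (tm_bound M * ?e)" by (simp add: power_mult)
  also have "\<dots> < 2 ^ (tm_bound M * ?e + 1)" by simp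
  finally have "length (nat_bits (card X)) \<le> tm_bound M * ?e + 1"
    unfolding length_nat_bits .
  also have "\<dots> \<le> tm_bound M * poly p n + 1"
    using poly_nat_mono[OF assms(3), of p] by simp
  finally show ?thesis .
qed

theorem E_oracle_gapP_subset: "E_oracle gapP \<subseteq> E_oracle sharpP"
proof
  fix A assume "A \<in> E_oracle gapP"
  then obtain f M c where f: "f \<in> gapP" and M: "wf_otm M" "deterministic M"
    and run: "\<And>x. \<exists>cs. halting_computation (otm_step f M) (init_config M x) cs \<and>
        length cs - 1 \<le> 2 ^ (c * length x + c) \<and> (state (last cs) = accept M \<longleftrightarrow> x \<in> A)"
    unfolding E_oracle_def by blast
  obtain N where N: "wf_tm N" "poly_time N"
    "\<And>x. f x = int (card (accepting_paths N x)) - int (card (rejecting_paths N x))"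
    using f by (auto simp: gapP_def)
  obtain p :: "nat poly" where p: "\<And>x cs. computation (tm_step N) (init_config N x) cs \<Longrightarrow> length cs - 1 \<le> poly p (length x)"
    using N(2) by (auto simp: poly_time_def)
  define f' where "f' = (\<lambda>x. int (card (accepting_paths (split_tm N) x)))"
  interpret gap_sim M f f' "\<lambda>x. card (accepting_paths N x)" "\<lambda>x. card (rejecting_paths N x)"
    "\<lambda>n. tm_bound N * poly p n + 1"
  proof
    show "3 \<le> tape_count M" "wf_tm M" "deterministic M" using M by (auto simp: wf_otm_def)
    show "f' (False # x) = int (card (accepting_paths N x))" "f' (True # x) = int (card (rejecting_paths N x))" for x
      using card_split_tm[OF N(1), of _ x] by (simp_all add: f'_def)
    show "length (nat_bits (card (accepting_paths N x))) \<le> tm_bound N * poly p n + 1"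
      "length (nat_bits (card (rejecting_paths N x))) \<le> tm_bound N * poly p n + 1" if "length x \<le> n" for x n
      by (rule length_nat_bits_path_count[OF N(1) p that];
          auto simp: accepting_paths_def rejecting_paths_def)+
  qed (rule N(3))
  \<comment> \<open>130 is the constant 110 of \<open>cost\<close> plus 20 times the summand 1 in
    the bound on the number of digits.\<close>
  define q :: "nat poly" where "q = [:1, 1:] * ([:130, 13:] + smult (20 * tm_bound N) (pcompose p [:1, 1:]))"
  have q: "poly q z = Suc z * cost z" for z
    unfolding cost_def by (simp add: q_def poly_pcompose algebra_simps)
  obtain c' where c': "\<And>n. poly q (2 ^ (c * n + c)) \<le> 2 ^ (c' * n + c')"
    using poly_exp_bound[of q c] by blast
  have "f' \<in> sharpP"
    unfolding f'_def by (rule split_tm_sharpP[OF N(1,2)])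
  then show "A \<in> E_oracle sharpP"
  proof (rule E_oracleI[OF _ _ _ _ wf_sim_prog[OF refl] queries_sim_prog])
    fix x :: "bool list"
    let ?z = "2 ^ (c * length x + c) :: nat"
    obtain cs where cs: "halting_computation (otm_step f M) (init_config M x) cs" "length cs - 1 \<le> ?z"
      "state (last cs) = accept M \<longleftrightarrow> x \<in> A"
      using run by blast
    define T where "T = length cs - 1"
    have "cs \<noteq> []" using cs(1) by (simp add: halting_computation_def computation_def)
    then have "length cs = Suc T" by (simp add: T_def)
    then have "(otm_step f M ^^ T) (init_config M x) (last cs)"
      using cs(1) relpowp_computation by (auto simp: halting_computation_def)
    moreover have "\<nexists>c''. otm_step f M (last cs) c''"
      using cs(1) by (simp add: halting_computation_def)
    moreover have "0 + T \<le> ?z" using cs(2) by (simp add: T_def)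
    ultimately obtain st' where st': "runs k f' (Seq (run_M (state (init_config M x))) serve) (init_store x) (Suc T * cost ?z) st'"
      "rd (st' iF) = Bit True \<longleftrightarrow> state (last cs) = accept M"
      using runs_serve[OF ready_init] by blast
    have "Suc T * cost ?z \<le> poly q ?z"
      unfolding q using cs(2) by (intro mult_right_mono) (auto simp: T_def)
    also have "\<dots> \<le> 2 ^ (c' * length x + c')" by (rule c')
    finally have "runs k f' sim_prog (init_store x) (2 ^ (c' * length x + c')) st'"
      using st'(1) runs_mono by (auto simp: sim_prog_def init_config_def)
    then show "\<exists>st'. runs k f' sim_prog (init_store x) (2 ^ (c' * length x + c')) st' \<and>
        (scan k st' iF = Bit True \<longleftrightarrow> x \<in> A)"
      using st'(2) cs(3) by (intro exI[of _ st']) auto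
  qed (use K M finite_tm_syms[of M] in \<open>auto simp: basic_def wf_otm_def\<close>)
qed

theorem mainTheorem12:
  shows "\<not> measure_zero sharpP (E_oracle sharpP)
    \<and> \<not> measure_zero spanP (E_oracle spanP)
    \<and> (E_oracle sharpP = E_oracle gapP \<and> \<not> measure_zero gapP (E_oracle gapP))"
proof -
  have "E_oracle sharpP \<subseteq> E_oracle gapP"
    using sharpP_subset_gapP unfolding E_oracle_def by blast
  then show ?thesis
    using not_measure_zero_E_oracle E_oracle_gapP_subset by blast
qed

end
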